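(* Let $(M,\omega)$ be a compact $2n$-dimensional symplectic manifold with reference volume form $d\mu=\omega^n$, normalized so that $\int_M d\mu=1$. Let $\mathcal{D}$ be the group of all orientation preserving diffeomorphisms of $M$ with the symplectic structure $W^{\mathcal{D}}$, let $\mathrm{Dens}$ be the space of smooth volume forms on $M$ with total integral $1$ with the Poisson structure $\{\cdot,\cdot\}_{\mathrm{Dens}}$, and let $\pi:\mathcal{D}\to\mathrm{Dens}$, $\pi(\phi)=\phi_*(d\mu)$. Then the symplectic structure $W^{\mathcal{D}}$ on the diffeomorphism group $\mathcal{D}$ descends, under the projection $\pi$, to the Poisson structure $\{\cdot,\cdot\}_{\mathrm{Dens}}$ on $\mathrm{Dens}$.
   Context: The tangent space to $\mathcal{D}$ at $\phi$ is $T_\phi\mathcal{D}=\{X\circ\phi \mid X\in\mathfrak{X}\}$, where $\mathfrak{X}$ is the Lie algebra of all smooth vector fields on $M$. The symplectic form $W^{\mathcal{D}}$ is defined by $$W^{\mathcal{D}}(X\circ\phi,Y\circ\phi):=\int_M\omega(X\circ\phi(x),Y\circ\phi(x))\,d\mu(x)=\int_M\omega(X,Y)\,\phi_*d\mu .$$ Conventions: the Hamiltonian vector field $X_f$ of $f\in C^\infty(M)$ satisfies $\omega(X_f,Y)=df(Y)$ for all vector fields $Y$, and $\{f,g\}=\omega(X_f,X_g)$. Likewise on $\mathcal{D}$, the Hamiltonian field $X_{\bar F}$ of a functional $\bar F$ (when it exists) satisfies $W^{\mathcal{D}}(X_{\bar F}(\phi),Y\circ\phi)=\langle d\bar F,Y\circ\phi\rangle$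 for all $Y\in\mathfrak{X}$, and the bracket dual to $W^{\mathcal{D}}$ is $\{\bar F,\bar G\}^{\mathcal{D}}(\phi)=W^{\mathcal{D}}(X_{\bar F}(\phi),X_{\bar G}(\phi))$. $\mathrm{Dens}$ is the set of smooth volume forms on $M$ (positive with respect to the orientation given by $\omega^n$) with total integral $1$. Each $f\in C^\infty(M)$ defines a linear functional $F_f(d\nu):=\int_M f\,d\nu$ on $\mathrm{Dens}$, and the Poisson structure on $\mathrm{Dens}$ is determined on these functionals by $\{F_f,F_g\}_{\mathrm{Dens}}(d\nu):=\int_M\{f,g\}\,d\nu$. The map $\pi$ makes $\mathcal{D}$ a principal bundle over $\mathrm{Dens}$ with structure group $\mathcal{D}_\mu$, the group of diffeomorphisms preserving $d\mu$, acting on $\mathcal{D}$ by composition on the right. "$W^{\mathcal{D}}$ descends to $\{\cdot,\cdot\}_{\mathrm{Dens}}$" means that $W^{\mathcal{D}}$ is invariant under the $\mathcal{D}_\mu$-action and that the quotient Poisson structure on $\mathrm{Dens}$ is $\{\cdot,\cdot\}_{\mathrm{Dens}}$, i.e. for all $f,g\in C^\infty(M)$ and $\phi\in\mathcal{D}$, $\{\pi^*F_f,\pi^*F_g\}^{\mathcal{D}}(\phi)=\{F_f,F_g\}_{\mathrm{Dens}}(\pi(\phi))$. *)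

theory Defs
  imports "HOL-Analysis.Analysis"
begin

section \<open>Smooth manifolds\<close>

text \<open>\<open>C\<^sup>k\<close> and \<open>C\<^sup>\<infinity>\<close> maps; only used on open sets \<open>S\<close>.\<close>

primrec Ck_on :: "nat \<Rightarrow> 'e::real_normed_vector set \<Rightarrow> ('e \<Rightarrow> 'f::real_normed_vector) \<Rightarrow> bool" where
  "Ck_on 0 S f \<longleftrightarrow> continuous_on S f"
| "Ck_on (Suc k) S f \<longleftrightarrow>
     (\<forall>x\<in>S. f differentiable (at x)) \<and> (\<forall>v. Ck_on k S (\<lambda>x. frechet_derivative f (at x) v))"

definition smooth_on :: "'e::real_normed_vector set \<Rightarrow> ('e \<Rightarrow> 'f::real_normed_vector) \<Rightarrow> bool" where
  "smooth_on S f \<longleftrightarrow> (\<forall>k. Ck_on k S f)"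

text \<open>The underlying space of the manifold is a whole type \<open>'a\<close>. A chart is a pair of an open
  domain and a coordinate map, whose values outside the domain are irrelevant. The dimension is
  \<open>CARD('m)\<close>. The smooth structure is given by an atlas, which need not be maximal.\<close>

type_synonym ('a, 'm) chart = "'a set \<times> ('a \<Rightarrow> real ^ 'm)"

definition chart_inv :: "('a, 'm::finite) chart \<Rightarrow> real ^ 'm \<Rightarrow> 'a" where
  "chart_inv c = inv_into (fst c) (snd c)"

definition is_chart :: "('a::topological_space, 'm::finite) chart \<Rightarrow> bool" where
  "is_chart c \<longleftrightarrow> open (fst c) \<and> open (snd c ` fst c) \<and>
     homeomorphism (fst c) (snd c ` fst c) (snd c) (chart_inv c)"

definition smooth_atlas :: "('a::topological_space, 'm::finite) chart set \<Rightarrow> bool" where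
  "smooth_atlas A \<longleftrightarrow> (\<forall>c\<in>A. is_chart c) \<and> (\<Union>c\<in>A. fst c) = UNIV \<and>
     (\<forall>c\<in>A. \<forall>c'\<in>A. smooth_on (snd c ` (fst c \<inter> fst c')) (snd c' \<circ> chart_inv c))"

definition C_inf :: "('a, 'm::finite) chart set \<Rightarrow> ('a \<Rightarrow> real) set" where
  "C_inf A = {f. \<forall>c\<in>A. smooth_on (snd c ` fst c) (f \<circ> chart_inv c)}"

definition smooth_map :: "('a::topological_space, 'm::finite) chart set \<Rightarrow> ('a \<Rightarrow> 'a) \<Rightarrow> bool" where
  "smooth_map A \<phi> \<longleftrightarrow> continuous_on UNIV \<phi> \<and>
     (\<forall>c\<in>A. \<forall>c'\<in>A. smooth_on (snd c ` (fst c \<inter> \<phi> -` fst c')) (snd c' \<circ> \<phi> \<circ> chart_inv c))"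

definition diffeomorphism :: "('a::topological_space, 'm::finite) chart set \<Rightarrow> ('a \<Rightarrow> 'a) \<Rightarrow> bool" where
  "diffeomorphism A \<phi> \<longleftrightarrow> bij \<phi> \<and> smooth_map A \<phi> \<and> smooth_map A (inv \<phi>)"


section \<open>Tangent vectors and vector fields\<close>

text \<open>Tangent vectors are identified with the derivations of \<open>C\<^sup>\<infinity>(M)\<close> they induce. To make this
  representation unique they take the value 0 on functions that are not smooth.
  \<open>coord_vec A c p u\<close> is \<open>\<Sum>\<^sub>i u\<^sub>i \<partial>/\<partial>x\<^sub>i\<close> at \<open>p\<close> in the coordinates of the chart \<open>c\<close>.\<close>

type_synonym 'a tvec = "('a \<Rightarrow> real) \<Rightarrow> real"

definition coord_vec :: "('a, 'm::finite) chart set \<Rightarrow> ('a, 'm) chart \<Rightarrow> 'a \<Rightarrow> real ^ 'm \<Rightarrow> 'a tvec" where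
  "coord_vec A c p u =
     (\<lambda>f. if f \<in> C_inf A then frechet_derivative (f \<circ> chart_inv c) (at (snd c p)) u else 0)"

definition coord_frame :: "('a, 'm::finite) chart set \<Rightarrow> ('a, 'm) chart \<Rightarrow> 'a \<Rightarrow> 'm \<Rightarrow> 'a tvec" where
  "coord_frame A c p i = coord_vec A c p (axis i 1)"

definition tangent_space :: "('a, 'm::finite) chart set \<Rightarrow> 'a \<Rightarrow> 'a tvec set" where
  "tangent_space A p = {coord_vec A c p u | c u. c \<in> A \<and> p \<in> fst c}"

definition lincomb :: "real \<Rightarrow> 'a tvec \<Rightarrow> real \<Rightarrow> 'a tvec \<Rightarrow> 'a tvec" where
  "lincomb a v b w = (\<lambda>f. a * v f + b * w f)"

text \<open>The differential \<open>d\<phi>\<close> of a smooth map.\<close>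

definition tangent_map :: "('a, 'm::finite) chart set \<Rightarrow> ('a \<Rightarrow> 'a) \<Rightarrow> 'a tvec \<Rightarrow> 'a tvec" where
  "tangent_map A \<phi> v = (\<lambda>f. if f \<in> C_inf A then v (f \<circ> \<phi>) else 0)"

definition vector_fields :: "('a, 'm::finite) chart set \<Rightarrow> ('a \<Rightarrow> 'a tvec) set" where
  "vector_fields A = {X. (\<forall>p. X p \<in> tangent_space A p) \<and> (\<forall>f\<in>C_inf A. (\<lambda>p. X p f) \<in> C_inf A)}"

definition lie_bracket ::
  "('a, 'm::finite) chart set \<Rightarrow> ('a \<Rightarrow> 'a tvec) \<Rightarrow> ('a \<Rightarrow> 'a tvec) \<Rightarrow> 'a \<Rightarrow> 'a tvec" where
  "lie_bracket A X Y p =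
     (\<lambda>f. if f \<in> C_inf A then X p (\<lambda>q. Y q f) - Y p (\<lambda>q. X q f) else 0)"


section \<open>Symplectic forms\<close>

type_synonym 'a two_form = "'a \<Rightarrow> 'a tvec \<Rightarrow> 'a tvec \<Rightarrow> real"

text \<open>Forms are only constrained, and only used, on tangent vectors at the base point.\<close>

definition is_two_form :: "('a, 'm::finite) chart set \<Rightarrow> 'a two_form \<Rightarrow> bool" where
  "is_two_form A \<omega> \<longleftrightarrow>
     (\<forall>p. \<forall>u\<in>tangent_space A p. \<forall>v\<in>tangent_space A p. \<forall>w\<in>tangent_space A p. \<forall>a b.
        \<omega> p (lincomb a u b v) w = a * \<omega> p u w + b * \<omega> p v w) \<and>
     (\<forall>p. \<forall>v\<in>tangent_space A p. \<forall>w\<in>tangent_space A p. \<omega> p v w = - \<omega> p w v) \<and>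
     (\<forall>c\<in>A. \<forall>i j. smooth_on (snd c ` fst c)
        ((\<lambda>q. \<omega> q (coord_frame A c q i) (coord_frame A c q j)) \<circ> chart_inv c))"

text \<open>\<open>d\<omega> = 0\<close>, by the invariant formula for \<open>d\<omega>(X,Y,Z)\<close>.\<close>

definition closed_two_form :: "('a, 'm::finite) chart set \<Rightarrow> 'a two_form \<Rightarrow> bool" where
  "closed_two_form A \<omega> \<longleftrightarrow>
     (\<forall>X\<in>vector_fields A. \<forall>Y\<in>vector_fields A. \<forall>Z\<in>vector_fields A. \<forall>p.
        X p (\<lambda>q. \<omega> q (Y q) (Z q)) + Y p (\<lambda>q. \<omega> q (Z q) (X q)) + Z p (\<lambda>q. \<omega> q (X q) (Y q))
        - \<omega> p (lie_bracket A X Y p) (Z p) - \<omega> p (lie_bracket A Y Z p) (X p)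
        - \<omega> p (lie_bracket A Z X p) (Y p) = 0)"

definition symplectic_form :: "('a, 'm::finite) chart set \<Rightarrow> 'a two_form \<Rightarrow> bool" where
  "symplectic_form A \<omega> \<longleftrightarrow> is_two_form A \<omega> \<and> closed_two_form A \<omega> \<and>
     (\<forall>p. \<forall>v\<in>tangent_space A p. (\<forall>w\<in>tangent_space A p. \<omega> p v w = 0) \<longrightarrow> v = (\<lambda>f. 0))"

text \<open>The Hamiltonian vector field: \<open>\<omega>(X\<^sub>f, Y) = df(Y) = Y f\<close>.\<close>

definition hamiltonian_field ::
  "('a, 'm::finite) chart set \<Rightarrow> 'a two_form \<Rightarrow> ('a \<Rightarrow> real) \<Rightarrow> 'a \<Rightarrow> 'a tvec" where
  "hamiltonian_field A \<omega> f =
     (THE X. X \<in> vector_fields A \<and> (\<forall>Y\<in>vector_fields A. \<forall>p. \<omega> p (X p) (Y p) = Y p f))"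

definition poisson_bracket ::
  "('a, 'm::finite) chart set \<Rightarrow> 'a two_form \<Rightarrow> ('a \<Rightarrow> real) \<Rightarrow> ('a \<Rightarrow> real) \<Rightarrow> 'a \<Rightarrow> real" where
  "poisson_bracket A \<omega> f g p = \<omega> p (hamiltonian_field A \<omega> f p) (hamiltonian_field A \<omega> g p)"


section \<open>Volume forms and integration\<close>

text \<open>Forms of top degree take a family of \<open>CARD('m)\<close> tangent vectors indexed by \<open>'m\<close>; the order
  on \<open>'m\<close> gives the order of the arguments.\<close>

type_synonym ('a, 'm) top_form = "'a \<Rightarrow> ('m \<Rightarrow> 'a tvec) \<Rightarrow> real"

definition is_top_form :: "('a, 'm::finite) chart set \<Rightarrow> ('a, 'm) top_form \<Rightarrow> bool" where
  "is_top_form A \<nu> \<longleftrightarrow>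
     (\<forall>p vs. (\<forall>i. vs i \<in> tangent_space A p) \<longrightarrow>
        (\<forall>i. \<forall>v\<in>tangent_space A p. \<forall>w\<in>tangent_space A p. \<forall>a b.
           \<nu> p (vs(i := lincomb a v b w)) = a * \<nu> p (vs(i := v)) + b * \<nu> p (vs(i := w))) \<and>
        (\<forall>i j. i \<noteq> j \<and> vs i = vs j \<longrightarrow> \<nu> p vs = 0)) \<and>
     (\<forall>c\<in>A. smooth_on (snd c ` fst c) ((\<lambda>q. \<nu> q (coord_frame A c q)) \<circ> chart_inv c))"

text \<open>\<open>nth_index k\<close> is the \<open>k\<close>-th element (counting from 0) of \<open>'m\<close> in increasing order.\<close>

definition nth_index :: "nat \<Rightarrow> 'm::{finite,linorder}" where
  "nth_index k = sorted_list_of_set (UNIV :: 'm set) ! k"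

text \<open>The wedge power \<open>\<omega>\<^sup>n\<close>, with
  \<open>(\<alpha> \<and> \<beta>)(v\<^sub>1,\<dots>) = 1/(k! l!) \<Sum>\<^sub>\<sigma> sgn(\<sigma>) \<alpha>(v\<^sub>\<sigma>\<^sub>1,\<dots>) \<beta>(\<dots>)\<close> for a \<open>k\<close>-form \<open>\<alpha>\<close> and an
  \<open>l\<close>-form \<open>\<beta>\<close>. Meant for \<open>CARD('m) = 2 * n\<close>.\<close>

definition omega_power :: "nat \<Rightarrow> 'a two_form \<Rightarrow> ('a, 'm::{finite,linorder}) top_form" where
  "omega_power n \<omega> p vs =
     (\<Sum>\<sigma> | \<sigma> permutes (UNIV :: 'm set). of_int (sign \<sigma>) *
        (\<Prod>k<n. \<omega> p (vs (\<sigma> (nth_index (2 * k)))) (vs (\<sigma> (nth_index (2 * k + 1)))))) / 2 ^ n"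

text \<open>The Borel measure of a volume form \<open>\<nu>\<close>: in each chart it has density \<open>\<bar>\<nu>(\<partial>\<^sub>1,\<dots>,\<partial>\<^sub>2\<^sub>n)\<bar>\<close>
  with respect to Lebesgue measure. For a volume form that is positive with respect to the
  orientation, integration against this measure is integration of forms over the oriented
  manifold.\<close>

definition vol_measure ::
  "('a::topological_space, 'm::finite) chart set \<Rightarrow> ('a, 'm) top_form \<Rightarrow> 'a measure" where
  "vol_measure A \<nu> = (THE m. sets m = sets borel \<and>
     (\<forall>c\<in>A. \<forall>B\<in>sets borel. B \<subseteq> fst c \<longrightarrow>
        emeasure m B = (\<integral>\<^sup>+ y. ennreal \<bar>\<nu> (chart_inv c y) (coord_frame A c (chart_inv c y))\<bar>
                            * indicator (snd c ` B) y \<partial>lborel)))"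

definition vol_integral ::
  "('a::topological_space, 'm::finite) chart set \<Rightarrow> ('a, 'm) top_form \<Rightarrow> ('a \<Rightarrow> real) \<Rightarrow> real" where
  "vol_integral A \<nu> f = (\<integral>x. f x \<partial>vol_measure A \<nu>)"

text \<open>\<open>\<phi>\<^sub>*\<nu> = (\<phi>\<^sup>-\<^sup>1)\<^sup>*\<nu>\<close> for a diffeomorphism \<open>\<phi>\<close>.\<close>

definition push_forward ::
  "('a, 'm::finite) chart set \<Rightarrow> ('a \<Rightarrow> 'a) \<Rightarrow> ('a, 'm) top_form \<Rightarrow> ('a, 'm) top_form" where
  "push_forward A \<phi> \<nu> q vs = \<nu> (inv \<phi> q) (\<lambda>i. tangent_map A (inv \<phi>) (vs i))"


section \<open>The Poisson structure on the space of densities\<close>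

text \<open>From here on \<open>\<mu>\<close> is the reference volume form, which also fixes the orientation: a frame
  \<open>vs\<close> at \<open>p\<close> is positive if \<open>\<mu> p vs > 0\<close>.\<close>

definition Dens :: "('a::topological_space, 'm::finite) chart set \<Rightarrow> ('a, 'm) top_form
    \<Rightarrow> ('a, 'm) top_form set" where
  "Dens A \<mu> = {\<nu>. is_top_form A \<nu> \<and>
     (\<forall>p vs. (\<forall>i. vs i \<in> tangent_space A p) \<and> \<mu> p vs > 0 \<longrightarrow> \<nu> p vs > 0) \<and>
     vol_integral A \<nu> (\<lambda>x. 1) = 1}"

definition lin_functional ::
  "('a::topological_space, 'm::finite) chart set \<Rightarrow> ('a \<Rightarrow> real) \<Rightarrow> ('a, 'm) top_form \<Rightarrow> real" where
  "lin_functional A f \<nu> = vol_integral A \<nu> f"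

text \<open>The value of \<open>{F\<^sub>f, F\<^sub>g}\<close> at \<open>\<nu>\<close>, where \<open>F\<^sub>f = lin_functional A f\<close>.\<close>

definition Dens_bracket ::
  "('a::topological_space, 'm::finite) chart set \<Rightarrow> 'a two_form \<Rightarrow> ('a \<Rightarrow> real) \<Rightarrow> ('a \<Rightarrow> real)
    \<Rightarrow> ('a, 'm) top_form \<Rightarrow> real" where
  "Dens_bracket A \<omega> f g \<nu> = vol_integral A \<nu> (poisson_bracket A \<omega> f g)"


section \<open>The diffeomorphism group\<close>

definition Diff_plus :: "('a::topological_space, 'm::finite) chart set \<Rightarrow> ('a, 'm) top_form
    \<Rightarrow> ('a \<Rightarrow> 'a) set" where
  "Diff_plus A \<mu> = {\<phi>. diffeomorphism A \<phi> \<and>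
     (\<forall>p vs. (\<forall>i. vs i \<in> tangent_space A p) \<and> \<mu> p vs > 0 \<longrightarrow>
        \<mu> (\<phi> p) (\<lambda>i. tangent_map A \<phi> (vs i)) > 0)}"

definition Diff_mu :: "('a::topological_space, 'm::finite) chart set \<Rightarrow> ('a, 'm) top_form
    \<Rightarrow> ('a \<Rightarrow> 'a) set" where
  "Diff_mu A \<mu> = {\<psi>\<in>Diff_plus A \<mu>.
     \<forall>p vs. (\<forall>i. vs i \<in> tangent_space A p) \<longrightarrow> push_forward A \<psi> \<mu> p vs = \<mu> p vs}"

definition proj_Dens :: "('a, 'm::finite) chart set \<Rightarrow> ('a, 'm) top_form
    \<Rightarrow> ('a \<Rightarrow> 'a) \<Rightarrow> ('a, 'm) top_form" where
  "proj_Dens A \<mu> \<phi> = push_forward A \<phi> \<mu>"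

definition tangent_Diff :: "('a, 'm::finite) chart set \<Rightarrow> ('a \<Rightarrow> 'a) \<Rightarrow> ('a \<Rightarrow> 'a tvec) set" where
  "tangent_Diff A \<phi> = {X \<circ> \<phi> | X. X \<in> vector_fields A}"

text \<open>\<open>W\<^sup>D\<close> at the point \<open>\<phi>\<close>, on vectors \<open>U, V\<close> of \<open>tangent_Diff A \<phi>\<close>.\<close>

definition W_form :: "('a::topological_space, 'm::finite) chart set \<Rightarrow> 'a two_form
    \<Rightarrow> ('a, 'm) top_form \<Rightarrow> ('a \<Rightarrow> 'a) \<Rightarrow> ('a \<Rightarrow> 'a tvec) \<Rightarrow> ('a \<Rightarrow> 'a tvec) \<Rightarrow> real" where
  "W_form A \<omega> \<mu> \<phi> U V = vol_integral A \<mu> (\<lambda>x. \<omega> (\<phi> x) (U x) (V x))"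

text \<open>A smooth path in the diffeomorphism group is one for which \<open>(t, x) \<mapsto> \<gamma> t x\<close> is smooth.\<close>

definition smooth_path_Diff :: "('a::topological_space, 'm::finite) chart set \<Rightarrow> ('a, 'm) top_form
    \<Rightarrow> (real \<Rightarrow> 'a \<Rightarrow> 'a) \<Rightarrow> bool" where
  "smooth_path_Diff A \<mu> \<gamma> \<longleftrightarrow> (\<exists>\<epsilon>>0.
     (\<forall>t\<in>{-\<epsilon><..<\<epsilon>}. \<gamma> t \<in> Diff_plus A \<mu>) \<and>
     continuous_on ({-\<epsilon><..<\<epsilon>} \<times> UNIV) (\<lambda>(t, x). \<gamma> t x) \<and>
     (\<forall>c\<in>A. \<forall>c'\<in>A. smooth_on
        {(t, y). t \<in> {-\<epsilon><..<\<epsilon>} \<and> y \<in> snd c ` fst c \<and> \<gamma> t (chart_inv c y) \<in> fst c'}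
        (\<lambda>(t, y). snd c' (\<gamma> t (chart_inv c y)))))"

definition has_velocity_Diff ::
  "('a, 'm::finite) chart set \<Rightarrow> (real \<Rightarrow> 'a \<Rightarrow> 'a) \<Rightarrow> ('a \<Rightarrow> 'a tvec) \<Rightarrow> bool" where
  "has_velocity_Diff A \<gamma> V \<longleftrightarrow>
     (\<forall>x. \<forall>f\<in>C_inf A. ((\<lambda>t. f (\<gamma> t x)) has_real_derivative V x f) (at 0))"

text \<open>\<open>\<langle>dF, V\<rangle> = d\<close> at the point \<open>\<phi>\<close>, for a functional \<open>F\<close> on the diffeomorphism group.\<close>

definition has_differential_Diff ::
  "('a::topological_space, 'm::finite) chart set \<Rightarrow> ('a, 'm) top_form \<Rightarrow> (('a \<Rightarrow> 'a) \<Rightarrow> real)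
    \<Rightarrow> ('a \<Rightarrow> 'a) \<Rightarrow> ('a \<Rightarrow> 'a tvec) \<Rightarrow> real \<Rightarrow> bool" where
  "has_differential_Diff A \<mu> F \<phi> V d \<longleftrightarrow>
     (\<forall>\<gamma>. smooth_path_Diff A \<mu> \<gamma> \<and> \<gamma> 0 = \<phi> \<and> has_velocity_Diff A \<gamma> V \<longrightarrow>
        ((\<lambda>t. F (\<gamma> t)) has_real_derivative d) (at 0))"

definition is_hamiltonian_Diff ::
  "('a::topological_space, 'm::finite) chart set \<Rightarrow> 'a two_form \<Rightarrow> ('a, 'm) top_form
    \<Rightarrow> (('a \<Rightarrow> 'a) \<Rightarrow> real) \<Rightarrow> ('a \<Rightarrow> 'a) \<Rightarrow> ('a \<Rightarrow> 'a tvec) \<Rightarrow> bool" where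
  "is_hamiltonian_Diff A \<omega> \<mu> F \<phi> U \<longleftrightarrow> U \<in> tangent_Diff A \<phi> \<and>
     (\<forall>Y\<in>vector_fields A.
        has_differential_Diff A \<mu> F \<phi> (Y \<circ> \<phi>) (W_form A \<omega> \<mu> \<phi> U (Y \<circ> \<phi>)))"

definition hamiltonian_Diff ::
  "('a::topological_space, 'm::finite) chart set \<Rightarrow> 'a two_form \<Rightarrow> ('a, 'm) top_form
    \<Rightarrow> (('a \<Rightarrow> 'a) \<Rightarrow> real) \<Rightarrow> ('a \<Rightarrow> 'a) \<Rightarrow> 'a \<Rightarrow> 'a tvec" where
  "hamiltonian_Diff A \<omega> \<mu> F \<phi> = (THE U. is_hamiltonian_Diff A \<omega> \<mu> F \<phi> U)"

definition Diff_bracket ::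
  "('a::topological_space, 'm::finite) chart set \<Rightarrow> 'a two_form \<Rightarrow> ('a, 'm) top_form
    \<Rightarrow> (('a \<Rightarrow> 'a) \<Rightarrow> real) \<Rightarrow> (('a \<Rightarrow> 'a) \<Rightarrow> real) \<Rightarrow> ('a \<Rightarrow> 'a) \<Rightarrow> real" where
  "Diff_bracket A \<omega> \<mu> F G \<phi> =
     W_form A \<omega> \<mu> \<phi> (hamiltonian_Diff A \<omega> \<mu> F \<phi>) (hamiltonian_Diff A \<omega> \<mu> G \<phi>)"

text \<open>\<open>V \<mapsto> V \<circ> \<psi>\<close> is the differential of the right translation \<open>\<phi> \<mapsto> \<phi> \<circ> \<psi>\<close>.\<close>

definition W_right_invariant :: "('a::topological_space, 'm::finite) chart set \<Rightarrow> 'a two_form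
    \<Rightarrow> ('a, 'm) top_form \<Rightarrow> bool" where
  "W_right_invariant A \<omega> \<mu> \<longleftrightarrow>
     (\<forall>\<phi>\<in>Diff_plus A \<mu>. \<forall>\<psi>\<in>Diff_mu A \<mu>. \<forall>U\<in>tangent_Diff A \<phi>. \<forall>V\<in>tangent_Diff A \<phi>.
        W_form A \<omega> \<mu> (\<phi> \<circ> \<psi>) (U \<circ> \<psi>) (V \<circ> \<psi>) = W_form A \<omega> \<mu> \<phi> U V)"

end

theory Submission
  imports Defs
begin

text \<open>Differentiating \<open>\<integral> f \<circ> \<gamma>\<^sub>t d\<mu>\<close> under the integral sign shows that \<open>X\<^sub>f \<circ> \<phi>\<close> is a Hamiltonian
  vector of \<open>\<pi>\<^sup>*F\<^sub>f\<close> at \<open>\<phi>\<close>, and the change of variables formula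
  \<open>\<integral> h d(\<phi>\<^sub>*\<mu>) = \<integral> h \<circ> \<phi> d\<mu>\<close> then turns \<open>W(X\<^sub>f \<circ> \<phi>, X\<^sub>g \<circ> \<phi>)\<close> into the integral of
  \<open>{f,g}\<close> against \<open>\<phi>\<^sub>*\<mu>\<close>. Uniqueness of the Hamiltonian vector needs sufficiently many smooth paths
  through \<open>\<phi>\<close>; instead of flows we use shears \<open>y \<mapsto> y + t \<beta>(y) e\<^sub>i\<close> in a chart, with a bump
  function \<open>\<beta>\<close>, whose inverses are obtained from the contraction principle. Positivity of \<open>\<phi>\<^sub>*\<mu>\<close>
  rests on \<open>\<omega>\<^sup>n\<close> being nowhere zero, i.e. on the Pfaffian of a symplectic basis being nonzero.\<close>

section \<open>Calculus of smooth maps\<close>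

text \<open>\<open>vol_measure\<close>, \<open>hamiltonian_field\<close> and
  \<open>hamiltonian_Diff\<close> are definite descriptions, so they carry information only after
  existence and uniqueness are proved. For \<open>hamiltonian_Diff\<close> the delicate half is
  uniqueness: \<open>has_differential_Diff\<close> quantifies over all smooth paths with a given
  velocity and would hold for every number if there were none. A candidate vector is therefore
  constrained only along velocities that are actually realised. Fields of the form bump times
  coordinate field are enough, because \<omega> is nondegenerate and the volume measure charges
  every nonempty open set. For invertibility of a shear a bound on the derivative of the bump
  suffices; it is 4 r for radius r, whence the time interval |t| < 1 / (4 r + 1). Since tangent
  vectors act on globally defined smooth functions, bumps are also the means of reading off
  coordinates. The measure itself is assembled from finitely many disjoint Borel pieces, each inside
  one chart.\<close>

lemma Ck_on_subset: "Ck_on k S f \<Longrightarrow> T \<subseteq> S \<Longrightarrow> Ck_on k T f"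
  by (induction k arbitrary: f) (auto intro: continuous_on_subset)

lemma Ck_on_SucD: "Ck_on (Suc k) S f \<Longrightarrow> Ck_on k S f"
proof (induction k arbitrary: f)
  case 0
  then show ?case
    by (auto intro!: continuous_at_imp_continuous_on differentiable_imp_continuous_within)
next
  case (Suc k)
  then show ?case
    unfolding Ck_on.simps(2)[of "Suc k"] Ck_on.simps(2)[of k S f] by blast
qed

text \<open>Every clause of \<open>Ck_on\<close> is implied by its validity near each point, so a
  different open set may be used around each point; the induction passes to directional
  derivatives.\<close>

lemma Ck_on_local:
  assumes "\<And>x. x \<in> S \<Longrightarrow> \<exists>T. open T \<and> x \<in> T \<and> Ck_on k T f"
  shows "Ck_on k S f"
  using assms
proof (induction k arbitrary: f)
  case 0
  then show ?case
    by (force intro!: continuous_at_imp_continuous_on simp: continuous_on_eq_continuous_at)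
next
  case (Suc k)
  have "f differentiable (at x)" if "x \<in> S" for x
    using Suc.prems[OF that] by auto
  moreover have "Ck_on k S (\<lambda>x. frechet_derivative f (at x) v)" for v
    by (rule Suc.IH) (use Suc.prems in fastforce)
  ultimately show ?case by simp
qed

text \<open>Openness lets agreement on \<open>S\<close> pass to derivatives:
  \<open>frechet_derivative\<close> at a point depends on the values in a neighbourhood, and the
  induction needs the derivatives to agree on all of \<open>S\<close> again.\<close>

lemma Ck_on_cong:
  assumes "open S" "\<And>x. x \<in> S \<Longrightarrow> f x = g x" "Ck_on k S f"
  shows "Ck_on k S g"
  using assms(2,3)
proof (induction k arbitrary: f g)
  case 0
  then show ?case by (auto cong: continuous_on_cong)
next
  case (Suc k)
  have d: "f differentiable (at x)" if "x \<in> S" for x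
    using Suc.prems that by auto
  have "g differentiable (at x)" if "x \<in> S" for x
  proof -
    have "(g has_derivative frechet_derivative f (at x)) (at x)"
      by (rule has_derivative_transform_within_open[OF _ assms(1) that Suc.prems(1)])
        (use d[OF that] frechet_derivative_works in auto)
    then show ?thesis by (rule differentiableI)
  qed
  moreover have "Ck_on k S (\<lambda>x. frechet_derivative g (at x) v)" for v
    by (rule Suc.IH[of "\<lambda>x. frechet_derivative f (at x) v"])
      (use Suc.prems frechet_derivative_transform_within_open[OF d assms(1)] in auto)
  ultimately show ?case by simp
qed

text \<open>The successor clause speaks of \<open>frechet_derivative\<close>. Uniqueness of
  derivatives lets any explicit formula \<open>f'\<close> take its place, which is how the rules of
  calculus enter the inductions below.\<close>

lemma Ck_on_SucI:
  assumes "open S" "\<And>x. x \<in> S \<Longrightarrow> (f has_derivative f' x) (at x)"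
    "\<And>v. Ck_on k S (\<lambda>x. f' x v)"
  shows "Ck_on (Suc k) S f"
proof -
  have "f' x v = frechet_derivative f (at x) v" if "x \<in> S" for x v
    using frechet_derivative_at[OF assms(2)[OF that]] by simp
  then have "Ck_on k S (\<lambda>x. frechet_derivative f (at x) v)" for v
    by (intro Ck_on_cong[OF assms(1) _ assms(3)[of v]]) auto
  then show ?thesis
    using assms(2) by (auto simp: differentiable_def)
qed

lemma Ck_on_SucE:
  assumes "Ck_on (Suc k) S f" "x \<in> S"
  shows "(f has_derivative frechet_derivative f (at x)) (at x)"
  using assms frechet_derivative_works by auto

lemma Ck_on_const: "Ck_on k S (\<lambda>x. c)"
  by (induction k arbitrary: c) auto

lemma Ck_on_bounded_linear:
  assumes "bounded_linear L" "open S"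
  shows "Ck_on k S L"
proof (cases k)
  case 0
  then show ?thesis using assms by (simp add: linear_continuous_on)
next
  case (Suc m)
  then show ?thesis
    using Ck_on_SucI[OF assms(2), of L "\<lambda>x. L" m] assms(1)
    by (simp add: Ck_on_const bounded_linear_imp_has_derivative)
qed

lemma Ck_on_add:
  assumes "open S" "Ck_on k S f" "Ck_on k S g"
  shows "Ck_on k S (\<lambda>x. f x + g x)"
  using assms(2,3)
proof (induction k arbitrary: f g)
  case 0
  then show ?case by (auto intro: continuous_on_add)
next
  case (Suc k)
  show ?case
    by (rule Ck_on_SucI[OF assms(1) has_derivative_add[OF Ck_on_SucE[OF Suc.prems(1)] Ck_on_SucE[OF Suc.prems(2)]]])
      (use Suc in auto)
qed

text \<open>Leibniz rule: the derivative in direction \<open>v\<close> is a sum of two products of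
  the same kind, each with one factor differentiated; the other factor is lowered to order
  \<open>k\<close> by \<open>Ck_on_SucD\<close>.\<close>

lemma (in bounded_bilinear) Ck_on:
  assumes "open S" "Ck_on k S f" "Ck_on k S g"
  shows "Ck_on k S (\<lambda>x. prod (f x) (g x))"
  using assms(2,3)
proof (induction k arbitrary: f g)
  case 0
  then show ?case by (auto intro: continuous_on)
next
  case (Suc k)
  show ?case
    by (rule Ck_on_SucI[OF assms(1) FDERIV[OF Ck_on_SucE[OF Suc.prems(1)] Ck_on_SucE[OF Suc.prems(2)]]])
      (use Suc Ck_on_SucD[OF Suc.prems(1)] Ck_on_SucD[OF Suc.prems(2)]
        in \<open>auto intro!: Ck_on_add assms(1) Suc.IH\<close>)
qed

lemma Ck_on_sum:
  assumes "open S" "finite I" "\<And>i. i \<in> I \<Longrightarrow> Ck_on k S (f i)"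
  shows "Ck_on k S (\<lambda>x. \<Sum>i\<in>I. f i x)"
  using assms(2,3) by (induction I) (auto intro!: Ck_on_const Ck_on_add assms(1))

text \<open>The chain rule gives \<open>f' (g x) (g' x v)\<close>, where point and direction both
  depend on \<open>x\<close>, so the induction hypothesis does not apply directly. Expanding the
  direction in a basis of the Euclidean middle space leaves compositions with fixed directions,
  multiplied by scalar functions.\<close>

lemma Ck_on_compose:
  fixes f :: "'b::euclidean_space \<Rightarrow> 'c::real_normed_vector" and g :: "'a::real_normed_vector \<Rightarrow> 'b"
  assumes "open S" "open T" "g ` S \<subseteq> T" "Ck_on k S g" "Ck_on k T f"
  shows "Ck_on k S (\<lambda>x. f (g x))"
  using assms(4,5)
proof (induction k arbitrary: f)
  case 0
  then show ?case
    using continuous_on_compose2[of T f S g] assms(3) by auto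
next
  case (Suc k)
  let ?f' = "\<lambda>y. frechet_derivative f (at y)" and ?g' = "\<lambda>x. frechet_derivative g (at x)"
  have gT: "g x \<in> T" if "x \<in> S" for x using assms(3) that by auto
  have der: "((\<lambda>x. f (g x)) has_derivative (\<lambda>v. ?f' (g x) (?g' x v))) (at x)" if "x \<in> S" for x
    using has_derivative_compose[OF Ck_on_SucE[OF Suc.prems(1) that]
        Ck_on_SucE[OF Suc.prems(2) gT[OF that]]] .
  have "?f' (g x) (?g' x v) = (\<Sum>b\<in>Basis. (?g' x v \<bullet> b) *\<^sub>R ?f' (g x) b)" if "x \<in> S" for x v
  proof -
    have lin: "linear (?f' (g x))"
      using Ck_on_SucE[OF Suc.prems(2) gT[OF that]] has_derivative_linear by blast
    show ?thesis
      by (subst euclidean_representation[of "?g' x v", symmetric])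
        (simp only: linear_sum[OF lin] linear_scale[OF lin])
  qed
  moreover have "Ck_on k S (\<lambda>x. \<Sum>b\<in>Basis. (?g' x v \<bullet> b) *\<^sub>R ?f' (g x) b)" for v
  proof (intro Ck_on_sum assms(1) finite_Basis)
    fix b :: 'b
    have a: "Ck_on k S (\<lambda>x. ?f' (g x) b)"
      by (rule Suc.IH[OF Ck_on_SucD[OF Suc.prems(1)]]) (use Suc.prems(2) in auto)
    have "Ck_on k S (\<lambda>x. ?g' x v)" using Suc.prems(1) by auto
    then have c: "Ck_on k S (\<lambda>x. ?g' x v \<bullet> b)"
      by (intro bounded_bilinear.Ck_on[OF bounded_bilinear_inner assms(1)] Ck_on_const)
    show "Ck_on k S (\<lambda>x. (?g' x v \<bullet> b) *\<^sub>R ?f' (g x) b)"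
      by (rule bounded_bilinear.Ck_on[OF bounded_bilinear_scaleR assms(1) c a])
  qed
  ultimately have "Ck_on k S (\<lambda>x. ?f' (g x) (?g' x v))" for v
    by (intro Ck_on_cong[OF assms(1) _ \<open>Ck_on k S (\<lambda>x. \<Sum>b\<in>Basis. (?g' x v \<bullet> b) *\<^sub>R ?f' (g x) b)\<close>]) auto
  with der show ?case
    by (intro Ck_on_SucI[OF assms(1)]) auto
qed

text \<open>The derivative of the reciprocal is a product containing the reciprocal itself, which
  the induction hypothesis already covers at order \<open>k\<close>.\<close>

lemma Ck_on_inverse:
  fixes f :: "'a::real_normed_vector \<Rightarrow> real"
  assumes "open S" "Ck_on k S f" "\<And>x. x \<in> S \<Longrightarrow> f x \<noteq> 0"
  shows "Ck_on k S (\<lambda>x. inverse (f x))"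
  using assms(2)
proof (induction k)
  case 0
  then show ?case using assms(3) by (auto intro!: continuous_intros)
next
  case (Suc k)
  have "((\<lambda>x. inverse (f x)) has_derivative
      (\<lambda>v. - (inverse (f x) * frechet_derivative f (at x) v * inverse (f x)))) (at x)" if "x \<in> S" for x
    using Deriv.has_derivative_inverse[OF assms(3)[OF that] Ck_on_SucE[OF Suc.prems that]] by simp
  then show ?case
  proof (rule Ck_on_SucI[OF assms(1)])
    fix v
    have "Ck_on k S (\<lambda>x. inverse (f x))" "Ck_on k S (\<lambda>x. frechet_derivative f (at x) v)"
      using Suc.IH Ck_on_SucD[OF Suc.prems] Suc.prems by auto
    then have "Ck_on k S (\<lambda>x. (-1) * (inverse (f x) * frechet_derivative f (at x) v * inverse (f x)))"
      by (intro bounded_bilinear.Ck_on[OF bounded_bilinear_mult assms(1)] Ck_on_const)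
    then show "Ck_on k S (\<lambda>x. - (inverse (f x) * frechet_derivative f (at x) v * inverse (f x)))"
      by simp
  qed
qed

section \<open>Smooth maps: locality, algebra and composition\<close>

lemma smooth_on_subset: "smooth_on S f \<Longrightarrow> T \<subseteq> S \<Longrightarrow> smooth_on T f"
  unfolding smooth_on_def using Ck_on_subset by blast

lemma smooth_on_cong:
  "open S \<Longrightarrow> (\<And>x. x \<in> S \<Longrightarrow> f x = g x) \<Longrightarrow> smooth_on S f \<Longrightarrow> smooth_on S g"
  unfolding smooth_on_def using Ck_on_cong by blast

text \<open>Smoothness may be tested on a different representative \<open>g\<close> near each point.
  This is the form in which changes of chart and piecewise definitions are treated
  throughout.\<close>

lemma smooth_on_local:
  assumes "\<And>x. x \<in> S \<Longrightarrow> \<exists>T g. open T \<and> x \<in> T \<and> smooth_on T g \<and> (\<forall>y\<in>T. g y = f y)"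
  shows "smooth_on S f"
  unfolding smooth_on_def
proof
  fix k
  show "Ck_on k S f"
  proof (rule Ck_on_local)
    fix x assume "x \<in> S"
    then obtain T g where "open T" "x \<in> T" "smooth_on T g" "\<forall>y\<in>T. g y = f y"
      using assms by blast
    then show "\<exists>T. open T \<and> x \<in> T \<and> Ck_on k T f"
      using smooth_on_cong[of T g f] unfolding smooth_on_def by blast
  qed
qed

lemma smooth_on_const: "smooth_on S (\<lambda>x. c)"
  by (simp add: smooth_on_def Ck_on_const)

lemma smooth_on_bounded_linear: "bounded_linear L \<Longrightarrow> open S \<Longrightarrow> smooth_on S L"
  by (simp add: smooth_on_def Ck_on_bounded_linear)

lemma smooth_on_ident: "open S \<Longrightarrow> smooth_on S (\<lambda>x. x)"
  by (intro smooth_on_bounded_linear bounded_linear_ident)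

lemma smooth_on_add:
  "open S \<Longrightarrow> smooth_on S f \<Longrightarrow> smooth_on S g \<Longrightarrow> smooth_on S (\<lambda>x. f x + g x)"
  by (simp add: smooth_on_def Ck_on_add)

lemma (in bounded_bilinear) smooth_on:
  "open S \<Longrightarrow> smooth_on S f \<Longrightarrow> smooth_on S g \<Longrightarrow> smooth_on S (\<lambda>x. prod (f x) (g x))"
  by (simp add: smooth_on_def Ck_on)

lemmas smooth_on_mult = bounded_bilinear.smooth_on[OF bounded_bilinear_mult]
lemmas smooth_on_scaleR = bounded_bilinear.smooth_on[OF bounded_bilinear_scaleR]
lemmas smooth_on_inner = bounded_bilinear.smooth_on[OF bounded_bilinear_inner]

lemma smooth_on_minus: "open S \<Longrightarrow> smooth_on S f \<Longrightarrow> smooth_on S (\<lambda>x. - f x)"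
  using smooth_on_scaleR[of S "\<lambda>x. -1" f] by (simp add: smooth_on_const)

lemma smooth_on_diff:
  "open S \<Longrightarrow> smooth_on S f \<Longrightarrow> smooth_on S g \<Longrightarrow> smooth_on S (\<lambda>x. f x - g x)"
  using smooth_on_add[of S f "\<lambda>x. - g x"] by (simp add: smooth_on_minus)

lemma smooth_on_sum:
  "open S \<Longrightarrow> finite I \<Longrightarrow> (\<And>i. i \<in> I \<Longrightarrow> smooth_on S (f i)) \<Longrightarrow> smooth_on S (\<lambda>x. \<Sum>i\<in>I. f i x)"
  by (simp add: smooth_on_def Ck_on_sum)

lemma smooth_on_prod:
  fixes f :: "'i \<Rightarrow> 'a::real_normed_vector \<Rightarrow> real"
  assumes "open S" "finite I" "\<And>i. i \<in> I \<Longrightarrow> smooth_on S (f i)"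
  shows "smooth_on S (\<lambda>x. \<Prod>i\<in>I. f i x)"
  using assms(2,3) by (induction I) (auto intro!: smooth_on_const smooth_on_mult assms(1))

lemma smooth_on_divide:
  fixes f g :: "'a::real_normed_vector \<Rightarrow> real"
  assumes "open S" "smooth_on S f" "smooth_on S g" "\<And>x. x \<in> S \<Longrightarrow> g x \<noteq> 0"
  shows "smooth_on S (\<lambda>x. f x / g x)"
proof -
  have "Ck_on k S (\<lambda>x. inverse (g x))" for k
    by (rule Ck_on_inverse[OF assms(1)]) (use assms in \<open>auto simp: smooth_on_def\<close>)
  then show ?thesis
    unfolding divide_inverse by (intro smooth_on_mult[OF assms(1,2)]) (simp add: smooth_on_def)
qed

lemma smooth_on_compose:
  fixes f :: "'b::euclidean_space \<Rightarrow> 'c::real_normed_vector" and g :: "'a::real_normed_vector \<Rightarrow> 'b"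
  assumes "open S" "open T" "\<And>x. x \<in> S \<Longrightarrow> g x \<in> T" "smooth_on S g" "smooth_on T f"
  shows "smooth_on S (\<lambda>x. f (g x))"
  using assms Ck_on_compose[of S T g _ f] unfolding smooth_on_def by blast

lemma smooth_on_linear_compose:
  fixes g :: "'a::real_normed_vector \<Rightarrow> 'b::euclidean_space"
  assumes "bounded_linear L" "open S" "smooth_on S g"
  shows "smooth_on S (\<lambda>x. L (g x))"
  using smooth_on_compose[OF assms(2) open_UNIV _ assms(3) smooth_on_bounded_linear[OF assms(1)]]
  by auto

lemma smooth_on_nth:
  "open S \<Longrightarrow> smooth_on S f \<Longrightarrow> smooth_on S (\<lambda>x. (f x :: real^'n) $ i)"
  by (rule smooth_on_linear_compose[OF bounded_linear_vec_nth])

lemma smooth_on_vec_lambda: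
  fixes f :: "'a::real_normed_vector \<Rightarrow> 'n::finite \<Rightarrow> real"
  assumes "open S" "\<And>i. smooth_on S (\<lambda>x. f x i)"
  shows "smooth_on S (\<lambda>x. \<chi> i. f x i)"
proof -
  have "(\<chi> i. f x i) = (\<Sum>i\<in>UNIV. f x i *\<^sub>R axis i 1)" for x
    by (simp add: vec_eq_iff axis_def if_distrib cong: if_cong)
  then show ?thesis
    by (simp add: smooth_on_sum smooth_on_scaleR smooth_on_const assms)
qed

lemma smooth_on_Pair:
  fixes f :: "'a::real_normed_vector \<Rightarrow> 'b::euclidean_space" and g :: "'a \<Rightarrow> 'c::euclidean_space"
  assumes "open S" "smooth_on S f" "smooth_on S g"
  shows "smooth_on S (\<lambda>x. (f x, g x))"
proof -
  have "smooth_on S (\<lambda>x. (f x, 0) + (0, g x))"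
    by (intro smooth_on_add assms smooth_on_linear_compose[of "\<lambda>y. (y, 0)"]
        smooth_on_linear_compose[of "\<lambda>y. (0, y)"] bounded_linear_intros)
  then show ?thesis by simp
qed

lemma smooth_on_det:
  fixes F :: "'a::real_normed_vector \<Rightarrow> 'n::finite \<Rightarrow> 'n \<Rightarrow> real"
  assumes "open S" "\<And>i j. smooth_on S (\<lambda>x. F x i j)"
  shows "smooth_on S (\<lambda>x. det (\<chi> i j. F x i j))"
  unfolding det_def
  by (simp, intro smooth_on_sum smooth_on_mult smooth_on_prod smooth_on_const assms finite_permutations) auto

lemma smooth_on_imp_has_derivative:
  "smooth_on S f \<Longrightarrow> x \<in> S \<Longrightarrow> (f has_derivative frechet_derivative f (at x)) (at x)"
  unfolding smooth_on_def using Ck_on_SucE by blast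

lemma smooth_on_imp_differentiable: "smooth_on S f \<Longrightarrow> x \<in> S \<Longrightarrow> f differentiable (at x)"
  using smooth_on_imp_has_derivative differentiable_def by blast

lemma smooth_on_imp_continuous_on: "smooth_on S f \<Longrightarrow> continuous_on S f"
  unfolding smooth_on_def using Ck_on.simps(1) by blast

lemma smooth_on_frechet_derivative:
  "smooth_on S f \<Longrightarrow> smooth_on S (\<lambda>x. frechet_derivative f (at x) v)"
  unfolding smooth_on_def using Ck_on.simps(2) by blast


section \<open>Bump functions and shears\<close>

text \<open>The functions exp(-1/t) t^(-j), extended by 0. The powers are there because the
  derivatives of exp(-1/t) are combinations of such functions: up to linear combinations the family
  is closed under differentiation.\<close>

definition flat :: "nat \<Rightarrow> real \<Rightarrow> real" where
  "flat j t = (if t > 0 then exp (- inverse t) * inverse t ^ j else 0)"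

lemma flat_nonneg: "0 \<le> flat j t"
  by (simp add: flat_def)

lemma flat_pos_iff: "0 < flat j t \<longleftrightarrow> 0 < t"
  by (simp add: flat_def)

lemma flat_nonpos_eq_0: "t \<le> 0 \<Longrightarrow> flat j t = 0"
  by (simp add: flat_def)

text \<open>\<open>flat 2\<close> is the derivative of \<open>flat 0\<close>, and the constant comes
  from x^2 / 2 \<le> exp x with x = 1/t. It ends up in the derivative bound of the bump
  functions.\<close>

lemma flat_2_le: "flat 2 t \<le> 2"
proof (cases "t > 0")
  case True
  define x where "x = inverse t"
  have "0 \<le> x" using True by (simp add: x_def)
  then have "x\<^sup>2 \<le> 2 * exp x" using exp_lower_Taylor_quadratic[of x] by simp
  then have "exp (- x) * x\<^sup>2 \<le> 2" by (simp add: exp_minus field_simps)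
  then show ?thesis using True by (simp add: flat_def x_def)
qed (simp add: flat_def)

lemma flat_tendsto_0: "(flat j \<longlongrightarrow> 0) (at 0)"
proof -
  have "((\<lambda>t. inverse t ^ j / exp (inverse t)) \<longlongrightarrow> 0) (at_right (0::real))"
    by (rule filterlim_compose[OF tendsto_power_div_exp_0 filterlim_inverse_at_top_right])
  moreover have "\<forall>\<^sub>F t in at_right 0. inverse t ^ j / exp (inverse t) = flat j t"
    by (rule eventually_at_rightI[of 0 1]) (auto simp: flat_def exp_minus divide_inverse mult.commute)
  ultimately have "(flat j \<longlongrightarrow> 0) (at_right 0)"
    by (rule Lim_transform_eventually)
  moreover have "(flat j \<longlongrightarrow> 0) (at_left 0)"
    by (rule tendsto_eventually, rule eventually_at_leftI[of "-1"]) (auto simp: flat_def)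
  ultimately show ?thesis by (simp add: filterlim_split_at_real)
qed

lemma DERIV_flat:
  "(flat j has_real_derivative (flat (j + 2) t - real j * flat (j + 1) t)) (at t)"
proof -
  consider "t > 0" | "t < 0" | "t = 0" by linarith
  then show ?thesis
  proof cases
    case 1
    have "((\<lambda>t. exp (- inverse t) * inverse t ^ j) has_real_derivative
        exp (- inverse t) * inverse t ^ (j + 2) - real j * (exp (- inverse t) * inverse t ^ (j + 1))) (at t)"
    proof -
      have inv: "(inverse has_real_derivative - (inverse t ^ Suc (Suc 0))) (at t)"
        using DERIV_inverse[of t] 1 by simp
      have "((\<lambda>t. inverse t ^ j) has_real_derivative - real j * inverse t ^ (j + 1)) (at t)"
        by (rule DERIV_cong[OF DERIV_power[OF inv]]) (cases j; simp add: algebra_simps)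
      moreover have "((\<lambda>t. exp (- inverse t)) has_real_derivative exp (- inverse t) * inverse t ^ 2) (at t)"
        by (rule DERIV_cong[OF DERIV_fun_exp[OF DERIV_minus[OF inv]]]) (simp add: power2_eq_square)
      ultimately show ?thesis
        by (rule DERIV_cong[OF DERIV_mult[rotated]]) (simp add: algebra_simps power_add power2_eq_square)
    qed
    then have "(flat j has_real_derivative
        exp (- inverse t) * inverse t ^ (j + 2) - real j * (exp (- inverse t) * inverse t ^ (j + 1))) (at t)"
      by (rule has_field_derivative_transform_within_open[of _ _ _ "{0<..}"]) (use 1 in \<open>auto simp: flat_def\<close>)
    then show ?thesis using 1 by (simp add: flat_def)
  next
    case 2
    have "((\<lambda>t. 0) has_real_derivative 0) (at t)" by simp
    then have "(flat j has_real_derivative 0) (at t)"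
      by (rule has_field_derivative_transform_within_open[of _ _ _ "{..<0}"]) (use 2 in \<open>auto simp: flat_def\<close>)
    then show ?thesis using 2 by (simp add: flat_def)
  next
    case 3
    \<comment> \<open>At 0 the difference quotient of \<open>flat j\<close> is again a member of the
      family, so the derivative there is the limit of \<open>flat (j + 1)\<close>.\<close>
    have "(\<lambda>y. (flat j y - flat j 0) / (y - 0)) = flat (j + 1)"
      by (auto simp: flat_def divide_inverse fun_eq_iff)
    then have "(flat j has_real_derivative 0) (at 0)"
      using flat_tendsto_0[of "j + 1"] by (simp only: has_field_derivative_iff)
    then show ?thesis using 3 by (simp add: flat_def)
  qed
qed

text \<open>Both terms of the derivative are multiples of other members of the family, so the
  induction on the order is general in \<open>j\<close>.\<close>

lemma smooth_on_flat: "smooth_on UNIV (flat j)"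
proof -
  have "Ck_on k UNIV (flat j)" for k
  proof (induction k arbitrary: j)
    case 0
    show ?case
      using DERIV_isCont[OF DERIV_flat] by (auto intro!: continuous_at_imp_continuous_on)
  next
    case (Suc k)
    show ?case
    proof (rule Ck_on_SucI[OF open_UNIV])
      show "(flat j has_derivative (\<lambda>v. (flat (j + 2) t + (- real j) * flat (j + 1) t) * v)) (at t)" for t
        using DERIV_flat[of j t] by (simp add: has_field_derivative_def)
      show "Ck_on k UNIV (\<lambda>t. (flat (j + 2) t + (- real j) * flat (j + 1) t) * v)" for v
        by (intro bounded_bilinear.Ck_on[OF bounded_bilinear_mult] Ck_on_add Ck_on_const open_UNIV Suc.IH)
    qed
  qed
  then show ?thesis by (simp add: smooth_on_def)
qed

text \<open>The squared distance is polynomial, so there is no singularity at the centre. For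
  positive \<open>r\<close> the function is positive exactly on the open ball.\<close>

definition ball_bump :: "'e::euclidean_space \<Rightarrow> real \<Rightarrow> 'e \<Rightarrow> real" where
  "ball_bump y0 r y = flat 0 (r\<^sup>2 - (y - y0) \<bullet> (y - y0))"

lemma ball_bump_nonneg: "0 \<le> ball_bump y0 r y"
  by (simp add: ball_bump_def flat_nonneg)

lemma ball_bump_pos_iff: "r > 0 \<Longrightarrow> 0 < ball_bump y0 r y \<longleftrightarrow> y \<in> ball y0 r"
  by (auto simp: ball_bump_def flat_pos_iff dot_square_norm dist_norm norm_minus_commute
      intro: power_strict_mono power2_less_imp_less)

lemma ball_bump_eq_0: "r > 0 \<Longrightarrow> y \<notin> ball y0 r \<Longrightarrow> ball_bump y0 r y = 0"
  using ball_bump_pos_iff[of r y0 y] ball_bump_nonneg[of y0 r y] by linarith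

lemma smooth_on_ball_bump: "smooth_on UNIV (ball_bump y0 r)"
proof -
  have "smooth_on UNIV (\<lambda>y. r\<^sup>2 - (y - y0) \<bullet> (y - y0))"
    by (intro smooth_on_diff smooth_on_inner smooth_on_const smooth_on_ident open_UNIV)
  then have "smooth_on UNIV (\<lambda>y. flat 0 (r\<^sup>2 - (y - y0) \<bullet> (y - y0)))"
    by (intro smooth_on_compose[OF open_UNIV open_UNIV _ _ smooth_on_flat]) auto
  then show ?thesis by (simp add: ball_bump_def[abs_def])
qed

text \<open>The constant 4 r is the product of 2 from \<open>flat_2_le\<close>, 2 from
  differentiating the square, and r from |y - y0| \<le> r where the derivative does not vanish. It
  enters the contraction constant of the shears.\<close>

lemma frechet_derivative_ball_bump_le:
  assumes "r > 0"
  shows "\<bar>frechet_derivative (ball_bump y0 r) (at y) v\<bar> \<le> 4 * r * norm v"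
proof -
  define s where "s = r\<^sup>2 - (y - y0) \<bullet> (y - y0)"
  have "((\<lambda>y. r\<^sup>2 - (y - y0) \<bullet> (y - y0)) has_derivative (\<lambda>v. - 2 * ((y - y0) \<bullet> v))) (at y)"
    by (auto intro!: derivative_eq_intros simp: inner_commute)
  moreover have "(flat 0 has_derivative (\<lambda>u. flat 2 s * u)) (at s)"
    using DERIV_flat[of 0 s] by (simp add: has_field_derivative_def numeral_2_eq_2)
  ultimately have "(ball_bump y0 r has_derivative (\<lambda>v. flat 2 s * (- 2 * ((y - y0) \<bullet> v)))) (at y)"
    using has_derivative_compose[of "\<lambda>y. r\<^sup>2 - (y - y0) \<bullet> (y - y0)" _ y UNIV "flat 0"]
    unfolding ball_bump_def[abs_def] s_def by blast
  then have eq: "frechet_derivative (ball_bump y0 r) (at y) v = flat 2 s * (- 2 * ((y - y0) \<bullet> v))"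
    using frechet_derivative_at by metis
  show ?thesis
  proof (cases "s \<le> 0")
    case True
    then show ?thesis using assms by (simp add: eq flat_nonpos_eq_0)
  next
    case False
    then have "norm (y - y0) ^ 2 \<le> r\<^sup>2" by (simp add: s_def dot_square_norm)
    then have "norm (y - y0) \<le> r" using assms power2_le_imp_le by force
    then have "\<bar>(y - y0) \<bullet> v\<bar> \<le> r * norm v"
      using Cauchy_Schwarz_ineq2[of "y - y0" v] by (meson mult_right_mono norm_ge_zero order_trans)
    then have "flat 2 s * (2 * \<bar>(y - y0) \<bullet> v\<bar>) \<le> 2 * (2 * (r * norm v))"
      by (intro mult_mono flat_2_le) auto
    then show ?thesis by (simp add: eq abs_mult flat_nonneg)
  qed
qed

text \<open>Affine in t, with velocity \<open>b y\<close> times \<open>e\<close> at every time; it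
  agrees to first order at t = 0 with the integral curves of the field \<open>b e\<close>.\<close>

definition shear :: "('e::euclidean_space \<Rightarrow> real) \<Rightarrow> 'e \<Rightarrow> real \<Rightarrow> 'e \<Rightarrow> 'e" where
  "shear b e t y = y + (t * b y) *\<^sub>R e"

lemma smooth_on_shear:
  assumes "smooth_on UNIV b"
  shows "smooth_on UNIV (\<lambda>(t, y). shear b e t y)"
proof -
  have "smooth_on UNIV (\<lambda>p::real \<times> _. snd p + (fst p * b (snd p)) *\<^sub>R e)"
    by (intro smooth_on_add smooth_on_scaleR smooth_on_mult smooth_on_const open_UNIV
        smooth_on_bounded_linear bounded_linear_intros smooth_on_compose[OF open_UNIV open_UNIV _ _ assms]) auto
  then show ?thesis by (simp add: shear_def case_prod_beta')
qed

lemma has_derivative_shear: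
  assumes "smooth_on UNIV b"
  shows "(shear b e t has_derivative (\<lambda>v. v + (t * frechet_derivative b (at y) v) *\<^sub>R e)) (at y)"
proof -
  have "(b has_derivative frechet_derivative b (at y)) (at y)"
    by (rule smooth_on_imp_has_derivative[OF assms]) simp
  then show ?thesis
    unfolding shear_def[abs_def] by (auto intro!: derivative_eq_intros)
qed

text \<open>The equation \<open>shear b e t y = z\<close> is a fixed point equation for y \<mapsto>
  z - t b(y) e, a contraction with constant |t| L. The last conclusion is positivity of the Jacobian
  determinant of the shear, kept for the orientation argument.\<close>

lemma shear_inverse:
  fixes b :: "'e::euclidean_space \<Rightarrow> real"
  assumes b: "smooth_on UNIV b" and L: "\<And>y v. \<bar>frechet_derivative b (at y) v\<bar> \<le> L * norm v"
    and e: "norm e = 1" and t: "\<bar>t\<bar> * L < 1"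
  obtains R where "smooth_on UNIV R" "\<And>y. R (shear b e t y) = y" "\<And>z. shear b e t (R z) = z"
    "\<And>y. 1 + t * frechet_derivative b (at y) e > 0"
proof -
  let ?b' = "\<lambda>y. frechet_derivative b (at y)"
  have db: "(b has_derivative ?b' y) (at y)" for y
    by (rule smooth_on_imp_has_derivative[OF b]) simp
  have "0 \<le> L" using L[of 0 e] e by (simp add: order_trans[OF abs_ge_zero])
  have bL: "\<bar>b y - b y'\<bar> \<le> L * norm (y - y')" for y y'
  proof -
    have "norm (b y - b y') \<le> L * norm (y - y')"
    proof (rule differentiable_bound[of UNIV b ?b'])
      show "onorm (?b' x) \<le> L" for x
        by (rule onorm_bound) (use L \<open>0 \<le> L\<close> in auto)
    qed (use db in auto)
    then show ?thesis by simp
  qed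
  have tbL: "norm ((t * b y) *\<^sub>R e - (t * b y') *\<^sub>R e) \<le> (\<bar>t\<bar> * L) * norm (y - y')" for y y'
  proof -
    have "norm ((t * b y) *\<^sub>R e - (t * b y') *\<^sub>R e) = \<bar>t\<bar> * \<bar>b y - b y'\<bar>"
      by (simp add: e flip: scaleR_diff_left right_diff_distrib abs_mult)
    also have "\<dots> \<le> \<bar>t\<bar> * (L * norm (y - y'))" by (intro mult_left_mono bL) auto
    finally show ?thesis by simp
  qed
  have ex1: "\<exists>!y. shear b e t y = z" for z
  proof -
    have "\<exists>!y. z - (t * b y) *\<^sub>R e = y"
      by (rule banach_fix_type[of "\<bar>t\<bar> * L" "\<lambda>y. z - (t * b y) *\<^sub>R e"])
        (use t \<open>0 \<le> L\<close> tbL in \<open>auto simp: dist_norm norm_minus_commute\<close>)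
    moreover have "z - (t * b y) *\<^sub>R e = y \<longleftrightarrow> shear b e t y = z" for y
      by (auto simp: shear_def algebra_simps)
    ultimately show ?thesis by simp
  qed
  define R where "R z = (THE y. shear b e t y = z)" for z
  have SR: "shear b e t (R z) = z" for z unfolding R_def by (rule theI'[OF ex1])
  have RS: "R (shear b e t y) = y" for y using ex1 SR by blast
  have pos: "1 + t * ?b' y e > 0" for y
  proof -
    have "\<bar>t * ?b' y e\<bar> \<le> \<bar>t\<bar> * L"
      using L[of y e] e by (simp add: abs_mult mult_left_mono)
    then show ?thesis using t by linarith
  qed
  \<comment> \<open>Subtracting the fixed point equations gives a Lipschitz bound for the inverse,
    hence its continuity, which the inverse function rule below presupposes.\<close>
  have RL: "norm (R z - R z') \<le> norm (z - z') / (1 - \<bar>t\<bar> * L)" for z z'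
  proof -
    have "R z - R z' = (z - z') - ((t * b (R z)) *\<^sub>R e - (t * b (R z')) *\<^sub>R e)"
      using SR[of z] SR[of z'] by (simp add: shear_def algebra_simps)
    then have "norm (R z - R z') \<le> norm (z - z') + norm ((t * b (R z)) *\<^sub>R e - (t * b (R z')) *\<^sub>R e)"
      by (metis norm_triangle_ineq4)
    also have "\<dots> \<le> norm (z - z') + (\<bar>t\<bar> * L) * norm (R z - R z')" using tbL by simp
    finally show ?thesis using t by (simp add: field_simps)
  qed
  have contR: "continuous (at z) R" for z
  proof -
    have "((\<lambda>w. norm (w - z) / (1 - \<bar>t\<bar> * L)) \<longlongrightarrow> norm (z - z) / (1 - \<bar>t\<bar> * L)) (at z)"
      by (intro tendsto_intros) (use t in auto)
    then have "((\<lambda>w. norm (w - z) / (1 - \<bar>t\<bar> * L)) \<longlongrightarrow> 0) (at z)" by simp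
    then have "((\<lambda>w. R w - R z) \<longlongrightarrow> 0) (at z)"
      by (rule Lim_null_comparison[rotated]) (use RL in auto)
    then show ?thesis using LIM_zero_iff continuous_at by blast
  qed
  \<comment> \<open>The inverse of v \<mapsto> v + t b'(v) e, a rank one perturbation of the
    identity, by the Sherman-Morrison formula; the denominator is positive by
    \<open>pos\<close>.\<close>
  define G where "G w y = w - (t * ?b' y w / (1 + t * ?b' y e)) *\<^sub>R e" for w y
  have smG: "smooth_on UNIV (G w)" for w
    unfolding G_def[abs_def]
    by (intro smooth_on_diff smooth_on_scaleR smooth_on_divide smooth_on_mult smooth_on_add smooth_on_const
        open_UNIV smooth_on_frechet_derivative[OF b]) (use pos in \<open>auto simp: less_le\<close>)
  have dR: "(R has_derivative (\<lambda>w. G w (R z))) (at z)" for z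
  proof (rule has_derivative_inverse_basic[OF has_derivative_shear[OF b] _ _ contR open_UNIV UNIV_I SR])
    have lin: "linear (?b' (R z))" using db has_derivative_linear by blast
    have "linear (\<lambda>w. G w (R z))"
      unfolding G_def
      by (rule linearI)
        (auto simp: linear_add[OF lin] linear_scale[OF lin] algebra_simps add_divide_distrib)
    then show "bounded_linear (\<lambda>w. G w (R z))" by (simp add: linear_conv_bounded_linear)
    have p: "1 + t * ?b' (R z) e \<noteq> 0" using pos[of "R z"] by simp
    show "(\<lambda>w. G w (R z)) \<circ> (\<lambda>v. v + (t * ?b' (R z) v) *\<^sub>R e) = id"
    proof
      fix v
      have "?b' (R z) (v + (t * ?b' (R z) v) *\<^sub>R e) = ?b' (R z) v * (1 + t * ?b' (R z) e)"
        by (simp add: linear_add[OF lin] linear_scale[OF lin] algebra_simps)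
      then show "((\<lambda>w. G w (R z)) \<circ> (\<lambda>v. v + (t * ?b' (R z) v) *\<^sub>R e)) v = id v"
        using p by (simp add: G_def)
    qed
  qed
  \<comment> \<open>Bootstrap: the derivative of \<open>R\<close> is the smooth map
    \<open>G w\<close> composed with \<open>R\<close>, so order \<open>k\<close> for
    \<open>R\<close> gives order \<open>k + 1\<close>.\<close>
  have "Ck_on k UNIV R" for k
  proof (induction k)
    case 0
    then show ?case using contR by (auto intro!: continuous_at_imp_continuous_on)
  next
    case (Suc k)
    show ?case
      by (rule Ck_on_SucI[OF open_UNIV dR])
        (use Suc Ck_on_compose[OF open_UNIV open_UNIV, of R] smG in \<open>auto simp: smooth_on_def\<close>)
  qed
  then have "smooth_on UNIV R" by (simp add: smooth_on_def)
  then show thesis using that RS SR pos by blast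
qed


section \<open>Alternating multilinear forms and Pfaffians\<close>

text \<open>Alternation is vanishing on two equal arguments, as in \<open>is_top_form\<close>. For
  arguments in \<open>real^'m\<close> indexed by \<open>'m\<close> these are exactly the multiples
  of the determinant.\<close>

definition alt_multilinear :: "(('m \<Rightarrow> 'v::real_vector) \<Rightarrow> real) \<Rightarrow> bool" where
  "alt_multilinear F \<longleftrightarrow> (\<forall>vs i. linear (\<lambda>v. F (vs(i := v)))) \<and>
     (\<forall>vs i j. i \<noteq> j \<and> vs i = vs j \<longrightarrow> F vs = 0)"

lemma alt_multilinear_linear: "alt_multilinear F \<Longrightarrow> linear (\<lambda>v. F (vs(i := v)))"
  by (simp add: alt_multilinear_def)

lemma alt_multilinear_eq_0: "alt_multilinear F \<Longrightarrow> i \<noteq> j \<Longrightarrow> vs i = vs j \<Longrightarrow> F vs = 0"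
  unfolding alt_multilinear_def by blast

lemma alt_multilinear_compose:
  assumes "alt_multilinear F" "linear T"
  shows "alt_multilinear (\<lambda>vs. F (\<lambda>i. T (vs i)))"
proof -
  have "linear (\<lambda>v. F (\<lambda>k. T ((vs(i := v)) k)))" for vs :: "'a \<Rightarrow> 'c" and i
  proof -
    have "(\<lambda>k. T ((vs(i := v)) k)) = (\<lambda>k. T (vs k))(i := T v)" for v by auto
    then show ?thesis
      using linear_compose[OF assms(2) alt_multilinear_linear[OF assms(1), of "\<lambda>k. T (vs k)" i]]
      by (simp add: o_def)
  qed
  moreover have "F (\<lambda>i. T (vs i)) = 0" if "i \<noteq> j" "vs i = vs j" for vs i j
    using alt_multilinear_eq_0[OF assms(1) that(1)] that(2) by simp
  ultimately show ?thesis unfolding alt_multilinear_def by blast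
qed

text \<open>Polarisation: expand the value with x + y in both places and drop the values at equal
  arguments.\<close>

lemma alt_multilinear_swap:
  assumes F: "alt_multilinear F" and "i \<noteq> j"
  shows "F (vs(i := y, j := x)) = - F (vs(i := x, j := y))"
proof -
  have l1: "F (vs(i := a + b, j := c)) = F (vs(i := a, j := c)) + F (vs(i := b, j := c))" for a b c
    using linear_add[OF alt_multilinear_linear[OF F, of "vs(j := c)" i]] assms(2)
    by (simp add: fun_upd_twist)
  have l2: "F (vs(i := c, j := a + b)) = F (vs(i := c, j := a)) + F (vs(i := c, j := b))" for a b c
    using linear_add[OF alt_multilinear_linear[OF F, of "vs(i := c)" j]] by simp
  have z: "F (vs(i := a, j := a)) = 0" for a
    by (rule alt_multilinear_eq_0[OF F assms(2)]) (use assms(2) in auto)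
  show ?thesis
    using z[of "x + y"] z[of x] z[of y] by (simp add: l1 l2)
qed

lemma alt_multilinear_scale:
  assumes F: "alt_multilinear F"
  shows "F (\<lambda>i. a i *\<^sub>R vs i) = prod a UNIV * F (vs :: 'm::finite \<Rightarrow> _)"
proof -
  have "F (\<lambda>i. if i \<in> S then a i *\<^sub>R vs i else vs i) = prod a S * F vs" if "finite S" for S
    using that
  proof (induction S)
    case (insert i S)
    let ?g = "\<lambda>k. if k \<in> S then a k *\<^sub>R vs k else vs k"
    have "(\<lambda>k. if k \<in> insert i S then a k *\<^sub>R vs k else vs k) = ?g(i := a i *\<^sub>R vs i)"
      by auto
    moreover have "F (?g(i := a i *\<^sub>R vs i)) = a i * F (?g(i := vs i))"
      using linear_scale[OF alt_multilinear_linear[OF F]] by simp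
    moreover have "?g(i := vs i) = ?g" using insert by auto
    ultimately show ?case using insert by simp
  qed simp
  from this[of UNIV] show ?thesis by simp
qed

text \<open>Uniqueness of the determinant. \<open>F\<close> has to be general because the induction
  exchanges columns, not rows: a column exchange is one linear map applied to every row, so it is
  absorbed by passing from \<open>F\<close> to \<open>F\<close> composed with that map.\<close>

lemma alt_multilinear_rows:
  fixes M :: "real^'m^'m"
  assumes "alt_multilinear F"
  shows "F (\<lambda>i. row i M) = det M * F (\<lambda>i. axis i 1)"
  using assms
proof (induction M arbitrary: F rule: induct_matrix_row_operations[case_names zero_row diagonal swap_cols row_op])
  case (zero_row A i)
  have "F (\<lambda>k. row k A) = F ((\<lambda>k. row k A)(i := 0))"
    using zero_row by (metis fun_upd_triv)
  also have "\<dots> = 0"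
    by (rule linear_0[OF alt_multilinear_linear[OF zero_row.prems]])
  finally show ?case using det_zero_row(2)[OF zero_row.hyps] by simp
next
  case (diagonal A)
  have "row i A = A $ i $ i *\<^sub>R axis i 1" for i
    using diagonal.hyps by (auto simp: vec_eq_iff row_def axis_def)
  then show ?case
    using alt_multilinear_scale[OF diagonal.prems, of "\<lambda>i. A $ i $ i" "\<lambda>i. axis i 1"] diagonal.hyps
    by (simp add: det_diagonal)
next
  case (swap_cols A m n)
  let ?t = "Transposition.transpose m n"
  define T :: "real^'m \<Rightarrow> real^'m" where "T x = (\<chi> j. x $ ?t j)" for x
  have T: "linear T" by (rule linearI) (simp_all add: T_def vec_eq_iff)
  have r: "row i (\<chi> i j. A $ i $ ?t j) = T (row i A)" for i
    by (simp add: T_def row_def vec_eq_iff)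
  have ax: "T (axis i 1) = axis (?t i) 1" for i
    by (auto simp: T_def axis_def vec_eq_iff transpose_eq_iff)
  \<comment> \<open>On the axes the exchange of coordinates swaps two arguments, which produces the
    sign matching that of the determinant.\<close>
  have "F (\<lambda>i. axis (?t i) 1) = F ((\<lambda>i. axis i 1)(m := axis n 1, n := axis m 1))"
    by (rule arg_cong[of _ _ F]) (auto simp: Transposition.transpose_def)
  also have "\<dots> = - F ((\<lambda>i. axis i 1)(m := axis m 1, n := axis n 1))"
    by (rule alt_multilinear_swap[OF swap_cols.prems swap_cols.hyps])
  also have "(\<lambda>i. axis i 1)(m := axis m 1, n := axis n 1) = (\<lambda>i. axis i (1::real))" by auto
  finally have sw: "F (\<lambda>i. axis (?t i) 1) = - F (\<lambda>i. axis i 1)" .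
  have "det (\<chi> i j. A $ i $ ?t j) = - det A"
    using det_permute_columns[of ?t A] swap_cols.hyps by (simp add: permutes_swap_id sign_swap_id)
  then show ?case
    using swap_cols.IH[OF alt_multilinear_compose[OF swap_cols.prems T]] by (simp add: r ax sw)
next
  case (row_op A m n c)
  let ?B = "\<chi> i. if i = m then row m A + c *\<^sub>R row n A else row i A"
  let ?r = "\<lambda>i. row i A"
  have "(\<lambda>i. row i ?B) = ?r(m := ?r m + c *\<^sub>R ?r n)"
    by (auto simp: row_def vec_eq_iff fun_eq_iff)
  then have "F (\<lambda>i. row i ?B) = F (?r(m := ?r m)) + c * F (?r(m := ?r n))"
    by (simp only: linear_add[OF alt_multilinear_linear[OF row_op.prems]]
        linear_scale[OF alt_multilinear_linear[OF row_op.prems]] real_scaleR_def)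
  moreover have "F (?r(m := ?r n)) = 0"
    by (rule alt_multilinear_eq_0[OF row_op.prems row_op.hyps]) (use row_op.hyps in auto)
  moreover have "?r(m := row m A) = ?r" by auto
  ultimately have "F (\<lambda>i. row i ?B) = F ?r" by (simp only: mult_zero_right add_0_right)
  moreover have "det ?B = det A"
    using det_row_operation[OF row_op.hyps, of A c] unfolding scalar_mult_eq_scaleR .
  ultimately show ?case using row_op.IH[OF row_op.prems] by simp
qed

text \<open>The vectors \<open>T (axis i 1)\<close> are the columns of \<open>matrix T\<close>, so
  the row version applies to the transpose, which has the same determinant.\<close>

lemma alt_multilinear_axes:
  fixes T :: "real^'m \<Rightarrow> real^'m"
  assumes "alt_multilinear F"
  shows "F (\<lambda>i. T (axis i 1)) = det (matrix T) * F (\<lambda>i. axis i 1)"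
proof -
  have "T (axis i 1) = row i (transpose (matrix T))" for i
    by (simp add: vec_eq_iff row_def transpose_def matrix_def)
  then show ?thesis
    using alt_multilinear_rows[OF assms, of "transpose (matrix T)"] by simp
qed

section \<open>Top powers of bilinear forms and Pfaffians\<close>

lemma bij_betw_nth_index:
  "bij_betw nth_index {..<CARD('m)} (UNIV :: 'm::{finite,linorder} set)"
proof -
  have "bij_betw ((!) (sorted_list_of_set (UNIV :: 'm set))) {..<CARD('m)} UNIV"
    by (rule bij_betw_nth) auto
  then show ?thesis by (simp add: nth_index_def[abs_def])
qed

lemma nth_index_eq_iff:
  "a < CARD('m) \<Longrightarrow> b < CARD('m) \<Longrightarrow> nth_index a = (nth_index b :: 'm::{finite,linorder}) \<longleftrightarrow> a = b"
  using bij_betw_imp_inj_on[OF bij_betw_nth_index] by (auto dest: inj_onD)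

lemma nth_index_surj:
  obtains a where "a < CARD('m)" "i = (nth_index a :: 'm::{finite,linorder})"
  using bij_betw_imp_surj_on[OF bij_betw_nth_index] by (metis UNIV_I imageE lessThan_iff)

text \<open>The value of \<omega>^n on one fibre, detached from the manifold. For 2n vectors and an
  antisymmetric form it is n! times the Pfaffian of the Gram matrix; the wedge power carries no
  division by n!.\<close>

definition pfaff :: "nat \<Rightarrow> ('v \<Rightarrow> 'v \<Rightarrow> real) \<Rightarrow> ('m::{finite,linorder} \<Rightarrow> 'v) \<Rightarrow> real" where
  "pfaff n B vs =
     (\<Sum>\<sigma> | \<sigma> permutes (UNIV :: 'm set). of_int (sign \<sigma>) *
        (\<Prod>k<n. B (vs (\<sigma> (nth_index (2 * k)))) (vs (\<sigma> (nth_index (2 * k + 1)))))) / 2 ^ n"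

lemma omega_power_eq_pfaff: "omega_power n \<omega> p = pfaff n (\<omega> p)"
  by (simp add: fun_eq_iff omega_power_def pfaff_def)

lemma pfaff_compose: "pfaff n B (\<lambda>i. T (vs i)) = pfaff n (\<lambda>u v. B (T u) (T v)) vs"
  by (simp add: pfaff_def)

text \<open>Since \<open>\<sigma>\<close> permutes the 2n places, the index \<open>i\<close> sits in
  exactly one slot of exactly one factor. The other factors are constant, and that one is linear in
  the slot.\<close>

lemma pfaff_summand_linear:
  fixes vs :: "'m::{finite,linorder} \<Rightarrow> 'v::real_vector" and B :: "'v \<Rightarrow> 'v \<Rightarrow> real"
  assumes card: "CARD('m) = 2 * n" and B1: "\<And>w. linear (\<lambda>u. B u w)" and B2: "\<And>u. linear (B u)"
    and \<sigma>: "\<sigma> permutes UNIV"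
  shows "linear (\<lambda>v. \<Prod>k<n. B ((vs(i := v)) (\<sigma> (nth_index (2 * k)))) ((vs(i := v)) (\<sigma> (nth_index (2 * k + 1)))))"
proof -
  \<comment> \<open>\<open>a\<close> is the place where \<open>i\<close> occurs: its half numbers
    the factor, and its parity tells which argument of \<open>B\<close> it is.\<close>
  obtain a where a: "a < 2 * n" "inv \<sigma> i = nth_index a"
    using nth_index_surj[of "inv \<sigma> i"] card by metis
  then have i: "\<sigma> (nth_index a) = i"
    using permutes_inverses(1)[OF \<sigma>] by metis
  define k0 where "k0 = a div 2"
  have "k0 < n" using a by (simp add: k0_def)
  have ne: "\<sigma> (nth_index c) = i \<longleftrightarrow> c = a" if "c < 2 * n" for c
    using i nth_index_eq_iff[of c a, where 'm='m] that a card permutes_inj[OF \<sigma>] by (metis injD)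
  have rest: "B ((vs(i := v)) (\<sigma> (nth_index (2 * k)))) ((vs(i := v)) (\<sigma> (nth_index (2 * k + 1))))
      = B (vs (\<sigma> (nth_index (2 * k)))) (vs (\<sigma> (nth_index (2 * k + 1))))" if "k < n" "k \<noteq> k0" for k v
    using that ne[of "2 * k"] ne[of "2 * k + 1"] by (auto simp: k0_def)
  let ?P = "\<Prod>k\<in>{..<n} - {k0}. B (vs (\<sigma> (nth_index (2 * k)))) (vs (\<sigma> (nth_index (2 * k + 1))))"
  have eq: "(\<Prod>k<n. B ((vs(i := v)) (\<sigma> (nth_index (2 * k)))) ((vs(i := v)) (\<sigma> (nth_index (2 * k + 1)))))
    = ?P *\<^sub>R B ((vs(i := v)) (\<sigma> (nth_index (2 * k0)))) ((vs(i := v)) (\<sigma> (nth_index (2 * k0 + 1))))" for v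
    using \<open>k0 < n\<close> rest by (subst prod.remove[of _ k0]) (auto intro!: prod.cong)
  show ?thesis
  proof (cases "even a")
    case True
    then have "a = 2 * k0" by (auto simp: k0_def)
    then show ?thesis
      unfolding eq using ne[of "2 * k0 + 1"] a \<open>k0 < n\<close> i
      by (auto intro!: linear_compose_scale_right B1 simp del: real_scaleR_def)
  next
    case False
    then have "a = 2 * k0 + 1" by (auto simp: k0_def)
    then show ?thesis
      unfolding eq using ne[of "2 * k0"] a \<open>k0 < n\<close> i
      by (auto intro!: linear_compose_scale_right B2 simp del: real_scaleR_def)
  qed
qed

text \<open>If \<open>vs i = vs j\<close>, composing every permutation with the transposition of i
  and j leaves the products unchanged and flips the signs, so the sum equals its own
  negative.\<close>

lemma alt_multilinear_pfaff:
  fixes B :: "'v::real_vector \<Rightarrow> 'v \<Rightarrow> real"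
  assumes card: "CARD('m::{finite,linorder}) = 2 * n"
    and B1: "\<And>w. linear (\<lambda>u. B u w)" and B2: "\<And>u. linear (B u)"
  shows "alt_multilinear (pfaff n B :: ('m \<Rightarrow> 'v) \<Rightarrow> real)"
  unfolding alt_multilinear_def
proof (intro conjI allI impI)
  fix vs :: "'m \<Rightarrow> 'v" and i
  have "linear (\<lambda>v. (1 / 2 ^ n) *\<^sub>R (\<Sum>\<sigma> | \<sigma> permutes (UNIV :: 'm set). of_int (sign \<sigma>) *\<^sub>R
        (\<Prod>k<n. B ((vs(i := v)) (\<sigma> (nth_index (2 * k)))) ((vs(i := v)) (\<sigma> (nth_index (2 * k + 1)))))))"
    by (intro linear_compose_scale_right linear_compose_sum ballI pfaff_summand_linear[OF card B1 B2]) auto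
  then show "linear (\<lambda>v. pfaff n B (vs(i := v)))"
    by (simp add: pfaff_def)
next
  fix vs :: "'m \<Rightarrow> 'v" and i j
  assume ij: "i \<noteq> j \<and> vs i = vs j"
  let ?q = "Transposition.transpose i j"
  let ?f = "\<lambda>\<sigma>. of_int (sign \<sigma>) * (\<Prod>k<n. B (vs (\<sigma> (nth_index (2 * k)))) (vs (\<sigma> (nth_index (2 * k + 1)))))"
  have q: "?q permutes UNIV" by (simp add: permutes_swap_id)
  have vq: "vs (?q k) = vs k" for k using ij by (auto simp: Transposition.transpose_def)
  have "sum ?f {\<sigma>. \<sigma> permutes UNIV} = (\<Sum>\<sigma> | \<sigma> permutes UNIV. ?f (?q \<circ> \<sigma>))"
    by (rule setum_permutations_compose_left[OF q])
  also have "\<dots> = (\<Sum>\<sigma> | \<sigma> permutes UNIV. - ?f \<sigma>)"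
  proof (rule sum.cong)
    fix \<sigma> :: "'m \<Rightarrow> 'm" assume "\<sigma> \<in> {\<sigma>. \<sigma> permutes UNIV}"
    then have "sign (?q \<circ> \<sigma>) = - sign \<sigma>"
      using ij q by (subst sign_compose) (auto simp: sign_swap_id permutation_permutes intro!: exI[of _ UNIV])
    then show "?f (?q \<circ> \<sigma>) = - ?f \<sigma>" by (simp add: vq)
  qed simp
  finally have "sum ?f {\<sigma>. \<sigma> permutes UNIV} = 0" by (simp add: sum_negf)
  then show "pfaff n B vs = 0" by (simp add: pfaff_def)
qed

text \<open>Symplectic Gram-Schmidt: k hyperbolic pairs are extended by a vector made B-orthogonal
  to them, together with a partner provided by nondegeneracy.\<close>

lemma symplectic_basis_exists:
  fixes B :: "'v::euclidean_space \<Rightarrow> 'v \<Rightarrow> real"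
  assumes B1: "\<And>w. linear (\<lambda>u. B u w)" and B2: "\<And>u. linear (B u)"
    and anti: "\<And>u v. B u v = - B v u" and nondeg: "\<And>u. u \<noteq> 0 \<Longrightarrow> \<exists>w. B u w \<noteq> 0"
    and "2 * k \<le> DIM('v)"
  shows "\<exists>e f. \<forall>i<k. \<forall>j<k. B (e i) (e j) = 0 \<and> B (f i) (f j) = 0 \<and>
           B (e i) (f j) = (if i = j then 1 else 0)"
  using assms(5)
proof (induction k)
  case (Suc k)
  then obtain e f where ef: "\<And>i j. i < k \<Longrightarrow> j < k \<Longrightarrow> B (e i) (e j) = 0"
    "\<And>i j. i < k \<Longrightarrow> j < k \<Longrightarrow> B (f i) (f j) = 0"
    "\<And>i j. i < k \<Longrightarrow> j < k \<Longrightarrow> B (e i) (f j) = (if i = j then 1 else 0)"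
    by auto
  have fe: "B (f i) (e j) = (if i = j then -1 else 0)" if "i < k" "j < k" for i j
    using anti[of "f i" "e j"] ef(3)[OF that(2,1)] by auto
  \<comment> \<open>Projection to the B-orthogonal complement of the pairs. The two sums carry
    different signs because B (f i) (e i) = -1.\<close>
  define pr where "pr v = v - (\<Sum>i<k. B v (f i) *\<^sub>R e i) + (\<Sum>i<k. B v (e i) *\<^sub>R f i)" for v
  have Bpr: "B (pr v) x = B v x - (\<Sum>i<k. B v (f i) * B (e i) x) + (\<Sum>i<k. B v (e i) * B (f i) x)" for v x
    unfolding pr_def
    by (simp add: linear_add[OF B1] linear_diff[OF B1] linear_sum[OF B1] linear_scale[OF B1])
  have pre: "B (pr v) (e j) = 0" and prf0: "B (pr v) (f j) = 0" if "j < k" for v j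
    using that by (auto simp: Bpr ef fe if_distrib sum.delta cong: if_cong)
  have Bx: "B x (pr v) = B x v" if "\<And>j. j < k \<Longrightarrow> B x (e j) = 0" "\<And>j. j < k \<Longrightarrow> B x (f j) = 0" for x v
    unfolding pr_def using that
    by (simp add: linear_add[OF B2] linear_diff[OF B2] linear_sum[OF B2] linear_scale[OF B2])
  \<comment> \<open>At most 2k vectors cannot span a space of dimension at least 2k + 2; a vector
    outside their span has a nonzero projection.\<close>
  let ?S = "e ` {..<k} \<union> f ` {..<k}"
  have "card ?S \<le> card (e ` {..<k}) + card (f ` {..<k})" by (rule card_Un_le)
  also have "\<dots> \<le> k + k" using card_image_le[of "{..<k}" e] card_image_le[of "{..<k}" f] by simp
  also have "\<dots> < DIM('v)" using Suc.prems by simp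
  finally have "dim ?S < DIM('v)"
    using dim_le_card'[of ?S] by simp
  then have "span ?S \<noteq> UNIV" using dim_eq_full[of ?S] by simp
  then obtain v where v: "v \<notin> span ?S" by auto
  have "pr v \<noteq> 0"
  proof
    assume "pr v = 0"
    then have "v = (\<Sum>i<k. B v (f i) *\<^sub>R e i) - (\<Sum>i<k. B v (e i) *\<^sub>R f i)"
      by (simp add: pr_def algebra_simps)
    moreover have "\<dots> \<in> span ?S"
      by (intro span_diff span_sum span_scale span_base) auto
    ultimately show False using v by simp
  qed
  then obtain w where w: "B (pr v) w \<noteq> 0" using nondeg by blast
  define e' where "e' = pr v"
  \<comment> \<open>\<open>w\<close> need not be orthogonal to the old pairs. By \<open>Bx\<close>
    its projection has the same pairing with \<open>e'\<close>, so the scaling still gives the value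
    1.\<close>
  define f' where "f' = pr (w /\<^sub>R B (pr v) w)"
  have "B e' f' = 1"
    unfolding e'_def f'_def using pre prf0 w by (simp add: Bx linear_scale[OF B2])
  moreover have "B e' e' = 0" "B f' f' = 0" using anti[of e' e'] anti[of f' f'] by auto
  moreover have "B e' (e j) = 0" "B e' (f j) = 0" "B f' (e j) = 0" "B f' (f j) = 0"
    "B (e j) e' = 0" "B (f j) e' = 0" "B (e j) f' = 0" "B (f j) f' = 0" if "j < k" for j
    using pre[OF that] prf0[OF that] anti[of "e j"] anti[of "f j"] unfolding e'_def f'_def by auto
  ultimately show ?case
    by (intro exI[of _ "e(k := e')"] exI[of _ "f(k := f')"]) (auto simp: less_Suc_eq ef)
qed simp

text \<open>Exchanging the two entries of one pair flips the sign of the permutation and, by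
  antisymmetry, the sign of one factor; the two signs cancel.\<close>

lemma pfaff_swap_in_pair:
  fixes C :: "'m::{finite,linorder} \<Rightarrow> 'm \<Rightarrow> real"
  assumes card: "CARD('m) = 2 * n" and anti: "\<And>a b. C a b = - C b a"
    and \<sigma>: "\<sigma> permutes UNIV" and l: "l < n"
  defines "Q \<equiv> \<lambda>\<sigma>. of_int (sign \<sigma>) * (\<Prod>k<n. C (\<sigma> (nth_index (2 * k))) (\<sigma> (nth_index (2 * k + 1))))"
  shows "Q (\<sigma> \<circ> Transposition.transpose (nth_index (2 * l)) (nth_index (2 * l + 1))) = Q \<sigma>"
proof -
  let ?a = "nth_index (2 * l) :: 'm" and ?b = "nth_index (2 * l + 1) :: 'm"
  let ?t = "Transposition.transpose ?a ?b"
  have ab: "?a \<noteq> ?b" using l card by (simp add: nth_index_eq_iff)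
  have s: "sign (\<sigma> \<circ> ?t) = - sign \<sigma>"
    using ab \<sigma> by (subst sign_compose)
      (auto simp: sign_swap_id permutation_permutes permutes_swap_id intro!: exI[of _ UNIV])
  have "C ((\<sigma> \<circ> ?t) (nth_index (2 * k))) ((\<sigma> \<circ> ?t) (nth_index (2 * k + 1)))
      = (if k = l then -1 else 1) * C (\<sigma> (nth_index (2 * k))) (\<sigma> (nth_index (2 * k + 1)))" if "k < n" for k
  proof (cases "k = l")
    case True
    then show ?thesis using anti[of "\<sigma> ?b" "\<sigma> ?a"] by simp
  next
    case False
    have "2 * k \<noteq> 2 * l" "2 * k \<noteq> 2 * l + 1" "2 * k + 1 \<noteq> 2 * l" "2 * k + 1 \<noteq> 2 * l + 1"
      using False by presburger+
    then have "nth_index (2 * k) \<noteq> ?a" "nth_index (2 * k) \<noteq> ?b"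
      "nth_index (2 * k + 1) \<noteq> ?a" "nth_index (2 * k + 1) \<noteq> ?b"
      using that l card by (auto simp: nth_index_eq_iff)
    then show ?thesis using False by (simp add: transpose_apply_other)
  qed
  then have "(\<Prod>k<n. C ((\<sigma> \<circ> ?t) (nth_index (2 * k))) ((\<sigma> \<circ> ?t) (nth_index (2 * k + 1))))
     = (\<Prod>k<n. (if k = l then -1 else 1) * C (\<sigma> (nth_index (2 * k))) (\<sigma> (nth_index (2 * k + 1))))"
    by (intro prod.cong) auto
  also have "\<dots> = - (\<Prod>k<n. C (\<sigma> (nth_index (2 * k))) (\<sigma> (nth_index (2 * k + 1))))"
    using l by (simp add: prod.distrib prod.delta)
  finally show ?thesis unfolding Q_def s by simp
qed

text \<open>Exchanging two whole pairs takes two transpositions, so the sign is unchanged, and the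
  factors of the product are merely permuted.\<close>

lemma pfaff_swap_pairs:
  fixes C :: "'m::{finite,linorder} \<Rightarrow> 'm \<Rightarrow> real"
  assumes card: "CARD('m) = 2 * n"
    and \<sigma>: "\<sigma> permutes UNIV" and l: "l < n" "j < n" "l \<noteq> j"
  defines "Q \<equiv> \<lambda>\<sigma>. of_int (sign \<sigma>) * (\<Prod>k<n. C (\<sigma> (nth_index (2 * k))) (\<sigma> (nth_index (2 * k + 1))))"
  shows "Q (\<sigma> \<circ> (Transposition.transpose (nth_index (2 * l)) (nth_index (2 * j)) \<circ>
            Transposition.transpose (nth_index (2 * l + 1)) (nth_index (2 * j + 1)))) = Q \<sigma>"
proof -
  let ?t1 = "Transposition.transpose (nth_index (2 * l)) (nth_index (2 * j)) :: 'm \<Rightarrow> 'm"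
  let ?t2 = "Transposition.transpose (nth_index (2 * l + 1)) (nth_index (2 * j + 1)) :: 'm \<Rightarrow> 'm"
  let ?t = "Transposition.transpose l j"
  have p: "permutation ?t1" "permutation ?t2" "permutation \<sigma>"
    using \<sigma> by (auto simp: permutation_permutes permutes_swap_id intro!: exI[of _ UNIV])
  have "sign (?t1 \<circ> ?t2) = 1"
    using l card by (subst sign_compose[OF p(1,2)]) (simp add: sign_swap_id nth_index_eq_iff)
  then have s: "sign (\<sigma> \<circ> (?t1 \<circ> ?t2)) = sign \<sigma>"
    by (subst sign_compose[OF p(3) permutation_compose[OF p(1,2)]]) simp
  have 1: "(?t1 \<circ> ?t2) (nth_index (2 * k)) = nth_index (2 * ?t k)"
    and 2: "(?t1 \<circ> ?t2) (nth_index (2 * k + 1)) = nth_index (2 * ?t k + 1)" if "k < n" for k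
  proof -
    have "2 * a \<noteq> 2 * b + 1" for a b :: nat by presburger
    then have *: "(nth_index (2 * a) :: 'm) \<noteq> nth_index (2 * b + 1)"
      "(nth_index (2 * b + 1) :: 'm) \<noteq> nth_index (2 * a)"
      "(nth_index (2 * a) :: 'm) = nth_index (2 * b) \<longleftrightarrow> a = b"
      "(nth_index (2 * a + 1) :: 'm) = nth_index (2 * b + 1) \<longleftrightarrow> a = b" if "a < n" "b < n" for a b
      using that card by (auto simp: nth_index_eq_iff) presburger+
    show "(?t1 \<circ> ?t2) (nth_index (2 * k)) = nth_index (2 * ?t k)"
      "(?t1 \<circ> ?t2) (nth_index (2 * k + 1)) = nth_index (2 * ?t k + 1)"
      unfolding Transposition.transpose_def o_def using l that by (simp_all add: * del: One_nat_def add_Suc_right)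
  qed
  have "(\<Prod>k<n. C ((\<sigma> \<circ> (?t1 \<circ> ?t2)) (nth_index (2 * k))) ((\<sigma> \<circ> (?t1 \<circ> ?t2)) (nth_index (2 * k + 1))))
     = (\<Prod>k<n. C (\<sigma> (nth_index (2 * ?t k))) (\<sigma> (nth_index (2 * ?t k + 1))))"
  proof (rule prod.cong)
    fix k assume "k \<in> {..<n}"
    then have "k < n" by simp
    have "(\<sigma> \<circ> (?t1 \<circ> ?t2)) x = \<sigma> ((?t1 \<circ> ?t2) x)" for x by simp
    then show "C ((\<sigma> \<circ> (?t1 \<circ> ?t2)) (nth_index (2 * k))) ((\<sigma> \<circ> (?t1 \<circ> ?t2)) (nth_index (2 * k + 1)))
      = C (\<sigma> (nth_index (2 * ?t k))) (\<sigma> (nth_index (2 * ?t k + 1)))"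
      by (simp only: 1[OF \<open>k < n\<close>] 2[OF \<open>k < n\<close>])
  qed simp
  also have "\<dots> = (\<Prod>k<n. C (\<sigma> (nth_index (2 * k))) (\<sigma> (nth_index (2 * k + 1))))"
  proof (rule prod.reindex_bij_betw)
    have "?t permutes {..<n}" using l by (intro permutes_swap_id) auto
    then show "bij_betw ?t {..<n} {..<n}" by (rule permutes_imp_bij)
  qed
  finally show ?thesis unfolding Q_def s by simp
qed

text \<open>A permutation whose summand does not vanish respects the pairs. Undoing flips within pairs and
  exchanges of pairs, neither of which changes the summand, reduces it to the identity.\<close>

lemma pfaff_summand_nonneg:
  fixes C :: "'m::{finite,linorder} \<Rightarrow> 'm \<Rightarrow> real"
  assumes card: "CARD('m) = 2 * n" and anti: "\<And>a b. C a b = - C b a"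
    and C: "\<And>k l. k < n \<Longrightarrow> l < n \<Longrightarrow> C (nth_index (2 * k)) (nth_index (2 * l)) = 0"
      "\<And>k l. k < n \<Longrightarrow> l < n \<Longrightarrow> C (nth_index (2 * k)) (nth_index (2 * l + 1)) = (if k = l then 1 else 0)"
    and \<sigma>: "\<sigma> permutes UNIV"
  defines "Q \<equiv> \<lambda>\<sigma>. of_int (sign \<sigma>) * (\<Prod>k<n. C (\<sigma> (nth_index (2 * k))) (\<sigma> (nth_index (2 * k + 1))))"
  shows "0 \<le> Q \<sigma>"
proof -
  \<comment> \<open>\<open>d\<close> counts the pairs not yet in place: the first
    \<open>n - d\<close> pairs are fixed pointwise. For d = 0 only the identity is left, and for d =
    n every permutation is covered.\<close>
  have "0 \<le> Q \<sigma>" if "\<sigma> permutes UNIV" "d \<le> n" "\<And>i. i < 2 * (n - d) \<Longrightarrow> \<sigma> (nth_index i) = nth_index i" for d \<sigma>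
    using that
  proof (induction d arbitrary: \<sigma>)
    case 0
    have "\<sigma> = id"
      using 0(3) nth_index_surj card by (metis diff_zero eq_id_iff)
    then show ?case using C(2) by (simp add: Q_def)
  next
    case (Suc d)
    define j where "j = n - Suc d"
    have j: "j < n" "n - d = Suc j" using Suc.prems by (auto simp: j_def)
    have fx: "\<sigma> (nth_index i) = nth_index i" if "i < 2 * j" for i
      using Suc.prems(3) that by (simp add: j_def)
    have inj: "\<sigma> (nth_index a) = \<sigma> (nth_index b) \<longleftrightarrow> a = b" if "a < 2 * n" "b < 2 * n" for a b
      using that card permutes_inj[OF Suc.prems(1)] by (metis injD nth_index_eq_iff)
    \<comment> \<open>The place of the value 2j, the first one not known to be fixed. It is at least
      2j since the earlier places are fixed; if it is the second entry of a pair, a flip within that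
      pair makes it the first.\<close>
    obtain a where a: "a < 2 * n" "inv \<sigma> (nth_index (2 * j)) = nth_index a"
      using nth_index_surj[of "inv \<sigma> (nth_index (2 * j))"] card by metis
    have \<sigma>a: "\<sigma> (nth_index a) = nth_index (2 * j)"
      using permutes_inverses(1)[OF Suc.prems(1)] a by metis
    have aj: "2 * j \<le> a"
    proof (rule ccontr)
      assume "\<not> 2 * j \<le> a"
      then have "a < 2 * j" by simp
      then have "nth_index a = (nth_index (2 * j) :: 'm)" using fx \<sigma>a by metis
      then show False using nth_index_eq_iff[of a "2 * j", where 'm='m] a j card \<open>a < 2 * j\<close> by simp
    qed
    define k where "k = a div 2"
    have k: "k < n" "j \<le> k" using a aj by (auto simp: k_def)
    let ?t = "Transposition.transpose (nth_index (2 * k)) (nth_index (2 * k + 1)) :: 'm \<Rightarrow> 'm"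
    define \<sigma>1 where "\<sigma>1 = (if even a then \<sigma> else \<sigma> \<circ> ?t)"
    have \<sigma>1: "\<sigma>1 permutes UNIV"
      using Suc.prems(1) by (auto simp: \<sigma>1_def intro!: permutes_compose permutes_swap_id)
    have Q1: "Q \<sigma>1 = Q \<sigma>"
      using pfaff_swap_in_pair[of n C \<sigma> k, OF card anti Suc.prems(1) k(1)] unfolding \<sigma>1_def Q_def by simp
    have \<sigma>1k: "\<sigma>1 (nth_index (2 * k)) = nth_index (2 * j)"
    proof (cases "even a")
      case True
      then have "a = 2 * k" by (auto simp: k_def)
      then show ?thesis using \<sigma>a True by (simp add: \<sigma>1_def)
    next
      case False
      then have "a = 2 * k + 1" by (auto simp: k_def)
      then show ?thesis using \<sigma>a False by (simp add: \<sigma>1_def)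
    qed
    have \<sigma>1fix: "\<sigma>1 (nth_index i) = nth_index i" if "i < 2 * j" for i
    proof -
      have "nth_index i \<noteq> (nth_index (2 * k) :: 'm)" "nth_index i \<noteq> (nth_index (2 * k + 1) :: 'm)"
        using that k card by (auto simp: nth_index_eq_iff)
      then show ?thesis using fx[OF that] by (simp add: \<sigma>1_def transpose_apply_other)
    qed
    show ?case
    proof (cases "Q \<sigma> = 0")
      case False
      then have "Q \<sigma>1 \<noteq> 0" using Q1 by simp
      then have "C (\<sigma>1 (nth_index (2 * k))) (\<sigma>1 (nth_index (2 * k + 1))) \<noteq> 0"
        using k(1) by (auto simp: Q_def)
      then have ne: "C (nth_index (2 * j)) (\<sigma>1 (nth_index (2 * k + 1))) \<noteq> 0" by (simp add: \<sigma>1k)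
      \<comment> \<open>A nonvanishing factor forces the partner of 2j to be 2j + 1, because 2j
        pairs to zero with every other index.\<close>
      obtain c where c: "c < 2 * n" "\<sigma>1 (nth_index (2 * k + 1)) = nth_index c"
        using nth_index_surj[of "\<sigma>1 (nth_index (2 * k + 1))"] card by metis
      have "c = 2 * j + 1"
      proof (cases "even c")
        case True
        then obtain m where "c = 2 * m" by (auto elim: evenE)
        then show ?thesis using ne c C(1)[of j m] j by simp
      next
        case False
        then obtain m where "c = 2 * m + 1" by (auto elim: oddE)
        then show ?thesis using ne c C(2)[of j m] j by (auto split: if_splits)
      qed
      then have \<sigma>1k': "\<sigma>1 (nth_index (2 * k + 1)) = nth_index (2 * j + 1)" using c by simp
      let ?t1 = "Transposition.transpose (nth_index (2 * k)) (nth_index (2 * j)) :: 'm \<Rightarrow> 'm"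
      let ?t2 = "Transposition.transpose (nth_index (2 * k + 1)) (nth_index (2 * j + 1)) :: 'm \<Rightarrow> 'm"
      \<comment> \<open>Moves the pair from places 2k, 2k + 1 to 2j, 2j + 1; for k = j both
        transpositions are the identity.\<close>
      define \<sigma>2 where "\<sigma>2 = \<sigma>1 \<circ> (?t1 \<circ> ?t2)"
      have \<sigma>2: "\<sigma>2 permutes UNIV"
        unfolding \<sigma>2_def by (intro permutes_compose permutes_swap_id \<sigma>1) auto
      have Q2: "Q \<sigma>2 = Q \<sigma>1"
      proof (cases "k = j")
        case False
        show ?thesis
          unfolding \<sigma>2_def Q_def by (rule pfaff_swap_pairs[OF card \<sigma>1 k(1) j(1) False])
      qed (simp add: \<sigma>2_def)
      have "\<sigma>2 (nth_index i) = nth_index i" if "i < 2 * (n - d)" for i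
      proof -
        have "i < 2 * j \<or> i = 2 * j \<or> i = 2 * j + 1" using that j by auto
        moreover have "nth_index (2 * j) \<noteq> (nth_index (2 * k + 1) :: 'm)"
          "nth_index (2 * j) \<noteq> (nth_index (2 * j + 1) :: 'm)"
          "nth_index (2 * k + 1) \<noteq> (nth_index (2 * j) :: 'm)"
          "nth_index (2 * k + 1) \<noteq> (nth_index (2 * k) :: 'm)"
          using j k card by (auto simp: nth_index_eq_iff)
        moreover have "nth_index i \<noteq> (nth_index (2 * k) :: 'm)" "nth_index i \<noteq> (nth_index (2 * k + 1) :: 'm)"
          "nth_index i \<noteq> (nth_index (2 * j) :: 'm)" "nth_index i \<noteq> (nth_index (2 * j + 1) :: 'm)" if "i < 2 * j"
          using that j k card by (auto simp: nth_index_eq_iff)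
        ultimately show ?thesis
          using \<sigma>1k \<sigma>1k' \<sigma>1fix by (auto simp: \<sigma>2_def transpose_apply_other)
      qed
      then have "0 \<le> Q \<sigma>2"
        using Suc.IH[OF \<sigma>2] Suc.prems(2) by simp
      then show ?thesis using Q1 Q2 by simp
    qed simp
  qed
  from this[of \<sigma> n] show ?thesis using \<sigma> by simp
qed

text \<open>On a symplectic basis every summand is nonnegative and the identity contributes 1, so
  the sum is positive. The value on the axes differs from it by a determinant factor, hence cannot
  vanish.\<close>

lemma pfaff_axes_nonzero:
  fixes B :: "real^'m::{finite,linorder} \<Rightarrow> real^'m::_ \<Rightarrow> real"
  assumes card: "CARD('m) = 2 * n"
    and B1: "\<And>w. linear (\<lambda>u. B u w)" and B2: "\<And>u. linear (B u)"
    and anti: "\<And>u v. B u v = - B v u" and nondeg: "\<And>u. u \<noteq> 0 \<Longrightarrow> \<exists>w. B u w \<noteq> 0"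
  shows "pfaff n B (\<lambda>i. axis i 1) \<noteq> 0"
proof -
  obtain e f where ef: "\<And>i j. i < n \<Longrightarrow> j < n \<Longrightarrow> B (e i) (e j) = 0"
    "\<And>i j. i < n \<Longrightarrow> j < n \<Longrightarrow> B (f i) (f j) = 0"
    "\<And>i j. i < n \<Longrightarrow> j < n \<Longrightarrow> B (e i) (f j) = (if i = j then 1 else 0)"
    using symplectic_basis_exists[OF B1 B2 anti nondeg, of n] card by auto
  \<comment> \<open>The symplectic basis interleaved as e 0, f 0, e 1, f 1, ..., so that consecutive
    places form the hyperbolic pairs.\<close>
  define vs :: "'m \<Rightarrow> real^'m::_" where
    "vs i = (let j = inv_into {..<2 * n} nth_index i in if even j then e (j div 2) else f (j div 2))" for i
  have inv: "inv_into {..<2 * n} nth_index (nth_index a :: 'm) = a" if "a < 2 * n" for a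
    using bij_betw_imp_inj_on[OF bij_betw_nth_index[where 'm='m]] that card by (simp add: inv_into_f_f)
  have ve: "vs (nth_index (2 * k)) = e k" and vf: "vs (nth_index (2 * k + 1)) = f k" if "k < n" for k
    using that inv[of "2 * k"] inv[of "2 * k + 1"] by (auto simp: vs_def Let_def)
  let ?C = "\<lambda>a b. B (vs a) (vs b)"
  let ?Q = "\<lambda>\<sigma>. of_int (sign \<sigma>) * (\<Prod>k<n. ?C (\<sigma> (nth_index (2 * k))) (\<sigma> (nth_index (2 * k + 1))))"
  have nonneg: "0 \<le> ?Q \<sigma>" if "\<sigma> permutes (UNIV :: 'm set)" for \<sigma>
    by (rule pfaff_summand_nonneg[OF card anti _ _ that]) (simp_all only: ve vf ef)
  have "?Q id = 1"
    using ve vf ef by (auto intro!: prod.neutral)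
  then have "1 \<le> (\<Sum>\<sigma> | \<sigma> permutes (UNIV :: 'm set). ?Q \<sigma>)"
    using member_le_sum[of id "{\<sigma>. \<sigma> permutes (UNIV :: 'm set)}" ?Q] nonneg
    by (auto simp: permutes_id finite_permutations)
  then have "pfaff n B vs \<noteq> 0" by (simp add: pfaff_def)
  moreover have "pfaff n B vs = det (\<chi> i. vs i) * pfaff n B (\<lambda>i. axis i 1)"
    using alt_multilinear_rows[OF alt_multilinear_pfaff[OF card B1 B2], of "\<chi> i. vs i"]
    by (simp add: row_def)
  ultimately show ?thesis by auto
qed


section \<open>Functions and vector fields on a manifold\<close>

lemma linear_eq_sum_axis:
  fixes L :: "real^'m \<Rightarrow> 'v::real_vector"
  assumes "linear L"
  shows "L u = (\<Sum>i\<in>UNIV. u $ i *\<^sub>R L (axis i 1))"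
proof -
  have "L u = L (\<Sum>i\<in>UNIV. u $ i *\<^sub>R axis i 1)"
    by (simp add: basis_expansion flip: scalar_mult_eq_scaleR)
  also have "\<dots> = (\<Sum>i\<in>UNIV. u $ i *\<^sub>R L (axis i 1))"
    by (simp only: linear_sum[OF assms] linear_scale[OF assms])
  finally show ?thesis .
qed

text \<open>Not continuous in general; the extension of a smooth function is smooth when the
  function vanishes outside a compact subset of the chart image.\<close>

definition chart_ext :: "('a, 'm::finite) chart \<Rightarrow> (real^'m \<Rightarrow> real) \<Rightarrow> 'a \<Rightarrow> real" where
  "chart_ext c g q = (if q \<in> fst c then g (snd c q) else 0)"

text \<open>The coordinates of a tangent vector. Meaningful on \<open>tangent_space A p\<close> for
  \<open>p\<close> in the chart domain, where \<open>coord_vec A c p\<close> is a bijection from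
  coordinates to tangent vectors.\<close>

definition vcomp :: "('a, 'm::finite) chart set \<Rightarrow> ('a, 'm) chart \<Rightarrow> 'a \<Rightarrow> 'a tvec \<Rightarrow> real^'m" where
  "vcomp A c p = inv (coord_vec A c p)"

definition chart_rep :: "('a, 'm::finite) chart \<Rightarrow> ('a, 'm) chart \<Rightarrow> ('a \<Rightarrow> 'a) \<Rightarrow> real^'m \<Rightarrow> real^'m" where
  "chart_rep c c' \<phi> = snd c' \<circ> \<phi> \<circ> chart_inv c"

definition chart_deriv ::
  "('a, 'm::finite) chart \<Rightarrow> ('a, 'm) chart \<Rightarrow> ('a \<Rightarrow> 'a) \<Rightarrow> 'a \<Rightarrow> real^'m \<Rightarrow> real^'m" where
  "chart_deriv c c' \<phi> p = frechet_derivative (chart_rep c c' \<phi>) (at (snd c p))"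

text \<open>The constant function 0 is the zero tangent vector. With a bump supported in the chart
  for \<open>b\<close>, the field is smooth and serves both as a test field and as the velocity of a
  lifted shear.\<close>

definition chart_field ::
  "('a, 'm::finite) chart set \<Rightarrow> ('a, 'm) chart \<Rightarrow> (real^'m \<Rightarrow> real) \<Rightarrow> real^'m \<Rightarrow> 'a \<Rightarrow> 'a tvec" where
  "chart_field A c b u q = (if q \<in> fst c then coord_vec A c q (b (snd c q) *\<^sub>R u) else (\<lambda>f. 0))"

locale smooth_manifold =
  fixes A :: "('a::t2_space, 'm::finite) chart set"
  assumes atlas: "smooth_atlas A"
begin

section \<open>Charts, smooth maps and smooth functions\<close>

lemma chart_openD: "c \<in> A \<Longrightarrow> open (fst c)" "c \<in> A \<Longrightarrow> open (snd c ` fst c)"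
  using atlas by (auto simp: smooth_atlas_def is_chart_def)

lemma chart_homeomorphism:
  "c \<in> A \<Longrightarrow> homeomorphism (fst c) (snd c ` fst c) (snd c) (chart_inv c)"
  using atlas by (auto simp: smooth_atlas_def is_chart_def)

lemma chart_continuous_on: "c \<in> A \<Longrightarrow> continuous_on (fst c) (snd c)"
  "c \<in> A \<Longrightarrow> continuous_on (snd c ` fst c) (chart_inv c)"
  using chart_homeomorphism by (auto simp: homeomorphism_def)

lemma chart_inv_snd [simp]: "c \<in> A \<Longrightarrow> p \<in> fst c \<Longrightarrow> chart_inv c (snd c p) = p"
  using chart_homeomorphism by (auto simp: homeomorphism_def)

lemma snd_chart_inv [simp]: "c \<in> A \<Longrightarrow> y \<in> snd c ` fst c \<Longrightarrow> snd c (chart_inv c y) = y"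
  by auto

lemma chart_inv_in [simp]: "c \<in> A \<Longrightarrow> y \<in> snd c ` fst c \<Longrightarrow> chart_inv c y \<in> fst c"
  by auto

lemma chart_cover: obtains c where "c \<in> A" "p \<in> fst c"
proof -
  have "p \<in> (\<Union>c\<in>A. fst c)" using atlas by (simp add: smooth_atlas_def)
  then show thesis using that by auto
qed

lemma chart_image_eq:
  assumes "c \<in> A"
  shows "snd c ` (fst c \<inter> U) = snd c ` fst c \<inter> chart_inv c -` U"
  using assms by auto

lemma open_chart_image:
  assumes "c \<in> A" "open U"
  shows "open (snd c ` (fst c \<inter> U))"
  unfolding chart_image_eq[OF assms(1)]
  by (rule continuous_open_preimage[OF chart_continuous_on(2)[OF assms(1)] chart_openD(2)[OF assms(1)] assms(2)])

lemma open_chart_preimage: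
  assumes "c \<in> A" "open T"
  shows "open (fst c \<inter> snd c -` T)"
  by (rule continuous_open_preimage[OF chart_continuous_on(1)[OF assms(1)] chart_openD(1)[OF assms(1)] assms(2)])

lemma smooth_map_continuous: "smooth_map A \<phi> \<Longrightarrow> continuous_on UNIV \<phi>"
  by (simp add: smooth_map_def)

lemma open_chart_rep_domain:
  assumes "smooth_map A \<phi>" "c \<in> A" "c' \<in> A"
  shows "open (snd c ` (fst c \<inter> \<phi> -` fst c'))"
  by (intro open_chart_image assms open_vimage chart_openD smooth_map_continuous)

lemma smooth_on_chart_rep:
  assumes "smooth_map A \<phi>" "c \<in> A" "c' \<in> A"
  shows "smooth_on (snd c ` (fst c \<inter> \<phi> -` fst c')) (chart_rep c c' \<phi>)"
  using assms by (simp add: smooth_map_def chart_rep_def)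

lemma chart_rep_in:
  assumes "c \<in> A" "y \<in> snd c ` (fst c \<inter> \<phi> -` fst c')"
  shows "chart_rep c c' \<phi> y \<in> snd c' ` fst c'"
  using assms by (auto simp: chart_rep_def)

lemma smooth_map_ident: "smooth_map A (\<lambda>x. x)"
proof -
  have "smooth_on (snd c ` (fst c \<inter> fst c')) (snd c' \<circ> chart_inv c)" if "c \<in> A" "c' \<in> A" for c c'
    using atlas that by (auto simp: smooth_atlas_def)
  then show ?thesis
    by (auto simp: smooth_map_def o_def)
qed

text \<open>An intermediate chart around the image point turns the coordinate representative into a
  composition of two representatives on a smaller open set.\<close>

lemma smooth_map_compose:
  assumes "smooth_map A \<phi>" "smooth_map A \<psi>"
  shows "smooth_map A (\<psi> \<circ> \<phi>)"
  unfolding smooth_map_def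
proof (intro conjI ballI)
  show "continuous_on UNIV (\<psi> \<circ> \<phi>)"
    using assms by (intro continuous_on_compose) (auto simp: smooth_map_def intro: continuous_on_subset)
next
  fix c c' assume c: "c \<in> A" "c' \<in> A"
  show "smooth_on (snd c ` (fst c \<inter> (\<psi> \<circ> \<phi>) -` fst c')) (snd c' \<circ> (\<psi> \<circ> \<phi>) \<circ> chart_inv c)"
  proof (rule smooth_on_local)
    fix y assume "y \<in> snd c ` (fst c \<inter> (\<psi> \<circ> \<phi>) -` fst c')"
    then obtain p where p: "y = snd c p" "p \<in> fst c" "\<psi> (\<phi> p) \<in> fst c'" by auto
    obtain d where d: "d \<in> A" "\<phi> p \<in> fst d" using chart_cover .
    let ?D = "snd d ` (fst d \<inter> \<psi> -` fst c')"
    let ?T = "snd c ` (fst c \<inter> \<phi> -` (fst d \<inter> \<psi> -` fst c'))"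
    have oT: "open ?T"
      by (intro open_chart_image c open_vimage open_Int chart_openD d smooth_map_continuous assms)
    have sm: "smooth_on ?T (\<lambda>y. chart_rep d c' \<psi> (chart_rep c d \<phi> y))"
      by (rule smooth_on_compose[OF oT open_chart_rep_domain[OF assms(2) d(1) c(2)] _
            smooth_on_subset[OF smooth_on_chart_rep[OF assms(1) c(1) d(1)]]
            smooth_on_chart_rep[OF assms(2) d(1) c(2)]])
        (use c in \<open>auto simp: chart_rep_def\<close>)
    show "\<exists>T g. open T \<and> y \<in> T \<and> smooth_on T g \<and> (\<forall>y\<in>T. g y = (snd c' \<circ> (\<psi> \<circ> \<phi>) \<circ> chart_inv c) y)"
      by (rule exI[of _ ?T], rule exI, intro conjI, rule oT, use p d in force, rule sm)
        (use c d in \<open>auto simp: chart_rep_def\<close>)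
  qed
qed

lemma C_infD: "f \<in> C_inf A \<Longrightarrow> c \<in> A \<Longrightarrow> smooth_on (snd c ` fst c) (f \<circ> chart_inv c)"
  by (simp add: C_inf_def)

text \<open>Membership in \<open>C_inf\<close> demands smoothness in every chart of the atlas; as
  transitions are smooth, one suitable chart around each point is enough.\<close>

lemma C_infI_local:
  assumes "\<And>p. \<exists>c\<in>A. \<exists>U. open U \<and> p \<in> U \<and> U \<subseteq> fst c \<and> smooth_on (snd c ` U) (f \<circ> chart_inv c)"
  shows "f \<in> C_inf A"
  unfolding C_inf_def
proof (intro CollectI ballI, rule smooth_on_local)
  fix c y assume c: "c \<in> A" and "y \<in> snd c ` fst c"
  then obtain p where p: "y = snd c p" "p \<in> fst c" by auto
  obtain d U where d: "d \<in> A" "open U" "p \<in> U" "U \<subseteq> fst d" "smooth_on (snd d ` U) (f \<circ> chart_inv d)"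
    using assms[of p] by blast
  let ?T = "snd c ` (fst c \<inter> U)"
  have oT: "open ?T" by (intro open_chart_image c d)
  have "snd d ` U = snd d ` (fst d \<inter> U)" using d by auto
  then have oU: "open (snd d ` U)" using open_chart_image[OF d(1,2)] by simp
  have sm: "smooth_on ?T (\<lambda>y. (f \<circ> chart_inv d) (chart_rep c d (\<lambda>x. x) y))"
    by (rule smooth_on_compose[OF oT oU _ smooth_on_subset[OF smooth_on_chart_rep[OF smooth_map_ident c d(1)]] d(5)])
      (use c d in \<open>auto simp: chart_rep_def\<close>)
  show "\<exists>T g. open T \<and> y \<in> T \<and> smooth_on T g \<and> (\<forall>y\<in>T. g y = (f \<circ> chart_inv c) y)"
    by (rule exI[of _ ?T], rule exI, intro conjI, rule oT, use p d in force, rule sm)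
      (use c d in \<open>auto simp: chart_rep_def\<close>)
qed

lemma C_inf_continuous:
  assumes "f \<in> C_inf A"
  shows "continuous_on UNIV f"
proof (rule continuous_at_imp_continuous_on, rule ballI)
  fix p
  obtain c where c: "c \<in> A" "p \<in> fst c" using chart_cover .
  have "continuous_on (fst c) (\<lambda>q. (f \<circ> chart_inv c) (snd c q))"
    by (rule continuous_on_compose2[OF smooth_on_imp_continuous_on[OF C_infD[OF assms c(1)]]
          chart_continuous_on(1)[OF c(1)]]) auto
  then have "continuous_on (fst c) f" by (rule continuous_on_eq) (use c in auto)
  then show "isCont f p" using c chart_openD continuous_on_eq_continuous_at by blast
qed

lemma C_inf_compose:
  assumes "f \<in> C_inf A" "smooth_map A \<phi>"
  shows "f \<circ> \<phi> \<in> C_inf A"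
proof (rule C_infI_local)
  fix p
  obtain c where c: "c \<in> A" "p \<in> fst c" using chart_cover .
  obtain d where d: "d \<in> A" "\<phi> p \<in> fst d" using chart_cover .
  let ?U = "fst c \<inter> \<phi> -` fst d"
  have oU: "open ?U" by (intro open_Int open_vimage chart_openD c d smooth_map_continuous assms)
  have oT: "open (snd c ` ?U)" by (intro open_chart_rep_domain assms c d)
  have "smooth_on (snd c ` ?U) (\<lambda>y. (f \<circ> chart_inv d) (chart_rep c d \<phi> y))"
    by (rule smooth_on_compose[OF oT chart_openD(2)[OF d(1)] _
          smooth_on_chart_rep[OF assms(2) c(1) d(1)] C_infD[OF assms(1) d(1)]])
      (use c in \<open>auto simp: chart_rep_def\<close>)
  then have "smooth_on (snd c ` ?U) (f \<circ> \<phi> \<circ> chart_inv c)"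
    by (rule smooth_on_cong[rotated 2]) (use oT c d in \<open>auto simp: chart_rep_def\<close>)
  then show "\<exists>c\<in>A. \<exists>U. open U \<and> p \<in> U \<and> U \<subseteq> fst c \<and> smooth_on (snd c ` U) (f \<circ> \<phi> \<circ> chart_inv c)"
    using c d oU by blast
qed

lemma compact_chart_inv:
  assumes "c \<in> A" "compact K" "K \<subseteq> snd c ` fst c"
  shows "compact (chart_inv c ` K)"
  using compact_continuous_image[OF continuous_on_subset[OF chart_continuous_on(2)] assms(2)] assms by blast

text \<open>The compact set of M corresponding to \<open>K\<close> is closed because M is Hausdorff.
  Its complement is an open set on which the extension vanishes, and together with the chart domain
  it covers M.\<close>

lemma chart_ext_C_inf:
  assumes c: "c \<in> A" and g: "smooth_on (snd c ` fst c) g"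
    and K: "compact K" "K \<subseteq> snd c ` fst c" "\<And>y. y \<in> snd c ` fst c \<Longrightarrow> y \<notin> K \<Longrightarrow> g y = 0"
  shows "chart_ext c g \<in> C_inf A"
proof (rule C_infI_local)
  fix p
  show "\<exists>c'\<in>A. \<exists>U. open U \<and> p \<in> U \<and> U \<subseteq> fst c' \<and> smooth_on (snd c' ` U) (chart_ext c g \<circ> chart_inv c')"
  proof (cases "p \<in> fst c")
    case True
    have "smooth_on (snd c ` fst c) (chart_ext c g \<circ> chart_inv c)"
      by (rule smooth_on_cong[OF _ _ g]) (use c chart_openD in \<open>auto simp: chart_ext_def\<close>)
    then show ?thesis using c True chart_openD by blast
  next
    case False
    obtain d where d: "d \<in> A" "p \<in> fst d" using chart_cover .
    let ?U = "fst d \<inter> - (chart_inv c ` K)"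
    have cl: "open (- (chart_inv c ` K))"
      using compact_chart_inv[OF c K(1,2)] compact_imp_closed by blast
    have oT: "open (snd d ` ?U)" by (intro open_chart_image cl d)
    have p: "p \<in> ?U" using d False c K by auto
    have "smooth_on (snd d ` ?U) (chart_ext c g \<circ> chart_inv d)"
    proof (rule smooth_on_cong[OF oT _ smooth_on_const[of _ 0]])
      fix y assume "y \<in> snd d ` ?U"
      then obtain q where q: "y = snd d q" "q \<in> fst d" "q \<notin> chart_inv c ` K" by auto
      have "g (snd c q) = 0" if "q \<in> fst c"
        by (rule K(3)) (use that q c in \<open>auto simp: image_iff\<close>)
      then show "0 = (chart_ext c g \<circ> chart_inv d) y"
        using q d by (simp add: chart_ext_def)
    qed
    moreover have "open ?U" using cl chart_openD(1)[OF d(1)] by (rule open_Int[rotated])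
    ultimately show ?thesis using d p by blast
  qed
qed

section \<open>Tangent vectors in coordinates\<close>

lemma coord_vec_chart_ext:
  assumes "c \<in> A" "p \<in> fst c" "chart_ext c g \<in> C_inf A" "g differentiable (at (snd c p))"
  shows "coord_vec A c p u (chart_ext c g) = frechet_derivative g (at (snd c p)) u"
proof -
  have "frechet_derivative g (at (snd c p)) = frechet_derivative (chart_ext c g \<circ> chart_inv c) (at (snd c p))"
    by (rule frechet_derivative_transform_within_open[OF assms(4) chart_openD(2)[OF assms(1)]])
      (use assms in \<open>auto simp: chart_ext_def\<close>)
  then show ?thesis using assms by (simp add: coord_vec_def)
qed

lemma chart_cball:
  assumes "c \<in> A" "y \<in> snd c ` fst c"
  obtains r where "r > 0" "cball y r \<subseteq> snd c ` fst c"
  using open_contains_cball chart_openD(2) assms by blast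

lemma chart_ext_bump:
  assumes "c \<in> A" "r > 0" "cball y r \<subseteq> snd c ` fst c" "smooth_on UNIV h"
  shows "chart_ext c (\<lambda>z. ball_bump y r z * h z) \<in> C_inf A"
proof (rule chart_ext_C_inf[OF assms(1) _ compact_cball assms(3)])
  show "smooth_on (snd c ` fst c) (\<lambda>z. ball_bump y r z * h z)"
    using smooth_on_mult[OF open_UNIV smooth_on_ball_bump assms(4)] smooth_on_subset by blast
  show "\<And>z. z \<in> snd c ` fst c \<Longrightarrow> z \<notin> cball y r \<Longrightarrow> ball_bump y r z * h z = 0"
    using ball_bump_eq_0[OF assms(2)] by force
qed

lemma frechet_derivative_bump_coord:
  "frechet_derivative (\<lambda>z. ball_bump y r z * (z - a) $ i) (at x) u
    = ball_bump y r x * u $ i + frechet_derivative (ball_bump y r) (at x) u * (x - a) $ i"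
proof -
  have b: "(ball_bump y r has_derivative frechet_derivative (ball_bump y r) (at x)) (at x)"
    by (rule smooth_on_imp_has_derivative[OF smooth_on_ball_bump]) simp
  have i: "((\<lambda>z. (z - a) $ i) has_derivative (\<lambda>u. u $ i)) (at x)"
    by (rule has_derivative_eq_rhs[OF bounded_linear.has_derivative[OF bounded_linear_vec_nth]])
      (auto intro!: derivative_eq_intros)
  show ?thesis
    using frechet_derivative_at[OF has_derivative_mult[OF b i], symmetric] by simp
qed

lemma smooth_on_coord: "smooth_on UNIV (\<lambda>z::real^'n. (z - a) $ i)"
  by (intro smooth_on_nth smooth_on_diff smooth_on_ident smooth_on_const open_UNIV)

text \<open>Two choices of \<open>a\<close> are of use: the coordinates of the base point, which
  remove the second term, and 0, where the second term is eliminated with the help of a further test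
  function.\<close>

lemma coord_vec_bump_coord:
  assumes c: "c \<in> A" "p \<in> fst c" and r: "r > 0" "cball y r \<subseteq> snd c ` fst c"
  shows "coord_vec A c p u (chart_ext c (\<lambda>z. ball_bump y r z * (z - a) $ i))
    = ball_bump y r (snd c p) * u $ i + frechet_derivative (ball_bump y r) (at (snd c p)) u * (snd c p - a) $ i"
proof -
  let ?g = "\<lambda>z. ball_bump y r z * (z - a) $ i"
  have "smooth_on UNIV ?g"
    by (rule smooth_on_mult[OF open_UNIV smooth_on_ball_bump smooth_on_coord])
  then have "?g differentiable (at (snd c p))"
    by (rule smooth_on_imp_differentiable) simp
  moreover have "chart_ext c ?g \<in> C_inf A"
    by (rule chart_ext_bump[OF c(1) r smooth_on_coord])
  ultimately have "coord_vec A c p u (chart_ext c ?g) = frechet_derivative ?g (at (snd c p)) u"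
    by (intro coord_vec_chart_ext c)
  then show ?thesis by (simp only: frechet_derivative_bump_coord)
qed

text \<open>Tangent vectors act on globally defined smooth functions, so coordinates are read off
  from cut-off coordinate functions centred at the point.\<close>

lemma inj_coord_vec:
  assumes c: "c \<in> A" "p \<in> fst c"
  shows "inj (coord_vec A c p)"
proof (rule injI)
  fix u u' assume eq: "coord_vec A c p u = coord_vec A c p u'"
  let ?y = "snd c p"
  obtain r where r: "r > 0" "cball ?y r \<subseteq> snd c ` fst c" using chart_cball c by blast
  have cv: "coord_vec A c p w (chart_ext c (\<lambda>z. ball_bump ?y r z * (z - ?y) $ i)) = ball_bump ?y r ?y * w $ i" for w i
    using coord_vec_bump_coord[OF c r, of w ?y i] by simp
  have "ball_bump ?y r ?y * u $ i = ball_bump ?y r ?y * u' $ i" for i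
    using cv[of u i] cv[of u' i] eq by simp
  moreover have "ball_bump ?y r ?y > 0" using ball_bump_pos_iff r(1) by (metis centre_in_ball)
  ultimately show "u = u'" by (auto simp: vec_eq_iff)
qed

lemma tangent_map_coord_vec:
  assumes \<phi>: "smooth_map A \<phi>" and c: "c \<in> A" "c' \<in> A" "p \<in> fst c" "\<phi> p \<in> fst c'"
  shows "tangent_map A \<phi> (coord_vec A c p u) = coord_vec A c' (\<phi> p) (chart_deriv c c' \<phi> p u)"
proof
  fix f
  show "tangent_map A \<phi> (coord_vec A c p u) f = coord_vec A c' (\<phi> p) (chart_deriv c c' \<phi> p u) f"
  proof (cases "f \<in> C_inf A")
    case True
    let ?T = "snd c ` (fst c \<inter> \<phi> -` fst c')" and ?y = "snd c p"
    have y: "?y \<in> ?T" using c by auto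
    have r: "chart_rep c c' \<phi> ?y = snd c' (\<phi> p)" using c by (simp add: chart_rep_def)
    have 1: "(chart_rep c c' \<phi> has_derivative chart_deriv c c' \<phi> p) (at ?y)"
      unfolding chart_deriv_def by (rule smooth_on_imp_has_derivative[OF smooth_on_chart_rep[OF \<phi> c(1,2)] y])
    have 2: "(f \<circ> chart_inv c' has_derivative frechet_derivative (f \<circ> chart_inv c') (at (snd c' (\<phi> p))))
        (at (chart_rep c c' \<phi> ?y))"
      unfolding r by (rule smooth_on_imp_has_derivative[OF C_infD[OF True c(2)]]) (use c in auto)
    have "(f \<circ> \<phi> \<circ> chart_inv c has_derivative
        (\<lambda>u. frechet_derivative (f \<circ> chart_inv c') (at (snd c' (\<phi> p))) (chart_deriv c c' \<phi> p u))) (at ?y)"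
      by (rule has_derivative_transform_within_open[OF has_derivative_compose[OF 1 2]
            open_chart_rep_domain[OF \<phi> c(1,2)] y]) (use c in \<open>auto simp: chart_rep_def\<close>)
    then have "frechet_derivative (f \<circ> \<phi> \<circ> chart_inv c) (at ?y) u
        = frechet_derivative (f \<circ> chart_inv c') (at (snd c' (\<phi> p))) (chart_deriv c c' \<phi> p u)"
      using frechet_derivative_at by metis
    then show ?thesis
      using True C_inf_compose[OF True \<phi>] by (simp add: tangent_map_def coord_vec_def)
  qed (simp add: tangent_map_def coord_vec_def)
qed

lemma linear_chart_deriv:
  assumes \<phi>: "smooth_map A \<phi>" and c: "c \<in> A" "c' \<in> A" "p \<in> fst c" "\<phi> p \<in> fst c'"
  shows "linear (chart_deriv c c' \<phi> p)"
  unfolding chart_deriv_def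
  by (rule has_derivative_linear[OF smooth_on_imp_has_derivative[OF smooth_on_chart_rep[OF \<phi> c(1,2)]]])
    (use c in auto)

text \<open>The transformation of coordinates is the chain rule for \<open>tangent_map\<close> in
  the case of the identity map.\<close>

lemma coord_vec_change:
  assumes c: "c \<in> A" "c' \<in> A" "p \<in> fst c" "p \<in> fst c'"
  shows "coord_vec A c p u = coord_vec A c' p (chart_deriv c c' (\<lambda>x. x) p u)"
proof -
  have "tangent_map A (\<lambda>x. x) (coord_vec A c p u) = coord_vec A c p u"
    by (auto simp: tangent_map_def coord_vec_def o_def)
  then show ?thesis using tangent_map_coord_vec[OF smooth_map_ident c] by simp
qed

lemma tangent_space_eq:
  assumes "c \<in> A" "p \<in> fst c"
  shows "tangent_space A p = range (coord_vec A c p)"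
proof
  show "tangent_space A p \<subseteq> range (coord_vec A c p)"
    unfolding tangent_space_def using coord_vec_change[OF _ assms(1) _ assms(2)] by blast
  show "range (coord_vec A c p) \<subseteq> tangent_space A p"
  proof
    fix v assume "v \<in> range (coord_vec A c p)"
    then obtain u where "v = coord_vec A c p u" by blast
    then show "v \<in> tangent_space A p"
      unfolding tangent_space_def using assms by (intro CollectI exI[of _ c] exI[of _ u]) simp
  qed
qed

lemma coord_vec_in_tangent_space [simp]: "c \<in> A \<Longrightarrow> p \<in> fst c \<Longrightarrow> coord_vec A c p u \<in> tangent_space A p"
  using tangent_space_eq by blast

lemma linear_coord_vec_apply:
  assumes c: "c \<in> A" "p \<in> fst c"
  shows "linear (\<lambda>u. coord_vec A c p u f)"
proof (cases "f \<in> C_inf A")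
  case True
  then show ?thesis
    using has_derivative_linear[OF smooth_on_imp_has_derivative[OF C_infD[OF True c(1)]]] c
    by (auto simp: coord_vec_def)
qed (simp add: coord_vec_def linear_zero)

lemma lincomb_coord_vec:
  assumes c: "c \<in> A" "p \<in> fst c"
  shows "lincomb a (coord_vec A c p u) b (coord_vec A c p v) = coord_vec A c p (a *\<^sub>R u + b *\<^sub>R v)"
  by (simp add: fun_eq_iff lincomb_def linear_add[OF linear_coord_vec_apply[OF c]]
      linear_scale[OF linear_coord_vec_apply[OF c]])

lemma coord_vec_0: "c \<in> A \<Longrightarrow> p \<in> fst c \<Longrightarrow> coord_vec A c p 0 = (\<lambda>f. 0)"
  using linear_0[OF linear_coord_vec_apply] by fastforce

lemma lincomb_in_tangent_space:
  assumes "v \<in> tangent_space A p" "w \<in> tangent_space A p"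
  shows "lincomb a v b w \<in> tangent_space A p"
proof -
  obtain c where c: "c \<in> A" "p \<in> fst c" using chart_cover .
  show ?thesis using assms unfolding tangent_space_eq[OF c] by (auto simp: lincomb_coord_vec[OF c])
qed

lemma tangent_map_in:
  assumes "smooth_map A \<phi>" "v \<in> tangent_space A p"
  shows "tangent_map A \<phi> v \<in> tangent_space A (\<phi> p)"
proof -
  obtain c where c: "c \<in> A" "p \<in> fst c" using chart_cover .
  obtain d where d: "d \<in> A" "\<phi> p \<in> fst d" using chart_cover .
  obtain u where "v = coord_vec A c p u" using assms(2) tangent_space_eq[OF c] by auto
  then show ?thesis
    using tangent_map_coord_vec[OF assms(1) c(1) d(1) c(2) d(2)] d by simp
qed

lemma tangent_map_compose:
  assumes "smooth_map A \<psi>"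
  shows "tangent_map A (\<psi> \<circ> \<phi>) v = tangent_map A \<psi> (tangent_map A \<phi> v)"
proof
  fix f
  show "tangent_map A (\<psi> \<circ> \<phi>) v f = tangent_map A \<psi> (tangent_map A \<phi> v) f"
    using C_inf_compose[OF _ assms, of f]
    by (cases "f \<in> C_inf A") (simp_all add: tangent_map_def comp_assoc)
qed

lemma tangent_map_ident:
  assumes "v \<in> tangent_space A p"
  shows "tangent_map A (\<lambda>x. x) v = v"
  using assms by (auto simp: tangent_map_def tangent_space_def coord_vec_def o_def fun_eq_iff)

lemma vcomp_coord_vec [simp]: "c \<in> A \<Longrightarrow> p \<in> fst c \<Longrightarrow> vcomp A c p (coord_vec A c p u) = u"
  unfolding vcomp_def by (rule inv_f_f[OF inj_coord_vec])

lemma coord_vec_vcomp: "c \<in> A \<Longrightarrow> p \<in> fst c \<Longrightarrow> v \<in> tangent_space A p \<Longrightarrow> coord_vec A c p (vcomp A c p v) = v"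
  using tangent_space_eq by fastforce

section \<open>Smooth vector fields in coordinates\<close>

lemma vector_fieldD:
  "X \<in> vector_fields A \<Longrightarrow> X p \<in> tangent_space A p"
  "X \<in> vector_fields A \<Longrightarrow> f \<in> C_inf A \<Longrightarrow> (\<lambda>p. X p f) \<in> C_inf A"
  by (auto simp: vector_fields_def)

text \<open>The components of \<open>X\<close> are recovered from its values on a bump function \<open>\<beta>\<close> and on \<open>\<beta>\<close> times
  the coordinate functions: \<open>X(\<beta> x\<^sub>i) = \<beta> X\<^sub>i + x\<^sub>i X(\<beta>)\<close>.\<close>

lemma smooth_on_vcomp:
  assumes X: "X \<in> vector_fields A" and c: "c \<in> A"
  shows "smooth_on (snd c ` fst c) (\<lambda>y. vcomp A c (chart_inv c y) (X (chart_inv c y)))"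
proof (rule smooth_on_local)
  fix y0 assume y0: "y0 \<in> snd c ` fst c"
  obtain r where r: "r > 0" "cball y0 r \<subseteq> snd c ` fst c" using chart_cball[OF c y0] .
  let ?b = "ball_bump y0 r" and ?S = "snd c ` fst c"
  \<comment> \<open>The factor 1 gives this function the shape required by
    \<open>chart_ext_bump\<close>.\<close>
  define f0 where "f0 = chart_ext c (\<lambda>z. ?b z * 1)"
  define f1 where "f1 i = chart_ext c (\<lambda>z. ?b z * (z - 0) $ i)" for i
  have f0: "f0 \<in> C_inf A" unfolding f0_def by (rule chart_ext_bump[OF c r smooth_on_const])
  have f1: "f1 i \<in> C_inf A" for i unfolding f1_def by (rule chart_ext_bump[OF c r smooth_on_coord])
  let ?X = "\<lambda>y. X (chart_inv c y)"
  let ?g = "\<lambda>y. \<chi> i. (?X y (f1 i) - y $ i * ?X y f0) / ?b y"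
  have sub: "ball y0 r \<subseteq> ?S" using r by (meson ball_subset_cball order_trans)
  have sX: "smooth_on (ball y0 r) (\<lambda>y. ?X y f)" if "f \<in> C_inf A" for f
    using C_infD[OF vector_fieldD(2)[OF X that] c] sub by (auto simp: o_def intro: smooth_on_subset)
  have "smooth_on (ball y0 r) ?g"
    by (intro smooth_on_vec_lambda smooth_on_divide smooth_on_diff smooth_on_mult smooth_on_nth smooth_on_ident
        open_ball sX f0 f1 smooth_on_subset[OF smooth_on_ball_bump])
      (use ball_bump_pos_iff[OF r(1)] in \<open>auto simp: less_le\<close>)
  moreover have "?g y = vcomp A c (chart_inv c y) (?X y)" if "y \<in> ball y0 r" for y
  proof -
    define q where "q = chart_inv c y"
    have yS: "y \<in> ?S" using sub that by auto
    have q: "q \<in> fst c" "snd c q = y" using c yS by (auto simp: q_def)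
    obtain u where u: "X q = coord_vec A c q u"
      using vector_fieldD(1)[OF X, of q] tangent_space_eq[OF c q(1)] by auto
    have bd: "?b differentiable (at y)" by (rule smooth_on_imp_differentiable[OF smooth_on_ball_bump]) simp
    have 0: "X q f0 = frechet_derivative ?b (at y) u"
      using coord_vec_chart_ext[OF c q(1), of ?b u] f0 bd unfolding u q(2) f0_def by simp
    have 1: "X q (f1 i) = ?b y * u $ i + frechet_derivative ?b (at y) u * y $ i" for i
      using coord_vec_bump_coord[OF c q(1) r, of u 0 i] unfolding u q(2) f1_def by simp
    have "?b y \<noteq> 0" using ball_bump_pos_iff[OF r(1), of y0 y] that by simp
    then have "?g y = u"
      unfolding q_def[symmetric] by (simp add: vec_eq_iff 0 1)
    then show ?thesis using u c q by (simp flip: q_def)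
  qed
  ultimately show "\<exists>T g. open T \<and> y0 \<in> T \<and> smooth_on T g \<and>
      (\<forall>y\<in>T. g y = vcomp A c (chart_inv c y) (X (chart_inv c y)))"
    using r(1) by (intro exI[of _ "ball y0 r"] exI[of _ ?g]) auto
qed

text \<open>In coordinates the field acts by a sum of coefficients times partial derivatives, so
  smooth coefficients in one chart around each point send smooth functions to smooth
  functions.\<close>

lemma vector_fieldI:
  assumes "\<And>p. \<exists>c\<in>A. \<exists>U \<xi>. open U \<and> p \<in> U \<and> U \<subseteq> fst c \<and> smooth_on (snd c ` U) \<xi> \<and>
      (\<forall>q\<in>U. X q = coord_vec A c q (\<xi> (snd c q)))"
  shows "X \<in> vector_fields A"
  unfolding vector_fields_def
proof (intro CollectI conjI allI ballI)
  fix p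
  show "X p \<in> tangent_space A p" using assms[of p] by fastforce
next
  fix f assume f: "f \<in> C_inf A"
  show "(\<lambda>p. X p f) \<in> C_inf A"
  proof (rule C_infI_local)
    fix p
    obtain c U \<xi> where c: "c \<in> A" and U: "open U" "p \<in> U" "U \<subseteq> fst c" "smooth_on (snd c ` U) \<xi>"
      "\<And>q. q \<in> U \<Longrightarrow> X q = coord_vec A c q (\<xi> (snd c q))"
      using assms[of p] by blast
    have "snd c ` U = snd c ` (fst c \<inter> U)" using U by auto
    then have oU: "open (snd c ` U)" using open_chart_image[OF c U(1)] by simp
    have sub: "snd c ` U \<subseteq> snd c ` fst c" using U by auto
    have sf: "smooth_on (snd c ` U) (f \<circ> chart_inv c)"
      using C_infD[OF f c] sub smooth_on_subset by blast
    let ?g = "\<lambda>y. \<Sum>i\<in>UNIV. \<xi> y $ i * frechet_derivative (f \<circ> chart_inv c) (at y) (axis i 1)"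
    have "smooth_on (snd c ` U) ?g"
      by (intro smooth_on_sum smooth_on_mult smooth_on_nth smooth_on_frechet_derivative sf oU U) auto
    then have "smooth_on (snd c ` U) ((\<lambda>p. X p f) \<circ> chart_inv c)"
    proof (rule smooth_on_cong[rotated 2])
      fix y assume "y \<in> snd c ` U"
      then obtain q where q: "q \<in> U" "y = snd c q" by auto
      have "linear (frechet_derivative (f \<circ> chart_inv c) (at y))"
        by (rule has_derivative_linear[OF smooth_on_imp_has_derivative[OF sf]]) (use q in auto)
      from linear_eq_sum_axis[OF this, of "\<xi> y"]
      have "frechet_derivative (f \<circ> chart_inv c) (at y) (\<xi> y) = ?g y" by simp
      then show "?g y = ((\<lambda>p. X p f) \<circ> chart_inv c) y"
        using q U c f by (auto simp: coord_vec_def)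
    qed (rule oU)
    then show "\<exists>c\<in>A. \<exists>U. open U \<and> p \<in> U \<and> U \<subseteq> fst c \<and> smooth_on (snd c ` U) ((\<lambda>p. X p f) \<circ> chart_inv c)"
      using c U by blast
  qed
qed

lemma chart_field_vector_fields:
  assumes c: "c \<in> A" and r: "r > 0" "cball y r \<subseteq> snd c ` fst c"
  shows "chart_field A c (ball_bump y r) u \<in> vector_fields A"
proof (rule vector_fieldI)
  fix p
  let ?b = "ball_bump y r"
  show "\<exists>d\<in>A. \<exists>U \<xi>. open U \<and> p \<in> U \<and> U \<subseteq> fst d \<and> smooth_on (snd d ` U) \<xi> \<and>
      (\<forall>q\<in>U. chart_field A c ?b u q = coord_vec A d q (\<xi> (snd d q)))"
  proof (cases "p \<in> fst c")
    case True
    show ?thesis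
      by (rule bexI[OF _ c], rule exI[of _ "fst c"], rule exI[of _ "\<lambda>y. ?b y *\<^sub>R u"])
        (use True c chart_openD[OF c] in \<open>auto simp: chart_field_def
          intro!: smooth_on_scaleR smooth_on_const smooth_on_subset[OF smooth_on_ball_bump]\<close>)
  next
    case False
    obtain d where d: "d \<in> A" "p \<in> fst d" using chart_cover .
    let ?U = "fst d \<inter> - (chart_inv c ` cball y r)"
    have cl: "open (- (chart_inv c ` cball y r))"
      using compact_chart_inv[OF c compact_cball r(2)] compact_imp_closed by blast
    have "open ?U" using cl chart_openD(1)[OF d(1)] by (rule open_Int[rotated])
    moreover have "p \<in> ?U" using d False c r(2) by auto
    moreover have "chart_field A c ?b u q = coord_vec A d q 0" if "q \<in> ?U" for q
    proof (cases "q \<in> fst c")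
      case True
      have "snd c q \<notin> cball y r" using that True c by (metis Int_iff ComplD chart_inv_snd image_eqI)
      then have "?b (snd c q) = 0" using ball_bump_eq_0[OF r(1)] by force
      then show ?thesis using True that c d by (simp add: chart_field_def coord_vec_0)
    qed (use that d in \<open>simp add: chart_field_def coord_vec_0\<close>)
    ultimately show ?thesis
      using d by (intro bexI[OF _ d(1)] exI[of _ ?U] exI[of _ "\<lambda>_. 0"]) (auto intro: smooth_on_const)
  qed
qed

text \<open>Hamiltonian fields are specified by testing against global vector fields. Extending a
  single tangent vector, by a bump divided by its value at \<open>p\<close>, turns these conditions
  into pointwise ones.\<close>

lemma vector_field_through:
  assumes "v \<in> tangent_space A p"
  obtains Y where "Y \<in> vector_fields A" "Y p = v"
proof -
  obtain c where c: "c \<in> A" "p \<in> fst c" using chart_cover .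
  obtain u where u: "v = coord_vec A c p u" using assms tangent_space_eq[OF c] by auto
  obtain r where r: "r > 0" "cball (snd c p) r \<subseteq> snd c ` fst c" using chart_cball c by blast
  let ?b = "ball_bump (snd c p) r (snd c p)"
  have "?b > 0" using ball_bump_pos_iff r(1) by (metis centre_in_ball)
  then have "chart_field A c (ball_bump (snd c p) r) (u /\<^sub>R ?b) p = v"
    using c by (simp add: chart_field_def u)
  then show thesis using that chart_field_vector_fields[OF c(1) r] by blast
qed

section \<open>Two-forms in coordinates\<close>

lemma two_form_chart:
  assumes \<omega>: "is_two_form A \<omega>" and c: "c \<in> A" "p \<in> fst c"
  shows "w \<in> tangent_space A p \<Longrightarrow> linear (\<lambda>u. \<omega> p (coord_vec A c p u) w)"
    and "w \<in> tangent_space A p \<Longrightarrow> linear (\<lambda>u. \<omega> p w (coord_vec A c p u))"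
proof -
  have bil: "\<omega> p (lincomb a u b v) w = a * \<omega> p u w + b * \<omega> p v w"
    and anti: "\<omega> p v w = - \<omega> p w v"
    if "u \<in> tangent_space A p" "v \<in> tangent_space A p" "w \<in> tangent_space A p" for u v w a b
    using \<omega> that unfolding is_two_form_def by blast+
  have l: "linear (\<lambda>u. \<omega> p (coord_vec A c p u) w)" if w: "w \<in> tangent_space A p" for w
  proof (rule linearI)
    fix u v
    show "\<omega> p (coord_vec A c p (u + v)) w = \<omega> p (coord_vec A c p u) w + \<omega> p (coord_vec A c p v) w"
      using bil[of "coord_vec A c p u" "coord_vec A c p v" w 1 1] c w by (simp add: lincomb_coord_vec)
  next
    fix a u
    show "\<omega> p (coord_vec A c p (a *\<^sub>R u)) w = a *\<^sub>R \<omega> p (coord_vec A c p u) w"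
      using bil[of "coord_vec A c p u" "coord_vec A c p u" w a 0] c w by (simp add: lincomb_coord_vec)
  qed
  show "linear (\<lambda>u. \<omega> p (coord_vec A c p u) w)" if "w \<in> tangent_space A p" using l[OF that] .
  show "linear (\<lambda>u. \<omega> p w (coord_vec A c p u))" if "w \<in> tangent_space A p"
  proof -
    have "\<omega> p w (coord_vec A c p u) = - \<omega> p (coord_vec A c p u) w" for u
      using anti[OF that that] anti[of w w "coord_vec A c p u"] c that by auto
    then show ?thesis using linear_compose_neg[OF l[OF that]] by simp
  qed
qed

lemma two_form_components:
  assumes \<omega>: "is_two_form A \<omega>" and c: "c \<in> A" "p \<in> fst c"
  shows "\<omega> p (coord_vec A c p u) (coord_vec A c p v) =
    (\<Sum>i\<in>UNIV. \<Sum>j\<in>UNIV. u $ i * v $ j * \<omega> p (coord_frame A c p i) (coord_frame A c p j))"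
proof -
  have "\<omega> p (coord_vec A c p u) (coord_vec A c p v) = (\<Sum>i\<in>UNIV. u $ i * \<omega> p (coord_frame A c p i) (coord_vec A c p v))"
    unfolding coord_frame_def
    using linear_eq_sum_axis[OF two_form_chart(1)[OF \<omega> c coord_vec_in_tangent_space[OF c, of v]], of u]
    by simp
  moreover have "\<omega> p (coord_frame A c p i) (coord_vec A c p v)
      = (\<Sum>j\<in>UNIV. v $ j * \<omega> p (coord_frame A c p i) (coord_frame A c p j))" for i
    unfolding coord_frame_def
    using linear_eq_sum_axis[OF two_form_chart(2)[OF \<omega> c coord_vec_in_tangent_space[OF c, of "axis i 1"]], of v]
    by simp
  ultimately show ?thesis by (simp add: sum_distrib_left mult.assoc)
qed

lemma smooth_on_two_form_frame:
  assumes "is_two_form A \<omega>" "c \<in> A"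
  shows "smooth_on (snd c ` fst c)
    (\<lambda>y. \<omega> (chart_inv c y) (coord_frame A c (chart_inv c y) i) (coord_frame A c (chart_inv c y) j))"
  using assms unfolding is_two_form_def o_def by blast

text \<open>The components of both fields and of the form are smooth in every chart. This is the
  source of continuity for the integrands of \<open>W_form\<close> and for Poisson brackets.\<close>

lemma two_form_C_inf:
  assumes \<omega>: "is_two_form A \<omega>" and X: "X \<in> vector_fields A" "Y \<in> vector_fields A"
  shows "(\<lambda>q. \<omega> q (X q) (Y q)) \<in> C_inf A"
  unfolding C_inf_def
proof (intro CollectI ballI)
  fix c assume c: "c \<in> A"
  let ?g = "\<lambda>y. \<Sum>i\<in>UNIV. \<Sum>j\<in>UNIV.
      vcomp A c (chart_inv c y) (X (chart_inv c y)) $ i * vcomp A c (chart_inv c y) (Y (chart_inv c y)) $ j *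
      \<omega> (chart_inv c y) (coord_frame A c (chart_inv c y) i) (coord_frame A c (chart_inv c y) j)"
  have "smooth_on (snd c ` fst c) ?g"
    by (intro smooth_on_sum smooth_on_mult smooth_on_nth smooth_on_vcomp X smooth_on_two_form_frame[OF \<omega> c]
        chart_openD c) auto
  then show "smooth_on (snd c ` fst c) ((\<lambda>q. \<omega> q (X q) (Y q)) \<circ> chart_inv c)"
  proof (rule smooth_on_cong[rotated 2])
    fix y assume y: "y \<in> snd c ` fst c"
    define q where "q = chart_inv c y"
    have q: "q \<in> fst c" using c y by (auto simp: q_def)
    show "?g y = ((\<lambda>q. \<omega> q (X q) (Y q)) \<circ> chart_inv c) y"
      using two_form_components[OF \<omega> c q, of "vcomp A c q (X q)" "vcomp A c q (Y q)"]
      by (simp add: coord_vec_vcomp[OF c q] vector_fieldD X flip: q_def)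
  qed (rule chart_openD(2)[OF c])
qed

end


section \<open>Volume forms and their measures\<close>

text \<open>Translates a finite value of a nonnegative Lebesgue integral into absolute integrability
  together with the value of the gauge integral, the language of the change of variables
  theorem.\<close>

lemma nn_integral_indicator_eq_iff:
  fixes h :: "'e::euclidean_space \<Rightarrow> real"
  assumes "\<And>x. x \<in> S \<Longrightarrow> 0 \<le> h x" "(\<lambda>x. h x * indicator S x) \<in> borel_measurable borel" "0 \<le> r"
  shows "(\<integral>\<^sup>+ x. ennreal (h x) * indicator S x \<partial>lborel) = ennreal r
    \<longleftrightarrow> h absolutely_integrable_on S \<and> integral S h = r"
proof -
  have eq: "ennreal (h x) * indicator S x = ennreal (h x * indicator S x)" for x
    by (auto split: split_indicator)
  have eq': "h x * indicator S x = (if x \<in> S then h x else 0)" for x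
    by (auto split: split_indicator)
  show ?thesis
  proof
    assume "(\<integral>\<^sup>+ x. ennreal (h x) * indicator S x \<partial>lborel) = ennreal r"
    then have "((\<lambda>x. h x * indicator S x) has_integral r) UNIV"
      unfolding eq by (intro nn_integral_has_integral assms) (use assms in \<open>auto split: split_indicator\<close>)
    then have "(h has_integral r) S" unfolding eq' has_integral_restrict_UNIV .
    then show "h absolutely_integrable_on S \<and> integral S h = r"
      using assms(1) by (auto intro!: nonnegative_absolutely_integrable_1)
  next
    assume *: "h absolutely_integrable_on S \<and> integral S h = r"
    then have "(h has_integral r) S"
      using absolutely_integrable_on_def integrable_integral by blast
    from nn_integral_has_integral_lebesgue[OF assms(1) this]
    show "(\<integral>\<^sup>+ x. ennreal (h x) * indicator S x \<partial>lborel) = ennreal r"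
      unfolding eq by (simp add: mult.commute)
  qed
qed

text \<open>The theorem for absolutely integrable functions gives, for each finite b, that one side
  equals b iff the other does. This settles the infinite case too: if one side is infinite, the
  other cannot be finite.\<close>

lemma nn_integral_change_of_variables:
  fixes f :: "real^'m::{finite,wellorder} \<Rightarrow> real" and g :: "real^'m::_ \<Rightarrow> real^'m::_"
  assumes S: "S \<in> sets borel"
    and der: "\<And>x. x \<in> S \<Longrightarrow> (g has_derivative g' x) (at x within S)" and inj: "inj_on g S"
    and nonneg: "\<And>y. 0 \<le> f y"
    and m1: "(\<lambda>x. (\<bar>det (matrix (g' x))\<bar> * f (g x)) * indicator S x) \<in> borel_measurable borel"
    and m2: "(\<lambda>y. f y * indicator (g ` S) y) \<in> borel_measurable borel"
  shows "(\<integral>\<^sup>+ x. ennreal (\<bar>det (matrix (g' x))\<bar> * f (g x)) * indicator S x \<partial>lborel)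
    = (\<integral>\<^sup>+ y. ennreal (f y) * indicator (g ` S) y \<partial>lborel)" (is "?l = ?r")
proof -
  let ?D = "\<lambda>x. \<bar>det (matrix (g' x))\<bar> * f (g x)"
  \<comment> \<open>The change of variables theorem is applied to functions with values in
    \<open>real^1\<close>, hence the embedding of the reals.\<close>
  let ?lift = "vec :: real \<Rightarrow> real^1"
  have "S \<in> sets lebesgue" using S by simp
  from has_absolute_integral_change_of_variables[OF this der inj, of "?lift \<circ> f" "?lift b" for b]
  have cv: "?D absolutely_integrable_on S \<and> integral S ?D = b
      \<longleftrightarrow> f absolutely_integrable_on (g ` S) \<and> integral (g ` S) f = b" for b
    by (simp add: absolutely_integrable_on_1_iff integral_on_1_eq o_def vec_eq_iff)
  have iff: "?l = ennreal b \<longleftrightarrow> ?r = ennreal b" if "0 \<le> b" for b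
  proof -
    have "?l = ennreal b \<longleftrightarrow> ?D absolutely_integrable_on S \<and> integral S ?D = b"
      by (rule nn_integral_indicator_eq_iff) (use nonneg m1 that in auto)
    also note cv
    also have "(f absolutely_integrable_on (g ` S) \<and> integral (g ` S) f = b) \<longleftrightarrow> ?r = ennreal b"
      by (rule nn_integral_indicator_eq_iff[symmetric]) (use nonneg m2 that in auto)
    finally show ?thesis .
  qed
  show ?thesis
  proof (cases ?l rule: ennreal_cases)
    case (real b)
    then show ?thesis using iff[of b] by simp
  next
    case top
    then show ?thesis using iff by (cases ?r rule: ennreal_cases) auto
  qed
qed

definition vdens ::
  "('a, 'm::finite) chart set \<Rightarrow> ('a, 'm) chart \<Rightarrow> ('a, 'm) top_form \<Rightarrow> real^'m \<Rightarrow> real" where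
  "vdens A c \<nu> y = \<bar>\<nu> (chart_inv c y) (coord_frame A c (chart_inv c y))\<bar>"

definition chart_mass ::
  "('a, 'm::finite) chart set \<Rightarrow> ('a, 'm) chart \<Rightarrow> ('a, 'm) top_form \<Rightarrow> 'a set \<Rightarrow> ennreal" where
  "chart_mass A c \<nu> B = (\<integral>\<^sup>+ y. ennreal (vdens A c \<nu> y) * indicator (snd c ` B) y \<partial>lborel)"

definition is_vol_measure ::
  "('a::topological_space, 'm::finite) chart set \<Rightarrow> ('a, 'm) top_form \<Rightarrow> 'a measure \<Rightarrow> bool" where
  "is_vol_measure A \<nu> m \<longleftrightarrow> sets m = sets borel \<and>
     (\<forall>c\<in>A. \<forall>B\<in>sets borel. B \<subseteq> fst c \<longrightarrow> emeasure m B = chart_mass A c \<nu> B)"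

lemma vol_measure_eq_The: "vol_measure A \<nu> = (THE m. is_vol_measure A \<nu> m)"
  by (simp add: vol_measure_def is_vol_measure_def chart_mass_def vdens_def)

context smooth_manifold
begin

lemma diffeomorphismD:
  assumes "diffeomorphism A \<phi>"
  shows "bij \<phi>" "smooth_map A \<phi>" "smooth_map A (inv \<phi>)"
  using assms by (auto simp: diffeomorphism_def)

lemma diffeomorphism_ident: "diffeomorphism A (\<lambda>x. x)"
  using smooth_map_ident by (auto simp: diffeomorphism_def inv_id[unfolded id_def] bij_id[unfolded id_def])

section \<open>Top forms and their transformation law\<close>

lemma alt_multilinear_top_form:
  assumes \<nu>: "is_top_form A \<nu>" and c: "c \<in> A" "p \<in> fst c"
  shows "alt_multilinear (\<lambda>us. \<nu> p (\<lambda>i. coord_vec A c p (us i)))"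
proof -
  have ml: "\<nu> p (vs(i := lincomb a v b w)) = a * \<nu> p (vs(i := v)) + b * \<nu> p (vs(i := w))"
    if "\<And>i. vs i \<in> tangent_space A p" "v \<in> tangent_space A p" "w \<in> tangent_space A p" for vs i a b v w
    using \<nu> that unfolding is_top_form_def by blast
  have alt: "\<nu> p vs = 0" if "\<And>i. vs i \<in> tangent_space A p" "i \<noteq> j" "vs i = vs j" for vs i j
    using \<nu> that unfolding is_top_form_def by blast
  let ?c = "coord_vec A c p"
  have upd: "(\<lambda>k. ?c ((us(i := v)) k)) = (\<lambda>k. ?c (us k))(i := ?c v)" for us i v by auto
  have "linear (\<lambda>v. \<nu> p (\<lambda>k. ?c ((us(i := v)) k)))" for us i
  proof (rule linearI)
    fix u v
    show "\<nu> p (\<lambda>k. ?c ((us(i := u + v)) k)) = \<nu> p (\<lambda>k. ?c ((us(i := u)) k)) + \<nu> p (\<lambda>k. ?c ((us(i := v)) k))"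
      using ml[of "\<lambda>k. ?c (us k)" "?c u" "?c v" i 1 1] c
      unfolding upd by (simp add: lincomb_coord_vec)
  next
    fix a u
    show "\<nu> p (\<lambda>k. ?c ((us(i := a *\<^sub>R u)) k)) = a *\<^sub>R \<nu> p (\<lambda>k. ?c ((us(i := u)) k))"
      using ml[of "\<lambda>k. ?c (us k)" "?c u" "?c u" i a 0] c
      unfolding upd by (simp add: lincomb_coord_vec)
  qed
  moreover have "\<nu> p (\<lambda>k. ?c (us k)) = 0" if "i \<noteq> j" "us i = us j" for us i j
    by (rule alt[OF _ that(1)]) (use c that in auto)
  ultimately show ?thesis unfolding alt_multilinear_def by blast
qed

text \<open>Multilinearity and alternation at a point may be checked in one chart, because there
  every tangent vector has coordinates; smoothness is asked for in every chart.\<close>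

lemma is_top_formI:
  assumes alt: "\<And>p. \<exists>c\<in>A. p \<in> fst c \<and> alt_multilinear (\<lambda>us. \<nu> p (\<lambda>i. coord_vec A c p (us i)))"
    and sm: "\<And>c. c \<in> A \<Longrightarrow> smooth_on (snd c ` fst c) (\<lambda>y. \<nu> (chart_inv c y) (coord_frame A c (chart_inv c y)))"
  shows "is_top_form A \<nu>"
proof -
  have "\<nu> p (vs(i := lincomb a v b w)) = a * \<nu> p (vs(i := v)) + b * \<nu> p (vs(i := w))"
    if vs: "\<forall>i. vs i \<in> tangent_space A p" and vw: "v \<in> tangent_space A p" "w \<in> tangent_space A p" for p vs i a b v w
  proof -
    obtain c where c: "c \<in> A" "p \<in> fst c" and F: "alt_multilinear (\<lambda>us. \<nu> p (\<lambda>i. coord_vec A c p (us i)))"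
      using alt by blast
    let ?us = "\<lambda>k. vcomp A c p (vs k)"
    have cv: "coord_vec A c p (vcomp A c p x) = x" if "x \<in> tangent_space A p" for x
      using coord_vec_vcomp[OF c that] .
    have upd: "(\<lambda>k. coord_vec A c p ((?us(i := u)) k)) = vs(i := coord_vec A c p u)" for u
      using vs cv by auto
    have "\<nu> p (\<lambda>k. coord_vec A c p ((?us(i := a *\<^sub>R vcomp A c p v + b *\<^sub>R vcomp A c p w)) k))
       = a * \<nu> p (\<lambda>k. coord_vec A c p ((?us(i := vcomp A c p v)) k))
       + b * \<nu> p (\<lambda>k. coord_vec A c p ((?us(i := vcomp A c p w)) k))"
      by (simp only: linear_add[OF alt_multilinear_linear[OF F, of ?us i]]
          linear_scale[OF alt_multilinear_linear[OF F, of ?us i]] real_scaleR_def)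
    then show ?thesis
      unfolding upd by (simp only: cv vw flip: lincomb_coord_vec[OF c])
  qed
  note ml = this
  have al: "\<nu> p vs = 0" if vs: "\<forall>i. vs i \<in> tangent_space A p" and ij: "i \<noteq> j" "vs i = vs j" for p vs i j
  proof -
    obtain c where c: "c \<in> A" "p \<in> fst c" and F: "alt_multilinear (\<lambda>us. \<nu> p (\<lambda>i. coord_vec A c p (us i)))"
      using alt by blast
    have "\<nu> p (\<lambda>k. coord_vec A c p (vcomp A c p (vs k))) = 0"
      by (rule alt_multilinear_eq_0[OF F ij(1)]) (simp add: ij)
    then show ?thesis using coord_vec_vcomp[OF c] vs by simp
  qed
  show ?thesis
    unfolding is_top_form_def o_def
  proof (intro conjI allI impI ballI)
    fix p and vs :: "'m \<Rightarrow> 'a tvec" and i v w a b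
    assume "\<forall>i. vs i \<in> tangent_space A p" "v \<in> tangent_space A p" "w \<in> tangent_space A p"
    then show "\<nu> p (vs(i := lincomb a v b w)) = a * \<nu> p (vs(i := v)) + b * \<nu> p (vs(i := w))"
      by (rule ml)
  next
    fix p and vs :: "'m \<Rightarrow> 'a tvec" and i j
    assume "\<forall>i. vs i \<in> tangent_space A p" "i \<noteq> j \<and> vs i = vs j"
    then show "\<nu> p vs = 0" using al by blast
  qed (rule sm)
qed

text \<open>The Jacobian determinant appears because the differential sends the coordinate frame to
  vectors whose coordinates are the columns of its matrix.\<close>

lemma top_form_pullback_frame:
  assumes \<nu>: "is_top_form A \<nu>" and \<psi>: "smooth_map A \<psi>" and c: "c \<in> A" "c' \<in> A" "p \<in> fst c" "\<psi> p \<in> fst c'"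
  shows "\<nu> (\<psi> p) (\<lambda>i. tangent_map A \<psi> (coord_frame A c p i))
    = det (matrix (chart_deriv c c' \<psi> p)) * \<nu> (\<psi> p) (coord_frame A c' (\<psi> p))"
  using alt_multilinear_axes[OF alt_multilinear_top_form[OF \<nu> c(2,4)], of "chart_deriv c c' \<psi> p"]
  by (simp add: coord_frame_def[abs_def] tangent_map_coord_vec[OF \<psi> c])

lemma smooth_on_top_form:
  assumes "is_top_form A \<nu>" "c \<in> A"
  shows "smooth_on (snd c ` fst c) (\<lambda>y. \<nu> (chart_inv c y) (coord_frame A c (chart_inv c y)))"
proof -
  have "\<forall>c\<in>A. smooth_on (snd c ` fst c) ((\<lambda>q. \<nu> q (coord_frame A c q)) \<circ> chart_inv c)"
    using assms(1) unfolding is_top_form_def by (rule conjunct2)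
  then show ?thesis using assms(2) by (simp add: o_def)
qed

lemma is_top_form_push_forward:
  assumes \<nu>: "is_top_form A \<nu>" and \<phi>: "diffeomorphism A \<phi>"
  shows "is_top_form A (push_forward A \<phi> \<nu>)"
proof (rule is_top_formI)
  let ?\<psi> = "inv \<phi>"
  note \<psi> = diffeomorphismD(3)[OF \<phi>]
  fix p
  obtain c where c: "c \<in> A" "p \<in> fst c" using chart_cover .
  obtain d where d: "d \<in> A" "?\<psi> p \<in> fst d" using chart_cover .
  have "alt_multilinear (\<lambda>us. push_forward A \<phi> \<nu> p (\<lambda>i. coord_vec A c p (us i)))"
    using alt_multilinear_compose[OF alt_multilinear_top_form[OF \<nu> d] linear_chart_deriv[OF \<psi> c(1) d(1) c(2) d(2)]]
    by (simp add: push_forward_def tangent_map_coord_vec[OF \<psi> c(1) d(1) c(2) d(2)])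
  then show "\<exists>c\<in>A. p \<in> fst c \<and> alt_multilinear (\<lambda>us. push_forward A \<phi> \<nu> p (\<lambda>i. coord_vec A c p (us i)))"
    using c by blast
next
  let ?\<psi> = "inv \<phi>"
  note \<psi> = diffeomorphismD(3)[OF \<phi>]
  fix c assume c: "c \<in> A"
  show "smooth_on (snd c ` fst c) (\<lambda>y. push_forward A \<phi> \<nu> (chart_inv c y) (coord_frame A c (chart_inv c y)))"
  proof (rule smooth_on_local)
    fix y assume "y \<in> snd c ` fst c"
    then obtain p where p: "p \<in> fst c" "y = snd c p" by auto
    obtain d where d: "d \<in> A" "?\<psi> p \<in> fst d" using chart_cover .
    let ?T = "snd c ` (fst c \<inter> ?\<psi> -` fst d)" and ?r = "chart_rep c d ?\<psi>"
    \<comment> \<open>Jacobian determinant of the representative times the coefficient of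
      \<open>\<nu>\<close> in the chart \<open>d\<close> at the image point; both are smooth in the
      coordinates.\<close>
    let ?g = "\<lambda>y. det (\<chi> i j. frechet_derivative ?r (at y) (axis j 1) $ i) *
        \<nu> (chart_inv d (?r y)) (coord_frame A d (chart_inv d (?r y)))"
    have oT: "open ?T" by (rule open_chart_rep_domain[OF \<psi> c d(1)])
    have sr: "smooth_on ?T ?r" by (rule smooth_on_chart_rep[OF \<psi> c d(1)])
    have "smooth_on ?T ?g"
    proof (intro smooth_on_mult[OF oT] smooth_on_det[OF oT] smooth_on_nth[OF oT] smooth_on_frechet_derivative[OF sr])
      show "smooth_on ?T (\<lambda>y. \<nu> (chart_inv d (?r y)) (coord_frame A d (chart_inv d (?r y))))"
        by (rule smooth_on_compose[OF oT chart_openD(2)[OF d(1)] chart_rep_in[OF c] sr smooth_on_top_form[OF \<nu> d(1)]])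
    qed
    moreover have "?g z = push_forward A \<phi> \<nu> (chart_inv c z) (coord_frame A c (chart_inv c z))" if z: "z \<in> ?T" for z
    proof -
      obtain q where q: "q \<in> fst c" "?\<psi> q \<in> fst d" "z = snd c q" using z by auto
      then show ?thesis
        using top_form_pullback_frame[OF \<nu> \<psi> c d(1) q(1,2)] c d(1)
        by (simp add: push_forward_def chart_deriv_def matrix_def) (simp add: chart_rep_def)
    qed
    ultimately show "\<exists>T g. open T \<and> y \<in> T \<and> smooth_on T g \<and>
        (\<forall>z\<in>T. g z = push_forward A \<phi> \<nu> (chart_inv c z) (coord_frame A c (chart_inv c z)))"
      using oT p d by (intro exI[of _ ?T] exI[of _ ?g]) auto
  qed
qed

section \<open>The mass of Borel sets inside one chart\<close>

lemma chart_image_borel: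
  assumes c: "c \<in> A" and B: "B \<in> sets borel" "B \<subseteq> fst c"
  shows "snd c ` B \<in> sets borel"
proof -
  let ?I = "snd c ` fst c"
  have I: "?I \<in> sets borel" using chart_openD(2)[OF c] by simp
  have "chart_inv c \<in> borel_measurable (restrict_space borel ?I)"
    by (rule borel_measurable_continuous_on_restrict[OF chart_continuous_on(2)[OF c]])
  then have "chart_inv c -` B \<inter> space (restrict_space borel ?I) \<in> sets (restrict_space borel ?I)"
    using B(1) by (rule measurable_sets)
  then have "chart_inv c -` B \<inter> ?I \<in> sets borel"
    using I by (simp add: space_restrict_space sets_restrict_space_iff)
  moreover have "chart_inv c -` B \<inter> ?I = snd c ` B" using c B(2) by auto
  ultimately show ?thesis by simp
qed

lemma vdens_measurable:
  assumes "is_top_form A \<nu>" and c: "c \<in> A" and T: "T \<in> sets borel" "T \<subseteq> snd c ` fst c"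
  shows "(\<lambda>y. vdens A c \<nu> y * indicator T y) \<in> borel_measurable borel"
proof -
  have "continuous_on T (vdens A c \<nu>)"
    using smooth_on_imp_continuous_on[OF smooth_on_top_form[OF assms(1) c]] T(2)
    unfolding vdens_def[abs_def] by (intro continuous_on_rabs) (rule continuous_on_subset)
  from borel_measurable_continuous_on_indicator[OF T(1) this] show ?thesis
    by (simp add: mult.commute)
qed

text \<open>Cutting the density off at the chart image makes it Borel on the whole space, whatever
  \<open>chart_inv\<close> does outside, so \<open>chart_mass\<close> inherits additivity from a
  measure on coordinate space.\<close>

definition chart_measure :: "('a, 'm) chart \<Rightarrow> ('a, 'm) top_form \<Rightarrow> (real^'m) measure" where
  "chart_measure c \<nu> = density lborel (\<lambda>y. ennreal (vdens A c \<nu> y * indicator (snd c ` fst c) y))"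

lemma sets_chart_measure [simp]: "sets (chart_measure c \<nu>) = sets borel"
  by (simp add: chart_measure_def)

lemma chart_mass_eq_emeasure:
  assumes \<nu>: "is_top_form A \<nu>" and c: "c \<in> A" and B: "B \<in> sets borel" "B \<subseteq> fst c"
  shows "chart_mass A c \<nu> B = emeasure (chart_measure c \<nu>) (snd c ` B)"
proof -
  have "(\<lambda>y. vdens A c \<nu> y * indicator (snd c ` fst c) y) \<in> borel_measurable borel"
    by (rule vdens_measurable[OF \<nu> c]) (use chart_openD[OF c] in auto)
  then have "emeasure (chart_measure c \<nu>) (snd c ` B)
    = (\<integral>\<^sup>+ y. ennreal (vdens A c \<nu> y * indicator (snd c ` fst c) y) * indicator (snd c ` B) y \<partial>lborel)"
    unfolding chart_measure_def using chart_image_borel[OF c B] by (intro emeasure_density) auto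
  also have "\<dots> = chart_mass A c \<nu> B"
    unfolding chart_mass_def
    by (intro nn_integral_cong) (use B(2) in \<open>auto split: split_indicator\<close>)
  finally show ?thesis by simp
qed

lemma chart_mass_suminf:
  fixes B :: "nat \<Rightarrow> 'a set"
  assumes \<nu>: "is_top_form A \<nu>" and c: "c \<in> A"
    and B: "\<And>i. B i \<in> sets borel" "\<And>i. B i \<subseteq> fst c" "disjoint_family B"
  shows "(\<Sum>i. chart_mass A c \<nu> (B i)) = chart_mass A c \<nu> (\<Union>i. B i)"
proof -
  have "inj_on (snd c) (fst c)" using chart_inv_snd[OF c] by (metis inj_onI)
  then have "disjoint_family (\<lambda>i. snd c ` B i)"
    using B(2,3) unfolding disjoint_family_on_def
    by (metis image_empty inj_on_image_Int)
  moreover have "range (\<lambda>i. snd c ` B i) \<subseteq> sets (chart_measure c \<nu>)"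
    using chart_image_borel[OF c B(1,2)] by auto
  ultimately have "(\<Sum>i. emeasure (chart_measure c \<nu>) (snd c ` B i)) = emeasure (chart_measure c \<nu>) (\<Union>i. snd c ` B i)"
    by (intro suminf_emeasure)
  moreover have "(\<Union>i. B i) \<in> sets borel" "(\<Union>i. B i) \<subseteq> fst c" using B by auto
  ultimately show ?thesis
    using chart_mass_eq_emeasure[OF \<nu> c] B by (simp add: image_UN)
qed

lemma chart_mass_sum:
  assumes \<nu>: "is_top_form A \<nu>" and c: "c \<in> A" and I: "finite I"
    and B: "\<And>i. i \<in> I \<Longrightarrow> B i \<in> sets borel" "\<And>i. i \<in> I \<Longrightarrow> B i \<subseteq> fst c" "disjoint_family_on B I"
  shows "(\<Sum>i\<in>I. chart_mass A c \<nu> (B i)) = chart_mass A c \<nu> (\<Union>i\<in>I. B i)"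
proof -
  have inj: "inj_on (snd c) (fst c)" using chart_inv_snd[OF c] by (metis inj_onI)
  have "snd c ` B i \<inter> snd c ` B j = {}" if "i \<in> I" "j \<in> I" "i \<noteq> j" for i j
    using inj_on_image_Int[OF inj B(2)[OF that(1)] B(2)[OF that(2)]] B(3) that
    by (metis disjoint_family_onD image_empty)
  then have "disjoint_family_on (\<lambda>i. snd c ` B i) I"
    unfolding disjoint_family_on_def by blast
  moreover have "(\<lambda>i. snd c ` B i) ` I \<subseteq> sets (chart_measure c \<nu>)"
    using chart_image_borel[OF c B(1,2)] by auto
  ultimately have "(\<Sum>i\<in>I. emeasure (chart_measure c \<nu>) (snd c ` B i)) = emeasure (chart_measure c \<nu>) (\<Union>i\<in>I. snd c ` B i)"
    using I by (intro sum_emeasure)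
  moreover have "(\<Union>i\<in>I. B i) \<in> sets borel" "(\<Union>i\<in>I. B i) \<subseteq> fst c" using B(1,2) I by auto
  ultimately show ?thesis
    using chart_mass_eq_emeasure[OF \<nu> c] B by (simp add: image_UN)
qed

end

text \<open>The sort \<open>wellorder\<close> on the index type is the one under which the change of
  variables theorem is stated.\<close>

locale compact_manifold = smooth_manifold A
  for A :: "('a::t2_space, 'm::{finite,wellorder}) chart set" +
  assumes compact_UNIV: "compact (UNIV :: 'a set)"
begin

text \<open>Change of variables with the coordinate representative of \<open>inv \<phi>\<close>: by
  the transformation law, the density of the pushed forward form is the Jacobian factor times the
  density of \<open>\<nu>\<close> in the other chart. Sets not contained in single charts are cut up
  later.\<close>

lemma chart_mass_push_forward:
  assumes \<nu>: "is_top_form A \<nu>" and \<phi>: "diffeomorphism A \<phi>" and c: "c \<in> A" "c' \<in> A"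
    and B: "B \<in> sets borel" "B \<subseteq> fst c" "inv \<phi> ` B \<subseteq> fst c'"
  shows "chart_mass A c (push_forward A \<phi> \<nu>) B = chart_mass A c' \<nu> (inv \<phi> ` B)"
proof -
  let ?\<psi> = "inv \<phi>"
  note \<psi> = diffeomorphismD(3)[OF \<phi>]
  let ?g = "chart_rep c c' ?\<psi>" and ?S = "snd c ` B"
  let ?g' = "\<lambda>y. frechet_derivative ?g (at y)"
  have bij: "bij \<phi>" by (rule diffeomorphismD(1)[OF \<phi>])
  have inj\<psi>: "inj ?\<psi>" using bij by (simp add: bij_betw_inv_into bij_is_inj)
  have gS: "?g ` ?S = snd c' ` (?\<psi> ` B)"
    using c B(2) by (force simp: chart_rep_def image_image subset_iff)
  have sub: "?S \<subseteq> snd c ` (fst c \<inter> ?\<psi> -` fst c')" by (rule image_mono) (use B in blast)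
  have S: "?S \<in> sets borel" by (rule chart_image_borel[OF c(1) B(1,2)])
  have dens: "vdens A c (push_forward A \<phi> \<nu>) y = \<bar>det (matrix (?g' y))\<bar> * vdens A c' \<nu> (?g y)" if y: "y \<in> ?S" for y
  proof -
    obtain q where "q \<in> B" "y = snd c q" using y by blast
    then have q: "q \<in> fst c" "?\<psi> q \<in> fst c'" "y = snd c q" using B by blast+
    then show ?thesis
      using top_form_pullback_frame[OF \<nu> \<psi> c q(1,2)] c
      by (simp add: vdens_def push_forward_def chart_deriv_def abs_mult) (simp add: chart_rep_def)
  qed
  have \<psi>B: "?\<psi> ` B \<in> sets borel"
  proof -
    have "?\<psi> ` B = \<phi> -` B" using bij by (simp add: bij_vimage_eq_inv_image)
    moreover have "\<phi> \<in> borel_measurable borel"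
      by (rule borel_measurable_continuous_onI[OF smooth_map_continuous[OF diffeomorphismD(2)[OF \<phi>]]])
    ultimately show ?thesis using measurable_sets[of \<phi> borel borel B] B(1) by simp
  qed
  have "chart_mass A c (push_forward A \<phi> \<nu>) B
      = (\<integral>\<^sup>+ y. ennreal (\<bar>det (matrix (?g' y))\<bar> * vdens A c' \<nu> (?g y)) * indicator ?S y \<partial>lborel)"
    unfolding chart_mass_def by (intro nn_integral_cong) (use dens in \<open>auto split: split_indicator\<close>)
  also have "\<dots> = (\<integral>\<^sup>+ y. ennreal (vdens A c' \<nu> y) * indicator (?g ` ?S) y \<partial>lborel)"
  proof (rule nn_integral_change_of_variables[OF S])
    show "(?g has_derivative ?g' y) (at y within ?S)" if "y \<in> ?S" for y
      using smooth_on_imp_has_derivative[OF smooth_on_chart_rep[OF \<psi> c]] sub that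
      by (blast intro: has_derivative_at_withinI)
    show "inj_on ?g ?S"
    proof (rule inj_onI)
      fix y z assume yz: "y \<in> ?S" "z \<in> ?S" "?g y = ?g z"
      then obtain p q where pq: "p \<in> B" "y = snd c p" "q \<in> B" "z = snd c q" by auto
      have "p \<in> fst c" "q \<in> fst c" "?\<psi> p \<in> fst c'" "?\<psi> q \<in> fst c'" using pq B by auto
      then have "?\<psi> p = ?\<psi> q"
        using yz(3) c unfolding pq chart_rep_def by (metis chart_inv_snd comp_apply)
      then show "y = z" using pq inj\<psi> by (simp add: inj_eq)
    qed
    show "0 \<le> vdens A c' \<nu> y" for y by (simp add: vdens_def)
    have "(\<lambda>y. vdens A c (push_forward A \<phi> \<nu>) y * indicator ?S y) \<in> borel_measurable borel"
      by (rule vdens_measurable[OF is_top_form_push_forward[OF \<nu> \<phi>] c(1) S]) (use B in auto)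
    moreover have "(\<lambda>y. vdens A c (push_forward A \<phi> \<nu>) y * indicator ?S y)
        = (\<lambda>y. \<bar>det (matrix (?g' y))\<bar> * vdens A c' \<nu> (?g y) * indicator ?S y)"
      using dens by (auto simp: fun_eq_iff split: split_indicator)
    ultimately show "(\<lambda>y. \<bar>det (matrix (?g' y))\<bar> * vdens A c' \<nu> (?g y) * indicator ?S y) \<in> borel_measurable borel"
      by simp
    show "(\<lambda>y. vdens A c' \<nu> y * indicator (?g ` ?S) y) \<in> borel_measurable borel"
      unfolding gS using B(3) by (intro vdens_measurable[OF \<nu> c(2)] chart_image_borel[OF c(2) \<psi>B]) auto
  qed
  finally show ?thesis unfolding chart_mass_def gS .
qed

text \<open>The case of the identity diffeomorphism. It is used twice, with equal and with different
  charts, since the push forward by the identity need not be literally the same function off tangent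
  vectors.\<close>

lemma chart_mass_eq:
  assumes \<nu>: "is_top_form A \<nu>" and c: "c \<in> A" "c' \<in> A" and B: "B \<in> sets borel" "B \<subseteq> fst c" "B \<subseteq> fst c'"
  shows "chart_mass A c \<nu> B = chart_mass A c' \<nu> B"
proof -
  have "inv (\<lambda>x. x) ` B = B" by (simp add: inv_id[unfolded id_def])
  then show ?thesis
    using chart_mass_push_forward[OF \<nu> diffeomorphism_ident c(1) c(1) B(1,2)]
      chart_mass_push_forward[OF \<nu> diffeomorphism_ident c(1,2) B(1,2)] B by simp
qed

text \<open>Compactness gives a finite subcover by chart domains, made disjoint by subtracting the
  earlier ones.\<close>

lemma chart_partition:
  obtains N :: nat and cf :: "nat \<Rightarrow> ('a, 'm) chart" and D :: "nat \<Rightarrow> 'a set"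
  where "\<And>k. k < N \<Longrightarrow> cf k \<in> A" "\<And>k. D k \<in> sets borel" "\<And>k. k < N \<Longrightarrow> D k \<subseteq> fst (cf k)"
    "disjoint_family_on D {..<N}" "(\<Union>k<N. D k) = UNIV"
proof -
  have "UNIV \<subseteq> (\<Union>c\<in>A. fst c)" using chart_cover by blast
  then obtain C where C: "C \<subseteq> A" "finite C" "UNIV \<subseteq> (\<Union>c\<in>C. fst c)"
    using compactE_image[OF compact_UNIV, of A fst] chart_openD(1) by metis
  obtain cf where cf: "bij_betw cf {0..<card C} C" using ex_bij_betw_nat_finite[OF C(2)] by blast
  let ?N = "card C"
  define E where "E k = (if k < ?N then fst (cf k) else {})" for k
  define D where "D k = E k - (\<Union>j<k. E j)" for k
  have cfA: "cf k \<in> A" if "k < ?N" for k using cf C(1) that by (auto simp: bij_betw_def)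
  have E: "E k \<in> sets borel" for k
    using chart_openD(1)[OF cfA, of k] by (auto simp: E_def)
  have "(\<Union>k<?N. D k) = UNIV"
  proof (intro equalityI subsetI UNIV_I)
    fix x
    have "x \<in> (\<Union>c\<in>C. fst c)" using C(3) by blast
    then obtain c where "c \<in> C" "x \<in> fst c" by blast
    then obtain k where "k < ?N" "c = cf k"
      using bij_betw_imp_surj_on[OF cf] by (metis atLeastLessThan_iff imageE)
    then have ex: "\<exists>k. x \<in> E k" using \<open>x \<in> fst c\<close> by (auto simp: E_def)
    define k where "k = (LEAST k. x \<in> E k)"
    have "x \<in> E k" unfolding k_def by (rule LeastI_ex[OF ex])
    moreover have "x \<notin> E j" if "j < k" for j using that not_less_Least unfolding k_def by blast
    ultimately have "x \<in> D k" "k < ?N" by (auto simp: D_def E_def split: if_splits)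
    then show "x \<in> (\<Union>k<?N. D k)" by blast
  qed
  moreover have "disjoint_family_on D {..<?N}"
    unfolding disjoint_family_on_def
  proof (intro ballI impI)
    fix m n :: nat assume "m \<noteq> n"
    then consider "m < n" | "n < m" by linarith
    then show "D m \<inter> D n = {}" by cases (auto simp: D_def)
  qed
  moreover have "D k \<in> sets borel" for k unfolding D_def using E by auto
  moreover have "D k \<subseteq> fst (cf k)" if "k < ?N" for k using that by (auto simp: D_def E_def)
  ultimately show thesis using that[of ?N cf D] cfA by blast
qed

lemma emeasure_partition:
  assumes "sets m = sets borel" "B \<in> sets borel" "\<And>k. D k \<in> sets borel"
    "disjoint_family_on D {..<N::nat}" "(\<Union>k<N. D k) = UNIV"
  shows "emeasure m B = (\<Sum>k<N. emeasure m (B \<inter> D k))"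
proof -
  have "disjoint_family_on (\<lambda>k. B \<inter> D k) {..<N}"
    using assms(4) unfolding disjoint_family_on_def by blast
  then have "(\<Sum>k<N. emeasure m (B \<inter> D k)) = emeasure m (\<Union>k<N. B \<inter> D k)"
    using assms(1-3) by (intro sum_emeasure) auto
  also have "(\<Union>k<N. B \<inter> D k) = B" using assms(5) by blast
  finally show ?thesis by simp
qed

lemma is_vol_measure_unique:
  assumes "is_vol_measure A \<nu> m" "is_vol_measure A \<nu> m'"
  shows "m = m'"
proof -
  obtain N :: nat and cf D where P: "\<And>k. k < N \<Longrightarrow> cf k \<in> A" "\<And>k. D k \<in> sets borel" "\<And>k. k < N \<Longrightarrow> D k \<subseteq> fst (cf k)"
    "disjoint_family_on D {..<N}" "(\<Union>k<N. D k) = UNIV"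
    using chart_partition by blast
  have s: "sets m = sets borel" "sets m' = sets borel" using assms by (auto simp: is_vol_measure_def)
  show ?thesis
  proof (rule measure_eqI)
    fix B assume "B \<in> sets m"
    then have B: "B \<in> sets borel" by (simp add: s)
    have "emeasure m (B \<inter> D k) = emeasure m' (B \<inter> D k)" if "k < N" for k
      using assms B P(1)[OF that] P(2)[of k] P(3)[OF that]
      unfolding is_vol_measure_def by (metis inf.coboundedI2 sets.Int)
    then show "emeasure m B = emeasure m' B"
      using emeasure_partition[OF s(1) B P(2,4,5)] emeasure_partition[OF s(2) B P(2,4,5)] by simp
  qed (simp add: s)
qed

text \<open>The mass of each piece is computed in the chart chosen for it, and the sum is countably
  additive. The formula in an arbitrary chart follows since two charts give the same mass to a set
  inside both domains.\<close>

lemma is_vol_measure_vol_measure: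
  assumes \<nu>: "is_top_form A \<nu>"
  shows "is_vol_measure A \<nu> (vol_measure A \<nu>)"
proof -
  obtain N :: nat and cf D where P: "\<And>k. k < N \<Longrightarrow> cf k \<in> A" "\<And>k. D k \<in> sets borel" "\<And>k. k < N \<Longrightarrow> D k \<subseteq> fst (cf k)"
    "disjoint_family_on D {..<N}" "(\<Union>k<N. D k) = UNIV"
    using chart_partition by blast
  let ?\<mu> = "\<lambda>B. \<Sum>k<N. chart_mass A (cf k) \<nu> (B \<inter> D k)"
  define m where "m = measure_of UNIV (sets borel) ?\<mu>"
  have sub: "B \<inter> D k \<subseteq> fst (cf k)" if "k < N" for k B using P(3)[OF that] by blast
  have em: "emeasure m B = ?\<mu> B" if "B \<in> sets borel" for B
    unfolding m_def
  proof (rule emeasure_measure_of_sigma[OF _ _ _ that])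
    show "sigma_algebra UNIV (sets borel)" using sets.sigma_algebra_axioms[of borel] by simp
    show "positive (sets borel) ?\<mu>"
      by (auto simp: positive_def chart_mass_def)
    show "countably_additive (sets borel) ?\<mu>"
      unfolding countably_additive_def
    proof (intro allI impI)
      fix B :: "nat \<Rightarrow> 'a set" assume B: "range B \<subseteq> sets borel" "disjoint_family B" "(\<Union>i. B i) \<in> sets borel"
      have "(\<Sum>i. chart_mass A (cf k) \<nu> (B i \<inter> D k)) = chart_mass A (cf k) \<nu> ((\<Union>i. B i) \<inter> D k)" if "k < N" for k
      proof -
        have "disjoint_family (\<lambda>i. B i \<inter> D k)"
          using B(2) unfolding disjoint_family_on_def by blast
        then have "(\<Sum>i. chart_mass A (cf k) \<nu> (B i \<inter> D k)) = chart_mass A (cf k) \<nu> (\<Union>i. B i \<inter> D k)"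
          using B(1) P(2) by (intro chart_mass_suminf[OF \<nu> P(1)[OF that]] sub[OF that]) auto
        then show ?thesis by (simp add: Int_UN_distrib2)
      qed
      then show "(\<Sum>i. ?\<mu> (B i)) = ?\<mu> (\<Union>i. B i)"
        by (subst suminf_sum) (auto intro: summableI)
    qed
  qed
  have sm: "sets m = sets borel"
    unfolding m_def using sets.sigma_sets_eq[of "borel :: 'a measure"] by (simp add: sets_measure_of)
  have vm: "is_vol_measure A \<nu> m"
    unfolding is_vol_measure_def
  proof (intro conjI ballI impI sm)
    fix c and B :: "'a set" assume c: "c \<in> A" and B: "B \<in> sets borel" "B \<subseteq> fst c"
    have "emeasure m B = (\<Sum>k<N. chart_mass A c \<nu> (B \<inter> D k))"
      unfolding em[OF B(1)]
      by (intro sum.cong chart_mass_eq[OF \<nu> P(1) c]) (use B P(2) sub in auto)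
    also have "\<dots> = chart_mass A c \<nu> (\<Union>k<N. B \<inter> D k)"
    proof (rule chart_mass_sum[OF \<nu> c finite_lessThan])
      show "disjoint_family_on (\<lambda>k. B \<inter> D k) {..<N}"
        using P(4) unfolding disjoint_family_on_def by blast
    qed (use B P(2) in auto)
    also have "(\<Union>k<N. B \<inter> D k) = B" using P(5) by blast
    finally show "emeasure m B = chart_mass A c \<nu> B" .
  qed
  then show ?thesis
    unfolding vol_measure_eq_The by (rule theI) (rule is_vol_measure_unique[OF _ vm])
qed

lemma vol_measure_eqI: "is_vol_measure A \<nu> m \<Longrightarrow> vol_measure A \<nu> = m"
  unfolding vol_measure_eq_The by (rule the_equality) (auto intro: is_vol_measure_unique)

lemma sets_vol_measure: "is_top_form A \<nu> \<Longrightarrow> sets (vol_measure A \<nu>) = sets borel"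
  using is_vol_measure_vol_measure is_vol_measure_def by blast

text \<open>The image measure is recognised by the defining property of \<open>vol_measure\<close>.
  A set inside \<open>c\<close> may have a preimage contained in no single chart, so it is split
  along the images of the pieces under \<phi>.\<close>

lemma vol_measure_push_forward:
  assumes \<nu>: "is_top_form A \<nu>" and \<phi>: "diffeomorphism A \<phi>"
  shows "vol_measure A (push_forward A \<phi> \<nu>) = distr (vol_measure A \<nu>) borel \<phi>"
proof (rule vol_measure_eqI)
  let ?m = "vol_measure A \<nu>"
  obtain N :: nat and cf D where P: "\<And>k. k < N \<Longrightarrow> cf k \<in> A" "\<And>k. D k \<in> sets borel" "\<And>k. k < N \<Longrightarrow> D k \<subseteq> fst (cf k)"
    "disjoint_family_on D {..<N}" "(\<Union>k<N. D k) = UNIV"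
    using chart_partition by blast
  have m: "sets ?m = sets borel"
    "\<And>c B. c \<in> A \<Longrightarrow> B \<in> sets borel \<Longrightarrow> B \<subseteq> fst c \<Longrightarrow> emeasure ?m B = chart_mass A c \<nu> B"
    using is_vol_measure_vol_measure[OF \<nu>] by (auto simp: is_vol_measure_def)
  have bij: "bij \<phi>" by (rule diffeomorphismD(1)[OF \<phi>])
  have meas: "\<phi> \<in> borel_measurable borel" "inv \<phi> \<in> borel_measurable borel"
    using borel_measurable_continuous_onI[OF smooth_map_continuous] diffeomorphismD[OF \<phi>] by auto
  have sp: "space ?m = UNIV" using sets_eq_imp_space_eq[OF m(1)] by simp
  have meas': "\<phi> \<in> measurable ?m borel" using meas(1) measurable_cong_sets[OF m(1) refl] by blast
  show "is_vol_measure A (push_forward A \<phi> \<nu>) (distr ?m borel \<phi>)"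
    unfolding is_vol_measure_def
  proof (intro conjI ballI impI)
    fix c and B :: "'a set" assume c: "c \<in> A" and B: "B \<in> sets borel" "B \<subseteq> fst c"
    let ?B = "\<lambda>k. B \<inter> inv \<phi> -` D k"
    have img: "inv \<phi> ` ?B k = \<phi> -` B \<inter> D k" for k
      using bij by (auto simp: bij_inv_eq_iff image_iff bij_is_surj surj_f_inv_f bij_is_inj)
    have vB: "\<phi> -` B \<in> sets borel" using measurable_sets[OF meas(1) B(1)] by simp
    have Bk: "?B k \<in> sets borel" for k using measurable_sets[OF meas(2) P(2)[of k]] B(1) by simp
    have "emeasure (distr ?m borel \<phi>) B = emeasure ?m (\<phi> -` B)"
      using emeasure_distr[OF meas' B(1)] sp by simp
    also have "\<dots> = (\<Sum>k<N. emeasure ?m (\<phi> -` B \<inter> D k))"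
      by (rule emeasure_partition[OF m(1) vB P(2,4,5)])
    also have "\<dots> = (\<Sum>k<N. chart_mass A c (push_forward A \<phi> \<nu>) (?B k))"
    proof (rule sum.cong[OF refl])
      fix k assume "k \<in> {..<N}"
      then have k: "k < N" by simp
      have s: "inv \<phi> ` ?B k \<subseteq> fst (cf k)" using P(3)[OF k] unfolding img by blast
      have "emeasure ?m (\<phi> -` B \<inter> D k) = chart_mass A (cf k) \<nu> (inv \<phi> ` ?B k)"
        unfolding img[symmetric] by (rule m(2)[OF P(1)[OF k] _ s]) (use img vB P(2) in auto)
      then show "emeasure ?m (\<phi> -` B \<inter> D k) = chart_mass A c (push_forward A \<phi> \<nu>) (?B k)"
        using chart_mass_push_forward[OF \<nu> \<phi> c P(1)[OF k] Bk _ s] B(2) by (metis inf.coboundedI1)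
    qed
    also have "\<dots> = chart_mass A c (push_forward A \<phi> \<nu>) (\<Union>k<N. ?B k)"
    proof (rule chart_mass_sum[OF is_top_form_push_forward[OF \<nu> \<phi>] c finite_lessThan])
      show "disjoint_family_on ?B {..<N}"
        using P(4) unfolding disjoint_family_on_def by blast
    qed (use B Bk in auto)
    also have "(\<Union>k<N. ?B k) = B" using P(5) by blast
    finally show "emeasure (distr ?m borel \<phi>) B = chart_mass A c (push_forward A \<phi> \<nu>) B" .
  qed simp
qed

lemma vol_integral_push_forward:
  assumes \<nu>: "is_top_form A \<nu>" and \<phi>: "diffeomorphism A \<phi>" and f: "continuous_on UNIV f"
  shows "vol_integral A (push_forward A \<phi> \<nu>) f = vol_integral A \<nu> (\<lambda>x. f (\<phi> x))"
proof -
  have "\<phi> \<in> borel_measurable borel"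
    by (rule borel_measurable_continuous_onI[OF smooth_map_continuous[OF diffeomorphismD(2)[OF \<phi>]]])
  then have "\<phi> \<in> measurable (vol_measure A \<nu>) borel"
    using measurable_cong_sets[OF sets_vol_measure[OF \<nu>] refl] by blast
  then show ?thesis
    unfolding vol_integral_def vol_measure_push_forward[OF \<nu> \<phi>]
    by (rule integral_distr) (rule borel_measurable_continuous_onI[OF f])
qed

end


section \<open>Symplectic manifolds\<close>

locale symplectic_manifold = compact_manifold A
  for A :: "('a::t2_space, 'm::{finite,wellorder}) chart set" +
  fixes \<omega> :: "'a two_form" and n :: nat
  assumes card_dim: "CARD('m) = 2 * n"
    and symplectic: "symplectic_form A \<omega>"
    and volume_1: "vol_integral A (omega_power n \<omega>) (\<lambda>x. 1) = 1"
begin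

definition \<mu> :: "('a, 'm) top_form" where
  "\<mu> = omega_power n \<omega>"

lemma two_form: "is_two_form A \<omega>"
  using symplectic by (simp add: symplectic_form_def)

lemma form_antisym:
  assumes "v \<in> tangent_space A p" "w \<in> tangent_space A p"
  shows "\<omega> p v w = - \<omega> p w v"
  using two_form assms unfolding is_two_form_def by blast

lemma nondegenerate:
  "v \<in> tangent_space A p \<Longrightarrow> (\<And>w. w \<in> tangent_space A p \<Longrightarrow> \<omega> p v w = 0) \<Longrightarrow> v = (\<lambda>f. 0)"
  using symplectic unfolding symplectic_form_def by blast

lemma nondegenerate_chart:
  assumes c: "c \<in> A" "p \<in> fst c" and "u \<noteq> 0"
  shows "\<exists>w. \<omega> p (coord_vec A c p u) (coord_vec A c p w) \<noteq> 0"
proof (rule ccontr)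
  assume "\<not> ?thesis"
  then have "coord_vec A c p u = (\<lambda>f. 0)"
    using c tangent_space_eq[OF c] by (intro nondegenerate) auto
  then have "coord_vec A c p u = coord_vec A c p 0" by (simp add: coord_vec_0 c)
  then show False using inj_coord_vec[OF c] assms(3) by (simp add: inj_eq)
qed

section \<open>The Liouville volume form\<close>

lemma volume_form_chart:
  "\<mu> p (\<lambda>i. coord_vec A c p (us i)) = pfaff n (\<lambda>u v. \<omega> p (coord_vec A c p u) (coord_vec A c p v)) us"
  unfolding \<mu>_def omega_power_eq_pfaff by (rule pfaff_compose)

lemma volume_form_top_form: "is_top_form A \<mu>"
proof (rule is_top_formI)
  fix p
  obtain c where c: "c \<in> A" "p \<in> fst c" using chart_cover .
  have "alt_multilinear (pfaff n (\<lambda>u v. \<omega> p (coord_vec A c p u) (coord_vec A c p v)) :: ('m \<Rightarrow> _) \<Rightarrow> real)"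
    by (intro alt_multilinear_pfaff card_dim two_form_chart[OF two_form c] coord_vec_in_tangent_space c)
  then show "\<exists>c\<in>A. p \<in> fst c \<and> alt_multilinear (\<lambda>us. \<mu> p (\<lambda>i. coord_vec A c p (us i)))"
    using c unfolding volume_form_chart by blast
next
  fix c assume c: "c \<in> A"
  show "smooth_on (snd c ` fst c) (\<lambda>y. \<mu> (chart_inv c y) (coord_frame A c (chart_inv c y)))"
    unfolding \<mu>_def omega_power_def
    by (intro smooth_on_divide smooth_on_sum smooth_on_mult smooth_on_prod smooth_on_const
        smooth_on_two_form_frame two_form c chart_openD(2)[OF c]) auto
qed

text \<open>Behind both uses of \<mu>: it decides the orientation of frames, and it gives every
  nonempty open set positive mass.\<close>

lemma volume_form_frame_nonzero:
  assumes c: "c \<in> A" "p \<in> fst c"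
  shows "\<mu> p (coord_frame A c p) \<noteq> 0"
proof -
  have "pfaff n (\<lambda>u v. \<omega> p (coord_vec A c p u) (coord_vec A c p v)) (\<lambda>i. axis i 1 :: real^'m::_) \<noteq> 0"
  proof (rule pfaff_axes_nonzero[OF card_dim])
    show "linear (\<lambda>u. \<omega> p (coord_vec A c p u) (coord_vec A c p w))" for w
      by (intro two_form_chart[OF two_form c] coord_vec_in_tangent_space c)
    show "linear (\<lambda>v. \<omega> p (coord_vec A c p u) (coord_vec A c p v))" for u
      by (intro two_form_chart[OF two_form c] coord_vec_in_tangent_space c)
    show "\<omega> p (coord_vec A c p u) (coord_vec A c p v) = - \<omega> p (coord_vec A c p v) (coord_vec A c p u)" for u v
      by (intro form_antisym coord_vec_in_tangent_space c)
  qed (rule nondegenerate_chart[OF c])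
  then show ?thesis
    using volume_form_chart[of p c "\<lambda>i. axis i 1"] by (simp add: coord_frame_def[abs_def])
qed

text \<open>In coordinates the Hamiltonian equation is a linear system whose matrix
  \<open>M\<close>, the transpose of the Gram matrix of \<omega>, is invertible by nondegeneracy.
  Cramer's rule displays the solution as a smooth expression in the entries.\<close>

lemma hamiltonian_vector_chart:
  fixes c :: "('a, 'm) chart" and grad :: "real^'m::_"
  assumes c: "c \<in> A" "p \<in> fst c"
  defines "M \<equiv> \<chi> i j. \<omega> p (coord_frame A c p j) (coord_frame A c p i)"
  shows "det M \<noteq> 0"
    "(\<forall>w. \<omega> p (coord_vec A c p u) (coord_vec A c p w) = (\<Sum>i\<in>UNIV. w $ i * grad $ i)) \<longleftrightarrow>
     u = (\<chi> k. det (\<chi> i j. if j = k then grad $ i else M $ i $ j) / det M)"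
proof -
  let ?B = "\<lambda>u v. \<omega> p (coord_vec A c p u) (coord_vec A c p v)"
  have Mu: "(M *v u) $ i = ?B u (axis i 1)" for u i
    using linear_eq_sum_axis[OF two_form_chart(1)[OF two_form c coord_vec_in_tangent_space[OF c, of "axis i 1"]], of u]
    by (simp add: matrix_vector_mult_def M_def coord_frame_def mult.commute)
  have Bw: "?B u w = (\<Sum>i\<in>UNIV. w $ i * (M *v u) $ i)" for u w
    using linear_eq_sum_axis[OF two_form_chart(2)[OF two_form c coord_vec_in_tangent_space[OF c, of u]], of w]
    by (simp add: Mu)
  have "u = 0" if "M *v u = 0" for u
  proof (rule ccontr)
    assume "u \<noteq> 0"
    then obtain w where "?B u w \<noteq> 0" using nondegenerate_chart[OF c] by blast
    then show False using that by (simp add: Bw)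
  qed
  then show det: "det M \<noteq> 0"
    using matrix_left_invertible_ker[of M] invertible_left_inverse[of M] invertible_det_nz[of M] by blast
  have "(\<forall>w. ?B u w = (\<Sum>i\<in>UNIV. w $ i * grad $ i)) \<longleftrightarrow> M *v u = grad"
  proof
    assume *: "\<forall>w. ?B u w = (\<Sum>i\<in>UNIV. w $ i * grad $ i)"
    show "M *v u = grad"
      unfolding vec_eq_iff
    proof
      fix i
      have "(M *v u) $ i = (\<Sum>j\<in>UNIV. axis i 1 $ j * grad $ j)" using * Mu by simp
      also have "\<dots> = grad $ i" by (simp add: axis_def if_distrib[of "\<lambda>x. x * _"] cong: if_cong)
      finally show "(M *v u) $ i = grad $ i" .
    qed
  qed (simp add: Bw)
  then show "(\<forall>w. ?B u w = (\<Sum>i\<in>UNIV. w $ i * grad $ i)) \<longleftrightarrow>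
     u = (\<chi> k. det (\<chi> i j. if j = k then grad $ i else M $ i $ j) / det M)"
    using cramer[OF det] by simp
qed

text \<open>The equation is solved at each point by a definite description that mentions no chart,
  so nothing has to be glued; each chart then identifies the solution with the smooth formula from
  Cramer's rule.\<close>

lemma hamiltonian_exists:
  assumes f: "f \<in> C_inf A"
  shows "\<exists>X\<in>vector_fields A. \<forall>p. \<forall>w\<in>tangent_space A p. \<omega> p (X p) w = w f"
proof -
  define M :: "('a, 'm) chart \<Rightarrow> 'a \<Rightarrow> real^'m::_^'m::_" where
    "M c p = (\<chi> i j. \<omega> p (coord_frame A c p j) (coord_frame A c p i))" for c p
  define grad :: "('a, 'm) chart \<Rightarrow> 'a \<Rightarrow> real^'m::_" where
    "grad c p = (\<chi> i. coord_vec A c p (axis i 1) f)" for c p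
  define \<xi> :: "('a, 'm) chart \<Rightarrow> 'a \<Rightarrow> real^'m::_" where
    "\<xi> c p = (\<chi> k. det (\<chi> i j. if j = k then grad c p $ i else M c p $ i $ j) / det (M c p))" for c p
  have iff: "(\<forall>w\<in>tangent_space A p. \<omega> p (coord_vec A c p u) w = w f) \<longleftrightarrow> u = \<xi> c p"
    if c: "c \<in> A" "p \<in> fst c" for c p u
  proof -
    have "coord_vec A c p w f = (\<Sum>i\<in>UNIV. w $ i * grad c p $ i)" for w
      using linear_eq_sum_axis[OF linear_coord_vec_apply[OF c, of f], of w] by (simp add: grad_def)
    then show ?thesis
      using hamiltonian_vector_chart(2)[OF c, of u "grad c p"]
      unfolding tangent_space_eq[OF c] \<xi>_def M_def by simp
  qed
  define X where "X p = (THE v. v \<in> tangent_space A p \<and> (\<forall>w\<in>tangent_space A p. \<omega> p v w = w f))" for p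
  have X: "X p = coord_vec A c p (\<xi> c p)" if c: "c \<in> A" "p \<in> fst c" for c p
    unfolding X_def
  proof (rule the_equality)
    show "coord_vec A c p (\<xi> c p) \<in> tangent_space A p \<and>
        (\<forall>w\<in>tangent_space A p. \<omega> p (coord_vec A c p (\<xi> c p)) w = w f)"
      using iff[OF c] coord_vec_in_tangent_space[OF c] by blast
  next
    fix v assume v: "v \<in> tangent_space A p \<and> (\<forall>w\<in>tangent_space A p. \<omega> p v w = w f)"
    then obtain u where "v = coord_vec A c p u" using tangent_space_eq[OF c] by blast
    then show "v = coord_vec A c p (\<xi> c p)" using iff[OF c, of u] v by blast
  qed
  have "X \<in> vector_fields A"
  proof (rule vector_fieldI)
    fix p
    obtain c where c: "c \<in> A" "p \<in> fst c" using chart_cover .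
    let ?S = "snd c ` fst c"
    have oS: "open ?S" by (rule chart_openD(2)[OF c(1)])
    have sM: "smooth_on ?S (\<lambda>y. M c (chart_inv c y) $ i $ j)" for i j
      using smooth_on_two_form_frame[OF two_form c(1)] by (simp add: M_def)
    have sg: "smooth_on ?S (\<lambda>y. grad c (chart_inv c y) $ i)" for i
    proof (rule smooth_on_cong[OF oS _ smooth_on_frechet_derivative[OF C_infD[OF f c(1)]]])
      show "frechet_derivative (f \<circ> chart_inv c) (at y) (axis i 1) = grad c (chart_inv c y) $ i" if "y \<in> ?S" for y
        using that c f by (simp add: grad_def coord_vec_def)
    qed
    have "smooth_on ?S (\<lambda>y. det (M c (chart_inv c y)))"
      using smooth_on_det[OF oS, of "\<lambda>y i j. M c (chart_inv c y) $ i $ j"] sM by (simp add: vec_nth_inverse)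
    moreover have "smooth_on ?S (\<lambda>y. if j = k then grad c (chart_inv c y) $ i else M c (chart_inv c y) $ i $ j)" for i j k
      using sM sg by (cases "j = k") auto
    moreover have "det (M c (chart_inv c y)) \<noteq> 0" if "y \<in> ?S" for y
      unfolding M_def by (rule hamiltonian_vector_chart(1)[OF c(1)]) (use c that in auto)
    ultimately have "smooth_on ?S (\<lambda>y. \<xi> c (chart_inv c y))"
      unfolding \<xi>_def
      by (intro smooth_on_vec_lambda smooth_on_divide smooth_on_det oS) auto
    then show "\<exists>c\<in>A. \<exists>U \<xi>. open U \<and> p \<in> U \<and> U \<subseteq> fst c \<and> smooth_on (snd c ` U) \<xi> \<and>
        (\<forall>q\<in>U. X q = coord_vec A c q (\<xi> (snd c q)))"
      using c X chart_openD(1)[OF c(1)]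
      by (intro bexI[OF _ c(1)] exI[of _ "fst c"] exI[of _ "\<lambda>y. \<xi> c (chart_inv c y)"]) auto
  qed
  moreover have "\<omega> p (X p) w = w f" if "w \<in> tangent_space A p" for p w
  proof -
    obtain c where c: "c \<in> A" "p \<in> fst c" using chart_cover .
    show ?thesis using iff[OF c, of "\<xi> c p"] that by (simp add: X[OF c])
  qed
  ultimately show ?thesis by blast
qed

lemma two_form_lincomb:
  assumes "u \<in> tangent_space A p" "v \<in> tangent_space A p" "w \<in> tangent_space A p"
  shows "\<omega> p (lincomb a u b v) w = a * \<omega> p u w + b * \<omega> p v w"
  using two_form assms unfolding is_two_form_def by blast

lemma two_form_eqI:
  assumes "u \<in> tangent_space A p" "v \<in> tangent_space A p"
    "\<And>w. w \<in> tangent_space A p \<Longrightarrow> \<omega> p u w = \<omega> p v w"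
  shows "u = v"
proof -
  have "lincomb 1 u (-1) v = (\<lambda>f. 0)"
    by (rule nondegenerate[of _ p]) (use assms two_form_lincomb lincomb_in_tangent_space in auto)
  then show ?thesis by (auto simp: lincomb_def fun_eq_iff)
qed

text \<open>Existence supplies a solution against all tangent vectors. For uniqueness, the global
  test fields in the definition reach every tangent vector.\<close>

lemma hamiltonian_field:
  assumes f: "f \<in> C_inf A"
  shows "hamiltonian_field A \<omega> f \<in> vector_fields A"
    "w \<in> tangent_space A p \<Longrightarrow> \<omega> p (hamiltonian_field A \<omega> f p) w = w f"
proof -
  obtain X where X: "X \<in> vector_fields A" "\<And>p w. w \<in> tangent_space A p \<Longrightarrow> \<omega> p (X p) w = w f"
    using hamiltonian_exists[OF f] by blast
  have "hamiltonian_field A \<omega> f = X"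
    unfolding hamiltonian_field_def
  proof (rule the_equality)
    show "X \<in> vector_fields A \<and> (\<forall>Y\<in>vector_fields A. \<forall>p. \<omega> p (X p) (Y p) = Y p f)"
      using X vector_fieldD(1) by blast
  next
    fix Z assume Z: "Z \<in> vector_fields A \<and> (\<forall>Y\<in>vector_fields A. \<forall>p. \<omega> p (Z p) (Y p) = Y p f)"
    show "Z = X"
    proof
      fix p
      show "Z p = X p"
      proof (rule two_form_eqI)
        fix w assume w: "w \<in> tangent_space A p"
        then obtain Y where "Y \<in> vector_fields A" "Y p = w" using vector_field_through by blast
        then show "\<omega> p (Z p) w = \<omega> p (X p) w" using Z X(2)[OF w] by auto
      qed (use Z X(1) vector_fieldD(1) in blast)+
    qed
  qed
  then show "hamiltonian_field A \<omega> f \<in> vector_fields A"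
    "w \<in> tangent_space A p \<Longrightarrow> \<omega> p (hamiltonian_field A \<omega> f p) w = w f"
    using X(1) X(2)[of w p] by simp_all
qed

lemma poisson_bracket_C_inf:
  assumes "f \<in> C_inf A" "g \<in> C_inf A"
  shows "poisson_bracket A \<omega> f g \<in> C_inf A"
  unfolding poisson_bracket_def[abs_def]
  by (rule two_form_C_inf[OF two_form hamiltonian_field(1)[OF assms(1)] hamiltonian_field(1)[OF assms(2)]])

section \<open>Orientation and integration against the volume form\<close>

lemma Diff_plusD: "\<phi> \<in> Diff_plus A \<mu> \<Longrightarrow> diffeomorphism A \<phi>"
  by (simp add: Diff_plus_def)

lemma Diff_plus_pos:
  assumes "\<phi> \<in> Diff_plus A \<mu>" "\<And>i. vs i \<in> tangent_space A p" "\<mu> p vs > 0"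
  shows "\<mu> (\<phi> p) (\<lambda>i. tangent_map A \<phi> (vs i)) > 0"
  using assms by (simp add: Diff_plus_def)

text \<open>The normalisation to total integral 1 excludes an infinite measure, because
  \<open>measure\<close> takes the value 0 at infinite mass.\<close>

lemma finite_vol_measure: "finite_measure (vol_measure A \<mu>)"
proof
  have "measure (vol_measure A \<mu>) (space (vol_measure A \<mu>)) = 1"
    using volume_1 by (simp add: vol_integral_def \<mu>_def)
  then show "emeasure (vol_measure A \<mu>) (space (vol_measure A \<mu>)) \<noteq> \<infinity>"
    by (auto simp: measure_def)
qed

lemma continuous_measurable_vol:
  "continuous_on UNIV (h :: 'a \<Rightarrow> real) \<Longrightarrow> h \<in> borel_measurable (vol_measure A \<mu>)"
  using borel_measurable_continuous_onI measurable_cong_sets[OF sets_vol_measure[OF volume_form_top_form] refl]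
  by blast

lemma continuous_bounded:
  assumes "continuous_on UNIV (h :: 'a \<Rightarrow> real)"
  obtains K where "\<And>x. \<bar>h x\<bar> \<le> K"
proof -
  have "bounded (range h)"
    using compact_continuous_image[OF assms compact_UNIV] compact_imp_bounded by blast
  then show thesis using that by (auto simp: bounded_iff)
qed

lemma continuous_integrable:
  assumes "continuous_on UNIV (h :: 'a \<Rightarrow> real)"
  shows "integrable (vol_measure A \<mu>) h"
proof -
  obtain K where "\<And>x. \<bar>h x\<bar> \<le> K" using continuous_bounded[OF assms] by blast
  then show ?thesis
    by (intro finite_measure.integrable_const_bound[OF finite_vol_measure, where B=K] continuous_measurable_vol assms) auto
qed

text \<open>The density of \<mu> vanishes nowhere in a chart, so an open set of mass zero on which
  \<open>h\<close> is positive would give a nonempty Lebesgue null open set of coordinates.\<close>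

lemma vol_integral_eq_0_imp:
  assumes h: "continuous_on UNIV h" "\<And>x. 0 \<le> h x" and 0: "vol_integral A \<mu> h = 0"
  shows "h p = 0"
proof (rule ccontr)
  assume "h p \<noteq> 0"
  then have hp: "0 < h p" using h(2)[of p] by linarith
  let ?m = "vol_measure A \<mu>" and ?U = "h -` {0<..}"
  have m: "sets ?m = sets borel"
    "\<And>c B. c \<in> A \<Longrightarrow> B \<in> sets borel \<Longrightarrow> B \<subseteq> fst c \<Longrightarrow> emeasure ?m B = chart_mass A c \<mu> B"
    using is_vol_measure_vol_measure[OF volume_form_top_form] by (auto simp: is_vol_measure_def)
  obtain c where c: "c \<in> A" "p \<in> fst c" using chart_cover .
  have oU: "open ?U" using h(1) by (intro open_vimage) auto
  let ?V = "snd c ` (fst c \<inter> ?U)"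
  have oV: "open ?V" by (rule open_chart_image[OF c(1) oU])
  have UB: "fst c \<inter> ?U \<in> sets borel" using oU chart_openD(1)[OF c(1)] by auto
  have "AE x in ?m. h x = 0"
    using 0 integral_nonneg_eq_0_iff_AE[OF continuous_integrable[OF h(1)]] h(2)
    by (auto simp: vol_integral_def)
  then have "AE x in ?m. x \<notin> fst c \<inter> ?U" by (rule eventually_mono) auto
  then have "emeasure ?m (fst c \<inter> ?U) = 0"
    using UB m(1) AE_iff_null_sets[of "fst c \<inter> ?U" ?m] by auto
  then have "chart_mass A c \<mu> (fst c \<inter> ?U) = 0" using m(2)[OF c(1) UB] by simp
  moreover have "(\<lambda>y. ennreal (vdens A c \<mu> y) * indicator ?V y) \<in> borel_measurable lborel"
  proof -
    have "(\<lambda>y. ennreal (vdens A c \<mu> y * indicator ?V y)) \<in> borel_measurable borel"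
      by (rule measurable_compose[OF vdens_measurable[OF volume_form_top_form c(1) _ image_mono]
            measurable_ennreal]) (use oV in auto)
    moreover have "ennreal (vdens A c \<mu> y * indicator ?V y) = ennreal (vdens A c \<mu> y) * indicator ?V y" for y
      by (auto split: split_indicator)
    ultimately show ?thesis by simp
  qed
  ultimately have "AE y in lborel. ennreal (vdens A c \<mu> y) * indicator ?V y = 0"
    unfolding chart_mass_def by (simp add: nn_integral_0_iff_AE)
  then have "AE y in lborel. y \<notin> ?V"
  proof (rule eventually_mono)
    fix y assume y: "ennreal (vdens A c \<mu> y) * indicator ?V y = 0"
    show "y \<notin> ?V"
    proof
      assume yV: "y \<in> ?V"
      then have "chart_inv c y \<in> fst c" using c by auto
      then have "vdens A c \<mu> y > 0" using volume_form_frame_nonzero[OF c(1)] by (simp add: vdens_def)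
      then show False using y yV by (simp add: indicator_def)
    qed
  qed
  then have "?V \<in> null_sets lborel" using oV by (subst AE_iff_null_sets) auto
  then have "negligible ?V" by (simp add: negligible_iff_null_sets null_sets_completionI)
  moreover have "snd c p \<in> ?V" using c hp by auto
  ultimately show False using open_not_negligible[OF oV] by blast
qed

lemma tangent_map_inv:
  assumes \<phi>: "diffeomorphism A \<phi>" and v: "v \<in> tangent_space A p"
  shows "tangent_map A (inv \<phi>) (tangent_map A \<phi> v) = v"
    "tangent_map A \<phi> (tangent_map A (inv \<phi>) v) = v"
proof -
  note d = diffeomorphismD[OF \<phi>]
  have "inv \<phi> \<circ> \<phi> = (\<lambda>x. x)" "\<phi> \<circ> inv \<phi> = (\<lambda>x. x)"
    using d(1) by (auto simp: fun_eq_iff bij_is_inj bij_is_surj surj_f_inv_f)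
  then show "tangent_map A (inv \<phi>) (tangent_map A \<phi> v) = v"
    "tangent_map A \<phi> (tangent_map A (inv \<phi>) v) = v"
    using tangent_map_compose[OF d(3), of \<phi> v] tangent_map_compose[OF d(2), of "inv \<phi>" v]
      tangent_map_ident[OF v] by simp_all
qed

text \<open>Both \<open>\<mu>\<close> and \<open>\<phi>\<^sub>*\<mu>\<close> are nonzero multiples of the determinant at \<open>p\<close>, so that the sign on one
  frame decides the sign on all frames.\<close>

lemma push_forward_positive:
  assumes \<phi>: "\<phi> \<in> Diff_plus A \<mu>" and vs: "\<And>i. vs i \<in> tangent_space A p" and pos: "\<mu> p vs > 0"
  shows "push_forward A \<phi> \<mu> p vs > 0"
proof -
  let ?\<psi> = "inv \<phi>"
  note D = Diff_plusD[OF \<phi>]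
  note d = diffeomorphismD[OF D]
  obtain c where c: "c \<in> A" "p \<in> fst c" using chart_cover .
  obtain e where e: "e \<in> A" "?\<psi> p \<in> fst e" using chart_cover .
  define F where "F us = push_forward A \<phi> \<mu> p (\<lambda>i. coord_vec A c p (us i))" for us
  define G where "G us = \<mu> p (\<lambda>i. coord_vec A c p (us i))" for us
  have F: "alt_multilinear F" and G: "alt_multilinear G"
    unfolding F_def[abs_def] G_def[abs_def]
    by (intro alt_multilinear_top_form is_top_form_push_forward volume_form_top_form D c)+
  let ?ax = "\<lambda>i. axis i 1 :: real^'m::_"
  have Fd: "F us = det (\<chi> i. us i) * F ?ax" and Gd: "G us = det (\<chi> i. us i) * G ?ax" for us
    using alt_multilinear_rows[OF F, of "\<chi> i. us i"] alt_multilinear_rows[OF G, of "\<chi> i. us i"]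
    by (simp_all add: row_def)
  have Tin: "tangent_map A \<phi> v \<in> tangent_space A p" if "v \<in> tangent_space A (?\<psi> p)" for v
    using tangent_map_in[OF d(2) that] d(1) by (simp add: bij_is_surj surj_f_inv_f)
  \<comment> \<open>\<phi> carries a positive frame at \<open>?\<psi> p\<close> to a positive one at
    \<open>p\<close>. This is the implication opposite to the claim; comparing the two multiples of
    the determinant reverses it.\<close>
  have key: "G us > 0" if "F us > 0" for us
  proof -
    let ?w = "\<lambda>i. tangent_map A ?\<psi> (coord_vec A c p (us i))"
    have "?w i \<in> tangent_space A (?\<psi> p)" for i using tangent_map_in[OF d(3)] c by simp
    moreover have "\<mu> (?\<psi> p) ?w > 0" using that by (simp add: F_def push_forward_def)
    ultimately have "\<mu> (\<phi> (?\<psi> p)) (\<lambda>i. tangent_map A \<phi> (?w i)) > 0"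
      by (rule Diff_plus_pos[OF \<phi>])
    then show ?thesis
      using d(1) c by (simp add: G_def tangent_map_inv(2)[OF D coord_vec_in_tangent_space] bij_is_surj surj_f_inv_f)
  qed
  \<comment> \<open>Otherwise \<open>F\<close> would vanish on all frames, in particular on the
    image under \<phi> of a coordinate frame at the preimage, where its value is the nonzero value
    of \<mu> on that frame.\<close>
  have F0: "F ?ax \<noteq> 0"
  proof
    assume 0: "F ?ax = 0"
    have "F (\<lambda>i. vcomp A c p (tangent_map A \<phi> (coord_frame A e (?\<psi> p) i))) = 0"
      by (subst Fd) (simp only: 0 mult_zero_right)
    then have "\<mu> (?\<psi> p) (coord_frame A e (?\<psi> p)) = 0"
      using e by (simp add: F_def push_forward_def coord_vec_vcomp[OF c Tin] coord_frame_def[abs_def]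
          tangent_map_inv(1)[OF D coord_vec_in_tangent_space])
    then show False using volume_form_frame_nonzero[OF e] by simp
  qed
  have "F ?ax * G ?ax > 0"
  proof -
    \<comment> \<open>Any index will do. Scaling this axis by the sign of \<open>F\<close> makes
      \<open>F\<close> positive, so that \<open>key\<close> applies and shows that \<open>F\<close>
      and \<open>G\<close> have the same sign on the axes.\<close>
    obtain i0 :: 'm where True by simp
    let ?us = "?ax(i0 := sgn (F ?ax) *\<^sub>R axis i0 1)"
    have "F ?us = sgn (F ?ax) * F (?ax(i0 := axis i0 1))" "G ?us = sgn (F ?ax) * G (?ax(i0 := axis i0 1))"
      by (simp_all only: linear_scale[OF alt_multilinear_linear[OF F]] linear_scale[OF alt_multilinear_linear[OF G]]
          real_scaleR_def)
    moreover have "?ax(i0 := axis i0 1) = ?ax" by auto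
    ultimately have us: "F ?us = sgn (F ?ax) * F ?ax" "G ?us = sgn (F ?ax) * G ?ax" by (simp_all only:)
    have "F ?us > 0" using F0 unfolding us by (simp add: sgn_if)
    from key[OF this] have "sgn (F ?ax) * G ?ax > 0" unfolding us .
    then show ?thesis by (auto simp: sgn_if zero_less_mult_iff split: if_splits)
  qed
  moreover have "G (\<lambda>i. vcomp A c p (vs i)) > 0"
    using pos by (simp add: G_def coord_vec_vcomp[OF c vs])
  ultimately have "F (\<lambda>i. vcomp A c p (vs i)) > 0"
    using Fd[of "\<lambda>i. vcomp A c p (vs i)"] Gd[of "\<lambda>i. vcomp A c p (vs i)"]
    by (auto simp: zero_less_mult_iff)
  then show ?thesis by (simp add: F_def coord_vec_vcomp[OF c vs])
qed

lemma proj_Dens_in_Dens: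
  assumes \<phi>: "\<phi> \<in> Diff_plus A \<mu>"
  shows "proj_Dens A \<mu> \<phi> \<in> Dens A \<mu>"
proof -
  note D = Diff_plusD[OF \<phi>]
  have "vol_integral A (push_forward A \<phi> \<mu>) (\<lambda>x. 1) = 1"
    using vol_integral_push_forward[OF volume_form_top_form D, of "\<lambda>x. 1"] volume_1 by (simp add: \<mu>_def)
  moreover have "\<forall>p vs. (\<forall>i. vs i \<in> tangent_space A p) \<and> \<mu> p vs > 0 \<longrightarrow> push_forward A \<phi> \<mu> p vs > 0"
    using push_forward_positive[OF \<phi>] by simp
  ultimately show ?thesis
    using is_top_form_push_forward[OF volume_form_top_form D]
    unfolding Dens_def proj_Dens_def by (intro CollectI conjI)
qed

lemma W_right_invariant_volume: "W_right_invariant A \<omega> \<mu>"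
  unfolding W_right_invariant_def
proof (intro ballI)
  fix \<phi> \<psi> U V
  assume \<phi>: "\<phi> \<in> Diff_plus A \<mu>" and \<psi>: "\<psi> \<in> Diff_mu A \<mu>"
    and UV: "U \<in> tangent_Diff A \<phi>" "V \<in> tangent_Diff A \<phi>"
  have D: "diffeomorphism A \<psi>" using \<psi> Diff_plusD by (auto simp: Diff_mu_def)
  obtain X Y where X: "X \<in> vector_fields A" "U = X \<circ> \<phi>" and Y: "Y \<in> vector_fields A" "V = Y \<circ> \<phi>"
    using UV by (auto simp: tangent_Diff_def)
  let ?h = "\<lambda>x. \<omega> (\<phi> x) (U x) (V x)"
  have h: "continuous_on UNIV ?h"
    using continuous_on_compose2[OF C_inf_continuous[OF two_form_C_inf[OF two_form X(1) Y(1)]]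
        smooth_map_continuous[OF diffeomorphismD(2)[OF Diff_plusD[OF \<phi>]]]]
    by (simp add: X Y)
  \<comment> \<open>Membership in \<open>Diff_mu\<close> equates the two forms on tangent vectors
    only, so they are compared through chart masses, which evaluate them on coordinate
    frames.\<close>
  have "chart_mass A c \<mu> B = chart_mass A c (push_forward A \<psi> \<mu>) B"
    if c: "c \<in> A" and B: "B \<subseteq> fst c" for c B
    unfolding chart_mass_def
  proof (rule nn_integral_cong)
    fix y
    show "ennreal (vdens A c \<mu> y) * indicator (snd c ` B) y
        = ennreal (vdens A c (push_forward A \<psi> \<mu>) y) * indicator (snd c ` B) y"
    proof (cases "y \<in> snd c ` B")
      case True
      then have "\<forall>i. coord_frame A c (chart_inv c y) i \<in> tangent_space A (chart_inv c y)"
        using c B by (auto simp: coord_frame_def)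
      then have "push_forward A \<psi> \<mu> (chart_inv c y) (coord_frame A c (chart_inv c y))
          = \<mu> (chart_inv c y) (coord_frame A c (chart_inv c y))"
        using \<psi> unfolding Diff_mu_def by blast
      then show ?thesis by (simp add: vdens_def)
    qed simp
  qed
  then have "is_vol_measure A (push_forward A \<psi> \<mu>) (vol_measure A \<mu>)"
    using is_vol_measure_vol_measure[OF volume_form_top_form] by (auto simp: is_vol_measure_def)
  then have "vol_measure A (push_forward A \<psi> \<mu>) = vol_measure A \<mu>" by (rule vol_measure_eqI)
  then show "W_form A \<omega> \<mu> (\<phi> \<circ> \<psi>) (U \<circ> \<psi>) (V \<circ> \<psi>) = W_form A \<omega> \<mu> \<phi> U V"
    using vol_integral_push_forward[OF volume_form_top_form D h]
    by (simp add: W_form_def vol_integral_def)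
qed

end


section \<open>Paths of diffeomorphisms\<close>

text \<open>This is det(I + e_i w^T) = 1 + w_i, the Jacobian of a shear: the matrix arises from a
  diagonal one by adding to row i a combination of the other rows.\<close>

lemma det_one_plus_row:
  fixes w :: "real^'m"
  shows "det (\<chi> k. if k = i then axis i 1 + w else axis k 1) = 1 + w $ i"
proof -
  define D :: "real^'m^'m" where "D = (\<chi> k j. if k = j then (if k = i then 1 + w $ i else 1) else 0)"
  have row: "row k D = (if k = i then (1 + w $ i) *s axis i 1 else axis k 1)" for k
    by (auto simp: D_def row_def vec_eq_iff axis_def)
  define x where "x = w - w $ i *s axis i 1"
  have "x = (\<Sum>j\<in>UNIV - {i}. w $ j *s axis j 1)"
  proof -
    have "(\<Sum>j\<in>UNIV. w $ j *s axis j 1) = w $ i *s axis i 1 + (\<Sum>j\<in>UNIV - {i}. w $ j *s axis j 1)"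
      by (rule sum.remove) auto
    then show ?thesis unfolding x_def basis_expansion by (metis add_diff_cancel_left')
  qed
  also have "\<dots> \<in> vec.span {row j D |j. j \<noteq> i}"
    by (intro vec.span_sum vec.span_scale vec.span_base) (auto simp: row intro!: exI)
  finally have x: "x \<in> vec.span {row j D |j. j \<noteq> i}" .
  have "(\<chi> k. if k = i then axis i 1 + w else axis k 1) = (\<chi> k. if k = i then row i D + x else row k D)"
    by (auto simp: vec_eq_iff row x_def algebra_simps)
  then have "det (\<chi> k. if k = i then axis i 1 + w else axis k 1) = det D"
    using det_row_span[OF x] by simp
  also have "\<dots> = (\<Prod>k\<in>UNIV. if k = i then 1 + w $ i else 1)"
    by (subst det_diagonal) (auto simp: D_def)
  also have "\<dots> = 1 + w $ i" by simp
  finally show ?thesis .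
qed

section \<open>Maps supported in a chart and smooth families of maps\<close>

definition chart_lift :: "('a, 'm::finite) chart \<Rightarrow> (real^'m \<Rightarrow> real^'m) \<Rightarrow> 'a \<Rightarrow> 'a" where
  "chart_lift c H q = (if q \<in> fst c then chart_inv c (H (snd c q)) else q)"

definition rep_domain ::
  "real set \<Rightarrow> ('a, 'm::finite) chart \<Rightarrow> ('a, 'm) chart \<Rightarrow> (real \<Rightarrow> 'a \<Rightarrow> 'a) \<Rightarrow> (real \<times> (real^'m)) set" where
  "rep_domain J c c' \<Gamma> = {(t, y). t \<in> J \<and> y \<in> snd c ` fst c \<and> \<Gamma> t (chart_inv c y) \<in> fst c'}"

text \<open>The regularity clauses of \<open>smooth_path_Diff\<close>, separated from membership in
  \<open>Diff_plus\<close> and with any parameter set. A family constant in t, over all of the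
  reals, also yields smoothness of a single map.\<close>

definition jointly_smooth ::
  "('a::topological_space, 'm::finite) chart set \<Rightarrow> real set \<Rightarrow> (real \<Rightarrow> 'a \<Rightarrow> 'a) \<Rightarrow> bool" where
  "jointly_smooth A J \<Gamma> \<longleftrightarrow> continuous_on (J \<times> UNIV) (\<lambda>(t, x). \<Gamma> t x) \<and>
     (\<forall>c\<in>A. \<forall>c'\<in>A. smooth_on (rep_domain J c c' \<Gamma>) (\<lambda>(t, y). snd c' (\<Gamma> t (chart_inv c y))))"

context smooth_manifold
begin

lemma jointly_smoothD:
  assumes "jointly_smooth A J \<Gamma>"
  shows "continuous_on (J \<times> UNIV) (\<lambda>(t, x). \<Gamma> t x)"
    "c \<in> A \<Longrightarrow> c' \<in> A \<Longrightarrow> smooth_on (rep_domain J c c' \<Gamma>) (\<lambda>(t, y). snd c' (\<Gamma> t (chart_inv c y)))"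
  using assms by (auto simp: jointly_smooth_def)

text \<open>Joint continuity makes the domain of a coordinate representative open, so that the rules
  for \<open>smooth_on\<close> apply there.\<close>

lemma open_rep_domain:
  assumes \<Gamma>: "jointly_smooth A J \<Gamma>" and J: "open J" and c: "c \<in> A" "c' \<in> A"
  shows "open (rep_domain J c c' \<Gamma>)"
proof -
  let ?S = "J \<times> snd c ` fst c" and ?g = "\<lambda>p. \<Gamma> (fst p) (chart_inv c (snd p))"
  have oS: "open ?S" using J chart_openD(2)[OF c(1)] by (rule open_Times)
  have "continuous_on ?S (\<lambda>p. (fst p, chart_inv c (snd p)))"
    by (intro continuous_on_Pair continuous_on_fst continuous_on_id
        continuous_on_compose2[OF chart_continuous_on(2)[OF c(1)] continuous_on_snd[OF continuous_on_id]]) auto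
  moreover have "(\<lambda>p. (fst p, chart_inv c (snd p))) ` ?S \<subseteq> J \<times> UNIV" by auto
  ultimately have "continuous_on ?S ?g"
    using continuous_on_compose2[OF jointly_smoothD(1)[OF \<Gamma>]] by (fastforce simp: case_prod_beta')
  then have "open (?S \<inter> ?g -` fst c')"
    using oS chart_openD(1)[OF c(2)] by (rule continuous_open_preimage)
  moreover have "?S \<inter> ?g -` fst c' = rep_domain J c c' \<Gamma>"
    by (auto simp: rep_domain_def)
  ultimately show ?thesis by simp
qed

lemma jointly_smooth_imp_smooth_map:
  assumes \<Gamma>: "jointly_smooth A J \<Gamma>" and J: "open J" and t: "t \<in> J"
  shows "smooth_map A (\<Gamma> t)"
proof -
  have "continuous_on UNIV (\<lambda>x. (t, x))" by (intro continuous_intros)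
  from continuous_on_compose2[OF jointly_smoothD(1)[OF \<Gamma>] this]
  have cont: "continuous_on UNIV (\<Gamma> t)" using t by auto
  have "smooth_on (snd c ` (fst c \<inter> \<Gamma> t -` fst c')) (snd c' \<circ> \<Gamma> t \<circ> chart_inv c)"
    if c: "c \<in> A" "c' \<in> A" for c c'
  proof -
    let ?T = "snd c ` (fst c \<inter> \<Gamma> t -` fst c')"
    have oT: "open ?T" by (intro open_chart_image c open_vimage chart_openD cont)
    have "smooth_on ?T (\<lambda>y. (\<lambda>(t, y). snd c' (\<Gamma> t (chart_inv c y))) (t, y))"
      by (rule smooth_on_compose[OF oT open_rep_domain[OF \<Gamma> J c] _
            smooth_on_Pair[OF oT smooth_on_const smooth_on_ident[OF oT]] jointly_smoothD(2)[OF \<Gamma> c]])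
        (use t c in \<open>auto simp: rep_domain_def\<close>)
    then show ?thesis by (simp add: o_def)
  qed
  then show ?thesis using cont by (simp add: smooth_map_def)
qed

lemma jointly_smooth_compose:
  assumes \<Gamma>: "jointly_smooth A J \<Gamma>" and J: "open J" and \<phi>: "smooth_map A \<phi>"
  shows "jointly_smooth A J (\<lambda>t x. \<Gamma> t (\<phi> x))"
proof -
  have "continuous_on (J \<times> UNIV) (\<lambda>p. (fst p, \<phi> (snd p)))"
    by (intro continuous_on_Pair continuous_on_fst continuous_on_id
        continuous_on_compose2[OF smooth_map_continuous[OF \<phi>] continuous_on_snd[OF continuous_on_id]]) auto
  moreover have "(\<lambda>p. (fst p, \<phi> (snd p))) ` (J \<times> UNIV) \<subseteq> J \<times> UNIV" by auto
  ultimately have "continuous_on (J \<times> UNIV) (\<lambda>(t, x). \<Gamma> t (\<phi> x))"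
    using continuous_on_compose2[OF jointly_smoothD(1)[OF \<Gamma>]] by (fastforce simp: case_prod_beta')
  moreover have "smooth_on (rep_domain J c c' (\<lambda>t x. \<Gamma> t (\<phi> x))) (\<lambda>(t, y). snd c' (\<Gamma> t (\<phi> (chart_inv c y))))"
    if c: "c \<in> A" "c' \<in> A" for c c'
  proof (rule smooth_on_local)
    fix p assume "p \<in> rep_domain J c c' (\<lambda>t x. \<Gamma> t (\<phi> x))"
    then obtain t q where p: "p = (t, snd c q)" "t \<in> J" "q \<in> fst c" "\<Gamma> t (\<phi> q) \<in> fst c'"
      using c by (auto simp: rep_domain_def)
    obtain d where d: "d \<in> A" "\<phi> q \<in> fst d" using chart_cover .
    let ?W = "snd c ` (fst c \<inter> \<phi> -` fst d)" and ?h = "\<lambda>p. (fst p, chart_rep c d \<phi> (snd p))"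
    have oW: "open ?W" by (rule open_chart_rep_domain[OF \<phi> c(1) d(1)])
    have oJW: "open (J \<times> ?W)" using J oW by (rule open_Times)
    have sh: "smooth_on (J \<times> ?W) ?h"
      by (intro smooth_on_Pair oJW smooth_on_bounded_linear bounded_linear_fst
          smooth_on_compose[OF oJW oW _ smooth_on_bounded_linear[OF bounded_linear_snd oJW]
            smooth_on_chart_rep[OF \<phi> c(1) d(1)]]) auto
    let ?D = "rep_domain J d c' \<Gamma>"
    have oD: "open ?D" by (rule open_rep_domain[OF \<Gamma> J d(1) c(2)])
    let ?T = "J \<times> ?W \<inter> ?h -` ?D"
    have oT: "open ?T"
      by (rule continuous_open_preimage[OF smooth_on_imp_continuous_on[OF sh] oJW oD])
    have "smooth_on ?T (\<lambda>p. (\<lambda>(t, y). snd c' (\<Gamma> t (chart_inv d y))) (?h p))"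
      by (rule smooth_on_compose[OF oT oD _ smooth_on_subset[OF sh] jointly_smoothD(2)[OF \<Gamma> d(1) c(2)]]) auto
    moreover have "p \<in> ?T"
      using p d c by (auto simp: rep_domain_def chart_rep_def)
    moreover have "(\<lambda>(t, y). snd c' (\<Gamma> t (chart_inv d y))) (?h z) = (\<lambda>(t, y). snd c' (\<Gamma> t (\<phi> (chart_inv c y)))) z"
      if "z \<in> ?T" for z
      using that c d by (auto simp: chart_rep_def)
    ultimately show "\<exists>T g. open T \<and> p \<in> T \<and> smooth_on T g \<and>
        (\<forall>z\<in>T. g z = (\<lambda>(t, y). snd c' (\<Gamma> t (\<phi> (chart_inv c y)))) z)"
      using oT by blast
  qed
  ultimately show ?thesis by (simp add: jointly_smooth_def)
qed

lemma chart_lift_eq_ident: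
  assumes c: "c \<in> A" and H: "\<And>y. y \<notin> ball y0 r \<Longrightarrow> H y = y"
    and q: "q \<notin> chart_inv c ` cball y0 r"
  shows "chart_lift c H q = q"
proof (cases "q \<in> fst c")
  case True
  then have "snd c q \<notin> cball y0 r" using q c by (metis chart_inv_snd image_eqI)
  then have "snd c q \<notin> ball y0 r" by auto
  then show ?thesis using H True c by (simp add: chart_lift_def)
qed (simp add: chart_lift_def)

lemma chart_lift_maps:
  assumes c: "c \<in> A" and sub: "cball y0 r \<subseteq> snd c ` fst c"
    and H: "\<And>y. y \<notin> ball y0 r \<Longrightarrow> H y = y" "\<And>y. y \<in> ball y0 r \<Longrightarrow> H y \<in> ball y0 r"
    and q: "q \<in> fst c"
  shows "H (snd c q) \<in> snd c ` fst c" "chart_lift c H q \<in> fst c" "snd c (chart_lift c H q) = H (snd c q)"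
proof -
  show *: "H (snd c q) \<in> snd c ` fst c"
  proof (cases "snd c q \<in> ball y0 r")
    case True
    then show ?thesis using H(2) sub ball_subset_cball by blast
  qed (use H(1) q in auto)
  show "chart_lift c H q \<in> fst c" "snd c (chart_lift c H q) = H (snd c q)"
    using chart_inv_in[OF c *] snd_chart_inv[OF c *] q by (simp_all add: chart_lift_def)
qed

lemma chart_lift_inverse:
  assumes c: "c \<in> A" and sub: "cball y0 r \<subseteq> snd c ` fst c"
    and H: "\<And>y. y \<notin> ball y0 r \<Longrightarrow> H y = y" "\<And>y. y \<in> ball y0 r \<Longrightarrow> H y \<in> ball y0 r"
    and RH: "\<And>y. R (H y) = y"
  shows "chart_lift c R (chart_lift c H q) = q"
proof (cases "q \<in> fst c")
  case True
  have "chart_lift c R (chart_lift c H q) = chart_inv c (R (snd c (chart_lift c H q)))"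
    using chart_lift_maps(2)[OF c sub H True] by (simp add: chart_lift_def[of c R])
  then show ?thesis
    using chart_lift_maps(3)[OF c sub H True] RH c True by simp
qed (simp add: chart_lift_def)

text \<open>Two open sets cover M: the chart domain, where the lift is \<open>H\<close> in
  coordinates, and the complement of the compact ball, where it is the identity. Continuity is glued
  over this cover; smoothness is local, with changes of chart on both sides of
  \<open>H\<close>.\<close>

lemma jointly_smooth_chart_lift:
  assumes c: "c \<in> A" and sub: "cball y0 r \<subseteq> snd c ` fst c" and J: "open J"
    and smH: "smooth_on UNIV (\<lambda>(t, y). H t y)"
    and H: "\<And>t y. t \<in> J \<Longrightarrow> y \<notin> ball y0 r \<Longrightarrow> H t y = y"
      "\<And>t y. t \<in> J \<Longrightarrow> y \<in> ball y0 r \<Longrightarrow> H t y \<in> ball y0 r"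
  shows "jointly_smooth A J (\<lambda>t. chart_lift c (H t))"
proof -
  let ?\<Gamma> = "\<lambda>t. chart_lift c (H t)" and ?K = "chart_inv c ` cball y0 r"
  have id: "?\<Gamma> t q = q" if "t \<in> J" "q \<notin> ?K" for t q
    by (rule chart_lift_eq_ident[OF c H(1)[OF that(1)] that(2)])
  have oK: "open (- ?K)"
    using compact_chart_inv[OF c compact_cball sub] compact_imp_closed by blast
  have K: "?K \<subseteq> fst c" using c sub by auto
  have contH: "continuous_on UNIV (\<lambda>p. H (fst p) (snd p))"
    using smooth_on_imp_continuous_on[OF smH] by (simp add: case_prod_beta')
  have maps: "H t (snd c q) \<in> snd c ` fst c" "?\<Gamma> t q \<in> fst c" "snd c (?\<Gamma> t q) = H t (snd c q)"
    if "t \<in> J" "q \<in> fst c" for t q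
    by (rule chart_lift_maps[OF c sub H(1)[OF that(1)] H(2)[OF that(1)] that(2)]; assumption)+
  have c1: "continuous_on (J \<times> fst c) (\<lambda>(t, x). ?\<Gamma> t x)"
  proof -
    have 1: "continuous_on (J \<times> fst c) (\<lambda>p. (fst p, snd c (snd p)))"
      by (intro continuous_on_Pair continuous_on_fst continuous_on_id
          continuous_on_compose2[OF chart_continuous_on(1)[OF c] continuous_on_snd[OF continuous_on_id]]) auto
    have 2: "continuous_on (J \<times> fst c) (\<lambda>p. H (fst p) (snd c (snd p)))"
      using continuous_on_compose2[OF contH 1] by simp
    have "continuous_on (J \<times> fst c) (\<lambda>p. chart_inv c (H (fst p) (snd c (snd p))))"
      by (rule continuous_on_compose2[OF chart_continuous_on(2)[OF c] 2]) (use maps(1) in force)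
    then show ?thesis
      by (rule continuous_on_eq) (auto simp: chart_lift_def)
  qed
  have c2: "continuous_on (J \<times> - ?K) (\<lambda>(t, x). ?\<Gamma> t x)"
    by (rule continuous_on_eq[OF continuous_on_snd[OF continuous_on_id]]) (use id in auto)
  have "J \<times> UNIV = J \<times> fst c \<union> J \<times> - ?K" using K by blast
  then have "continuous_on (J \<times> UNIV) (\<lambda>(t, x). ?\<Gamma> t x)"
    using continuous_on_open_Un[OF open_Times[OF J chart_openD(1)[OF c]] open_Times[OF J oK] c1 c2] by simp
  moreover have "smooth_on (rep_domain J d d' ?\<Gamma>) (\<lambda>(t, y). snd d' (?\<Gamma> t (chart_inv d y)))"
    if d: "d \<in> A" "d' \<in> A" for d d'
  proof (rule smooth_on_local)
    fix p assume "p \<in> rep_domain J d d' ?\<Gamma>"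
    then obtain t q where p: "p = (t, snd d q)" "t \<in> J" "q \<in> fst d" "?\<Gamma> t q \<in> fst d'"
      using d by (auto simp: rep_domain_def)
    let ?f = "\<lambda>(t, y). snd d' (?\<Gamma> t (chart_inv d y))"
    note si = smooth_map_ident
    show "\<exists>T g. open T \<and> p \<in> T \<and> smooth_on T g \<and> (\<forall>z\<in>T. g z = ?f z)"
    proof (cases "q \<in> fst c")
      case True
      let ?W = "snd d ` (fst d \<inter> (\<lambda>x. x) -` fst c)" and ?V = "snd c ` (fst c \<inter> (\<lambda>x. x) -` fst d')"
      let ?G = "\<lambda>p. H (fst p) (chart_rep d c (\<lambda>x. x) (snd p))"
      have oW: "open ?W" by (rule open_chart_rep_domain[OF si d(1) c])
      have oV: "open ?V" by (rule open_chart_rep_domain[OF si c d(2)])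
      have oJW: "open (J \<times> ?W)" using J oW by (rule open_Times)
      have "smooth_on (J \<times> ?W) (\<lambda>p. (fst p, chart_rep d c (\<lambda>x. x) (snd p)))"
        by (intro smooth_on_Pair oJW smooth_on_bounded_linear bounded_linear_fst
            smooth_on_compose[OF oJW oW _ smooth_on_bounded_linear[OF bounded_linear_snd oJW]
              smooth_on_chart_rep[OF si d(1) c]]) auto
      from smooth_on_compose[OF oJW open_UNIV _ this smH]
      have sG: "smooth_on (J \<times> ?W) ?G" by simp
      let ?T = "J \<times> ?W \<inter> ?G -` ?V"
      have oT: "open ?T"
        by (rule continuous_open_preimage[OF smooth_on_imp_continuous_on[OF sG] oJW oV])
      have sT: "smooth_on ?T (\<lambda>p. chart_rep c d' (\<lambda>x. x) (?G p))"
        by (rule smooth_on_compose[OF oT oV _ smooth_on_subset[OF sG] smooth_on_chart_rep[OF si c d(2)]]) auto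
      have "?G p \<in> ?V"
      proof (rule image_eqI)
        show "?G p = snd c (?\<Gamma> t q)" using p d True maps(3)[OF p(2) True] by (simp add: chart_rep_def)
        show "?\<Gamma> t q \<in> fst c \<inter> (\<lambda>x. x) -` fst d'" using maps(2)[OF p(2) True] p(4) by simp
      qed
      then have pT: "p \<in> ?T" using p True by auto
      have "chart_rep c d' (\<lambda>x. x) (?G z) = ?f z" if zT: "z \<in> ?T" for z
      proof -
        obtain s x where z: "z = (s, snd d x)" "s \<in> J" "x \<in> fst d" "x \<in> fst c"
          using zT by auto
        then show ?thesis using d by (simp add: chart_rep_def chart_lift_def)
      qed
      then show ?thesis using oT pT sT by blast
    next
      case False
      then have q: "q \<notin> ?K" using K by blast
      let ?W = "snd d ` (fst d \<inter> (fst d' \<inter> - ?K))"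
      have oW: "open ?W" by (intro open_chart_image d open_Int chart_openD oK)
      have oJW: "open (J \<times> ?W)" using J oW by (rule open_Times)
      have "smooth_on (J \<times> ?W) (\<lambda>p. chart_rep d d' (\<lambda>x. x) (snd p))"
        by (rule smooth_on_compose[OF oJW oW _ smooth_on_bounded_linear[OF bounded_linear_snd oJW]
              smooth_on_subset[OF smooth_on_chart_rep[OF si d]]]) auto
      moreover have "p \<in> J \<times> ?W" using p q id[OF p(2) q] by auto
      moreover have "chart_rep d d' (\<lambda>x. x) (snd z) = ?f z" if zT: "z \<in> J \<times> ?W" for z
      proof -
        obtain s x where z: "z = (s, snd d x)" "s \<in> J" "x \<in> fst d" "x \<notin> ?K"
          using zT by auto
        then show ?thesis using d id[OF z(2,4)] by (simp add: chart_rep_def)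
      qed
      ultimately show ?thesis using oJW by blast
    qed
  qed
  ultimately show ?thesis by (simp add: jointly_smooth_def)
qed

end

context symplectic_manifold
begin

lemma Diff_plus_compose:
  assumes \<phi>: "\<phi> \<in> Diff_plus A \<mu>" and \<psi>: "\<psi> \<in> Diff_plus A \<mu>"
  shows "(\<lambda>x. \<psi> (\<phi> x)) \<in> Diff_plus A \<mu>"
proof -
  note d = diffeomorphismD[OF Diff_plusD[OF \<phi>]] and e = diffeomorphismD[OF Diff_plusD[OF \<psi>]]
  have "diffeomorphism A (\<psi> \<circ> \<phi>)"
    unfolding diffeomorphism_def
    using d e by (auto simp: o_inv_distrib intro: bij_comp smooth_map_compose)
  moreover have "\<mu> (\<psi> (\<phi> p)) (\<lambda>i. tangent_map A (\<psi> \<circ> \<phi>) (vs i)) > 0"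
    if vs: "\<forall>i. vs i \<in> tangent_space A p" and pos: "\<mu> p vs > 0" for p vs
    unfolding tangent_map_compose[OF e(2)]
    by (intro Diff_plus_pos[OF \<psi>] Diff_plus_pos[OF \<phi>] tangent_map_in d pos) (use vs in auto)
  ultimately show ?thesis by (simp add: Diff_plus_def o_def)
qed

text \<open>A continuous function without zeros keeps its sign on a connected set, here a ball in
  coordinates.\<close>

lemma volume_density_same_sign:
  assumes c: "c \<in> A" and sub: "ball y0 r \<subseteq> snd c ` fst c" and y: "y \<in> ball y0 r" "z \<in> ball y0 r"
  shows "0 < \<mu> (chart_inv c y) (coord_frame A c (chart_inv c y))
           * \<mu> (chart_inv c z) (coord_frame A c (chart_inv c z))"
proof -
  let ?h = "\<lambda>y. \<mu> (chart_inv c y) (coord_frame A c (chart_inv c y))"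
  have "continuous_on (ball y0 r) ?h"
    using smooth_on_imp_continuous_on[OF smooth_on_top_form[OF volume_form_top_form c]] sub
    by (rule continuous_on_subset)
  then have "connected (?h ` ball y0 r)"
    by (rule connected_continuous_image) (simp add: convex_connected)
  then have iv: "\<And>a b x. a \<in> ?h ` ball y0 r \<Longrightarrow> b \<in> ?h ` ball y0 r \<Longrightarrow> a \<le> x \<Longrightarrow> x \<le> b \<Longrightarrow> x \<in> ?h ` ball y0 r"
    unfolding connected_iff_interval by blast
  have nz: "?h x \<noteq> 0" if "x \<in> ball y0 r" for x
    using volume_form_frame_nonzero[OF c] chart_inv_in[OF c] sub that by blast
  have "0 \<notin> ?h ` ball y0 r"
  proof
    assume "0 \<in> ?h ` ball y0 r"
    then obtain x where "x \<in> ball y0 r" "0 = ?h x" by (rule imageE)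
    then show False using nz[of x] by simp
  qed
  then have "\<not> (?h y \<le> 0 \<and> 0 \<le> ?h z)" "\<not> (?h z \<le> 0 \<and> 0 \<le> ?h y)"
    using iv[of "?h y" "?h z" 0] iv[of "?h z" "?h y" 0] y by blast+
  then show ?thesis by (auto simp: zero_less_mult_iff not_le)
qed

text \<open>In the chart the differential has positive determinant, and the coefficient of \<mu> has
  one sign on the ball, which the shear preserves; so positive frames stay positive. The bound on t
  is the contraction condition with derivative bound 4 r.\<close>

lemma chart_lift_shear_Diff_plus:
  fixes i :: 'm
  assumes c: "c \<in> A" and r: "r > 0" and sub: "cball y0 r \<subseteq> snd c ` fst c" and t: "\<bar>t\<bar> * (4 * r) < 1"
  defines "H \<equiv> shear (ball_bump y0 r) (axis i 1)"
  shows "chart_lift c (H t) \<in> Diff_plus A \<mu>"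
    "y \<notin> ball y0 r \<Longrightarrow> H t y = y" "y \<in> ball y0 r \<Longrightarrow> H t y \<in> ball y0 r"
proof -
  let ?b = "ball_bump y0 r" and ?e = "axis i 1 :: real^'m::_" and ?\<Gamma> = "chart_lift c (H t)"
  let ?b' = "\<lambda>y. frechet_derivative ?b (at y)"
  obtain R where R: "smooth_on UNIV R" "\<And>y. R (H t y) = y" "\<And>z. H t (R z) = z"
    "\<And>y. 1 + t * ?b' y ?e > 0"
    unfolding H_def
    by (rule shear_inverse[OF smooth_on_ball_bump frechet_derivative_ball_bump_le[OF r] _ t, of ?e]) auto
  have H1: "H t y = y" if "y \<notin> ball y0 r" for y
    using ball_bump_eq_0[OF r that] by (simp add: H_def shear_def)
  \<comment> \<open>A point of the ball sent outside would share its image with the fixed point it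
    lands on, against injectivity.\<close>
  have H2: "H t y \<in> ball y0 r" if "y \<in> ball y0 r" for y
  proof (rule ccontr)
    assume "H t y \<notin> ball y0 r"
    then have "H t (H t y) = H t y" using H1 by blast
    then have "H t y = y" using R(2) by metis
    then show False using that \<open>H t y \<notin> ball y0 r\<close> by simp
  qed
  show "H t y = y" if "y \<notin> ball y0 r" using H1 that .
  show "H t y \<in> ball y0 r" if "y \<in> ball y0 r" using H2 that .
  have R1: "R y = y" if "y \<notin> ball y0 r" for y using H1[OF that] R(2) by metis
  have R2: "R y \<in> ball y0 r" if "y \<in> ball y0 r" for y
    using H1[of "R y"] R(3)[of y] that by metis
  \<comment> \<open>The families constant in the parameter \<open>s\<close> make the result on
    jointly smooth lifts applicable to a single map and to its inverse.\<close>
  have smH: "smooth_on UNIV (H t)" "smooth_on UNIV (\<lambda>(s::real, y). H t y)" "smooth_on UNIV (\<lambda>(s::real, y). R y)"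
  proof -
    have "smooth_on UNIV (\<lambda>y. (\<lambda>(t, y). shear ?b ?e t y) (t, y))"
      by (rule smooth_on_compose[OF open_UNIV open_UNIV UNIV_I
            smooth_on_Pair[OF open_UNIV smooth_on_const smooth_on_ident[OF open_UNIV]]
            smooth_on_shear[OF smooth_on_ball_bump]])
    then show sm: "smooth_on UNIV (H t)" by (simp add: H_def)
    have *: "smooth_on UNIV (\<lambda>p::real \<times> _. f (snd p))" if "smooth_on UNIV (f :: real^'m::_ \<Rightarrow> real^'m::_)" for f
      by (rule smooth_on_compose[OF open_UNIV open_UNIV _ smooth_on_bounded_linear[OF bounded_linear_snd open_UNIV] that]) simp
    show "smooth_on UNIV (\<lambda>(s::real, y). H t y)" "smooth_on UNIV (\<lambda>(s::real, y). R y)"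
      using *[OF sm] *[OF R(1)] by (simp_all add: case_prod_beta')
  qed
  have sm: "smooth_map A ?\<Gamma>"
    by (rule jointly_smooth_imp_smooth_map[OF jointly_smooth_chart_lift[OF c sub open_UNIV smH(2)] open_UNIV UNIV_I])
      (use H1 H2 in auto)
  have smR: "smooth_map A (chart_lift c R)"
    by (rule jointly_smooth_imp_smooth_map[OF jointly_smooth_chart_lift[OF c sub open_UNIV smH(3)] open_UNIV UNIV_I])
      (use R1 R2 in auto)
  have inv: "chart_lift c R (?\<Gamma> q) = q" "?\<Gamma> (chart_lift c R q) = q" for q
    by (rule chart_lift_inverse[OF c sub]; use H1 H2 R1 R2 R in blast)+
  have bij: "bij ?\<Gamma>" by (rule o_bij[of "chart_lift c R"]) (auto simp: inv)
  have "inv ?\<Gamma> = chart_lift c R" by (rule inv_equality) (simp_all add: inv)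
  then have diff: "diffeomorphism A ?\<Gamma>" using bij sm smR by (simp add: diffeomorphism_def)
  have "\<mu> (?\<Gamma> p) (\<lambda>i. tangent_map A ?\<Gamma> (vs i)) > 0"
    if vs: "\<And>i. vs i \<in> tangent_space A p" and pos: "\<mu> p vs > 0" for p vs
  proof (cases "p \<in> fst c")
    case True
    let ?y = "snd c p"
    have maps: "?\<Gamma> p \<in> fst c" "snd c (?\<Gamma> p) = H t ?y"
      by (rule chart_lift_maps[OF c sub H1 H2 True]; assumption)+
    have inS: "?y \<in> snd c ` fst c" using True by simp
    define us where "us i = vcomp A c p (vs i)" for i
    have vs': "vs = (\<lambda>i. coord_vec A c p (us i))"
      using coord_vec_vcomp[OF c True vs] by (simp add: us_def)
    let ?d = "det (\<chi> i. us i)"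
    \<comment> \<open>Both values of \<mu> contain the same coordinate determinant
      \<open>?d\<close>. This reduces orientation to the sign of a Jacobian and a comparison of two
      frame values.\<close>
    have 1: "\<mu> p vs = ?d * \<mu> p (coord_frame A c p)"
      using alt_multilinear_rows[OF alt_multilinear_top_form[OF volume_form_top_form c True], of "\<chi> i. us i"]
      by (simp add: row_def vs' coord_frame_def[abs_def])
    have lin: "linear (chart_deriv c c ?\<Gamma> p)" by (rule linear_chart_deriv[OF sm c c True maps(1)])
    have tm: "tangent_map A ?\<Gamma> (coord_vec A c p u) = coord_vec A c (?\<Gamma> p) (chart_deriv c c ?\<Gamma> p u)" for u
      by (rule tangent_map_coord_vec[OF sm c c True maps(1)])
    have "\<mu> (?\<Gamma> p) (\<lambda>i. tangent_map A ?\<Gamma> (vs i))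
        = ?d * \<mu> (?\<Gamma> p) (\<lambda>i. coord_vec A c (?\<Gamma> p) (chart_deriv c c ?\<Gamma> p (axis i 1)))"
      using alt_multilinear_rows[OF alt_multilinear_compose[OF
          alt_multilinear_top_form[OF volume_form_top_form c maps(1)] lin], of "\<chi> i. us i"]
      by (simp add: row_def vs' tm)
    also have "\<dots> = ?d * (det (matrix (chart_deriv c c ?\<Gamma> p)) * \<mu> (?\<Gamma> p) (coord_frame A c (?\<Gamma> p)))"
      using alt_multilinear_axes[OF alt_multilinear_top_form[OF volume_form_top_form c maps(1)],
          of "chart_deriv c c ?\<Gamma> p"] by (simp add: coord_frame_def[abs_def])
    finally have 2: "\<mu> (?\<Gamma> p) (\<lambda>i. tangent_map A ?\<Gamma> (vs i))
        = ?d * (det (matrix (chart_deriv c c ?\<Gamma> p)) * \<mu> (?\<Gamma> p) (coord_frame A c (?\<Gamma> p)))" .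
    have "chart_deriv c c ?\<Gamma> p = frechet_derivative (H t) (at ?y)"
      unfolding chart_deriv_def
    proof (rule frechet_derivative_transform_within_open[symmetric])
      show "H t differentiable (at ?y)" by (rule smooth_on_imp_differentiable[OF smH(1)]) simp
      show "H t z = chart_rep c c ?\<Gamma> z" if "z \<in> snd c ` fst c" for z
      proof -
        have "snd c (?\<Gamma> (chart_inv c z)) = H t (snd c (chart_inv c z))"
          by (rule chart_lift_maps(3)[OF c sub H1 H2 chart_inv_in[OF c that]]; assumption)
        then show ?thesis using c that by (simp add: chart_rep_def)
      qed
    qed (use chart_openD(2)[OF c] True in auto)
    also have "\<dots> = (\<lambda>v. v + (t * ?b' ?y v) *\<^sub>R ?e)"
      unfolding H_def by (rule frechet_derivative_at[OF has_derivative_shear[OF smooth_on_ball_bump], symmetric])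
    finally have cd: "chart_deriv c c ?\<Gamma> p = (\<lambda>v. v + (t * ?b' ?y v) *\<^sub>R ?e)" .
    \<comment> \<open>The derivative adds a multiple of \<open>axis i 1\<close>, so only row i of
      the matrix differs from the identity.\<close>
    have "matrix (chart_deriv c c ?\<Gamma> p) = (\<chi> k. if k = i then axis i 1 + (\<chi> j. t * ?b' ?y (axis j 1)) else axis k 1)"
      by (auto simp: matrix_def cd vec_eq_iff axis_def)
    then have det: "det (matrix (chart_deriv c c ?\<Gamma> p)) > 0"
      using R(4)[of ?y] by (simp add: det_one_plus_row)
    have "0 < \<mu> p (coord_frame A c p) * \<mu> (?\<Gamma> p) (coord_frame A c (?\<Gamma> p))"
    proof (cases "?y \<in> ball y0 r")
      case True
      have "ball y0 r \<subseteq> snd c ` fst c" using sub ball_subset_cball by blast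
      note sgn = volume_density_same_sign[OF c this True H2[OF True]]
      have "chart_inv c ?y = p" "chart_inv c (H t ?y) = ?\<Gamma> p"
        using c \<open>p \<in> fst c\<close> by (simp_all add: chart_lift_def)
      with sgn show ?thesis by (simp only:)
    next
      case False
      then have "?\<Gamma> p = p" using H1 c \<open>p \<in> fst c\<close> by (simp add: chart_lift_def)
      then show ?thesis using volume_form_frame_nonzero[OF c \<open>p \<in> fst c\<close>] by (simp add: zero_less_mult_iff) linarith
    qed
    then show ?thesis
      using pos det unfolding 1 2 by (auto simp: zero_less_mult_iff mult_less_0_iff)
  next
    case False
    \<comment> \<open>Here the lift is the identity on a whole neighbourhood of \<open>p\<close>,
      off the compact ball, so its differential at \<open>p\<close> is the identity too.\<close>
    obtain d where d: "d \<in> A" "p \<in> fst d" using chart_cover .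
    have K: "chart_inv c ` cball y0 r \<subseteq> fst c" using c sub by auto
    have pK: "p \<notin> chart_inv c ` cball y0 r" using K False by blast
    have id: "?\<Gamma> q = q" if "q \<notin> chart_inv c ` cball y0 r" for q
      by (rule chart_lift_eq_ident[OF c H1 that])
    have oK: "open (- (chart_inv c ` cball y0 r))"
      using compact_chart_inv[OF c compact_cball sub] compact_imp_closed by blast
    have \<Gamma>p: "?\<Gamma> p = p" using id[OF pK] .
    have "chart_deriv d d ?\<Gamma> p = frechet_derivative (\<lambda>z. z) (at (snd d p))"
      unfolding chart_deriv_def
      by (rule frechet_derivative_transform_within_open[symmetric, OF _ open_chart_image[OF d(1) oK]])
        (use d pK id in \<open>auto simp: chart_rep_def\<close>)
    then have "tangent_map A ?\<Gamma> (coord_vec A d p u) = coord_vec A d p u" for u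
      using tangent_map_coord_vec[OF sm d(1,1) d(2), of u] d \<Gamma>p by simp
    then have "tangent_map A ?\<Gamma> (vs i) = vs i" for i
      using vs[of i] tangent_space_eq[OF d] by auto
    then show ?thesis using pos \<Gamma>p by simp
  qed
  then show "?\<Gamma> \<in> Diff_plus A \<mu>" using diff by (simp add: Diff_plus_def)
qed

text \<open>The path is the lifted shear composed with \<phi>. Points whose image lies outside the
  chart stay at rest, and there the field is zero.\<close>

lemma path_with_velocity:
  assumes \<phi>: "\<phi> \<in> Diff_plus A \<mu>" and c: "c \<in> A" and r: "r > 0" and sub: "cball y0 r \<subseteq> snd c ` fst c"
  obtains \<gamma> where "smooth_path_Diff A \<mu> \<gamma>" "\<gamma> 0 = \<phi>"
    "has_velocity_Diff A \<gamma> (chart_field A c (ball_bump y0 r) (axis i 1) \<circ> \<phi>)"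
proof -
  let ?b = "ball_bump y0 r" and ?e = "axis i 1 :: real^'m::_"
  \<comment> \<open>Then |t| * 4 r \<le> 4 r / (4 r + 1) < 1, the contraction condition for the bump
    of radius r.\<close>
  let ?\<epsilon> = "1 / (4 * r + 1)"
  let ?J = "{-?\<epsilon><..<?\<epsilon>}"
  let ?\<Gamma> = "\<lambda>t. chart_lift c (shear ?b ?e t)"
  define \<gamma> where "\<gamma> t x = ?\<Gamma> t (\<phi> x)" for t x
  have t: "\<bar>t\<bar> * (4 * r) < 1" if "t \<in> ?J" for t
  proof -
    have "\<bar>t\<bar> * (4 * r) \<le> ?\<epsilon> * (4 * r)" using that r by (intro mult_right_mono) auto
    also have "\<dots> < 1" using r by (simp add: field_simps)
    finally show ?thesis .
  qed
  have js: "jointly_smooth A ?J ?\<Gamma>"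
    by (rule jointly_smooth_chart_lift[OF c sub _ smooth_on_shear[OF smooth_on_ball_bump]])
      (use chart_lift_shear_Diff_plus(2,3)[OF c r sub t] in auto)
  have "jointly_smooth A ?J \<gamma>"
    unfolding \<gamma>_def[abs_def]
    by (rule jointly_smooth_compose[OF js _ diffeomorphismD(2)[OF Diff_plusD[OF \<phi>]]]) simp
  moreover have "\<gamma> t \<in> Diff_plus A \<mu>" if "t \<in> ?J" for t
    unfolding \<gamma>_def[abs_def] by (rule Diff_plus_compose[OF \<phi> chart_lift_shear_Diff_plus(1)[OF c r sub t[OF that]]])
  moreover have "?\<epsilon> > 0" using r by simp
  ultimately have "smooth_path_Diff A \<mu> \<gamma>"
    unfolding smooth_path_Diff_def jointly_smooth_def rep_domain_def by blast
  moreover have "\<gamma> 0 = \<phi>"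
    using c by (auto simp: \<gamma>_def chart_lift_def shear_def fun_eq_iff)
  moreover have "has_velocity_Diff A \<gamma> (chart_field A c ?b ?e \<circ> \<phi>)"
    unfolding has_velocity_Diff_def
  proof (intro allI ballI)
    fix x f assume f: "f \<in> C_inf A"
    let ?q = "\<phi> x"
    show "((\<lambda>t. f (\<gamma> t x)) has_real_derivative (chart_field A c ?b ?e \<circ> \<phi>) x f) (at 0)"
    proof (cases "?q \<in> fst c")
      case True
      let ?y = "snd c ?q"
      have 1: "((\<lambda>t. shear ?b ?e t ?y) has_derivative (\<lambda>t. (t * ?b ?y) *\<^sub>R ?e)) (at 0)"
        unfolding shear_def by (auto intro!: derivative_eq_intros)
      have 2: "(f \<circ> chart_inv c has_derivative frechet_derivative (f \<circ> chart_inv c) (at ?y)) (at (shear ?b ?e 0 ?y))"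
        using smooth_on_imp_has_derivative[OF C_infD[OF f c]] True by (simp add: shear_def)
      have lin: "linear (frechet_derivative (f \<circ> chart_inv c) (at ?y))"
        using 2 has_derivative_linear by blast
      have "((\<lambda>t. f (\<gamma> t x)) has_derivative (\<lambda>t. frechet_derivative (f \<circ> chart_inv c) (at ?y) ((t * ?b ?y) *\<^sub>R ?e))) (at 0)"
        using has_derivative_compose[OF 1 2] True by (simp add: \<gamma>_def chart_lift_def)
      moreover have "(\<lambda>t. frechet_derivative (f \<circ> chart_inv c) (at ?y) ((t * ?b ?y) *\<^sub>R ?e))
          = (*) ((chart_field A c ?b ?e \<circ> \<phi>) x f)"
        using True f by (auto simp: fun_eq_iff chart_field_def coord_vec_def linear_scale[OF lin])
      ultimately show ?thesis by (simp add: has_field_derivative_def)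
    next
      case False
      then show ?thesis by (simp add: \<gamma>_def chart_lift_def chart_field_def)
    qed
  qed
  ultimately show thesis using that by blast
qed

end


section \<open>Hamiltonian vectors on the diffeomorphism group\<close>

context smooth_manifold
begin

text \<open>The time derivative of f(\<gamma> t x) is continuous in (t, x) in coordinates, hence
  bounded on a product neighbourhood of (0, x0); the mean value inequality in t then gives a bound
  uniform in x.\<close>

lemma jointly_smooth_local_Lipschitz:
  assumes \<gamma>: "jointly_smooth A J \<gamma>" and J: "open J" "0 \<in> J" and f: "f \<in> C_inf A"
  shows "\<exists>V \<delta> C. open V \<and> x0 \<in> V \<and> 0 < \<delta> \<and>
    (\<forall>x\<in>V. \<forall>t. \<bar>t\<bar> < \<delta> \<longrightarrow> \<bar>f (\<gamma> t x) - f (\<gamma> 0 x)\<bar> \<le> C * \<bar>t\<bar>)"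
proof -
  obtain c where c: "c \<in> A" "x0 \<in> fst c" using chart_cover .
  obtain d where d: "d \<in> A" "\<gamma> 0 x0 \<in> fst d" using chart_cover .
  let ?D = "rep_domain J c d \<gamma>" and ?p0 = "(0::real, snd c x0)"
  have oD: "open ?D" by (rule open_rep_domain[OF \<gamma> J(1) c(1) d(1)])
  have p0: "?p0 \<in> ?D" using c d J by (auto simp: rep_domain_def)
  define w where "w p = (f \<circ> chart_inv d) ((\<lambda>(t, y). snd d (\<gamma> t (chart_inv c y))) p)" for p
  have sw: "smooth_on ?D w"
    unfolding w_def[abs_def]
    by (rule smooth_on_compose[OF oD chart_openD(2)[OF d(1)] _ jointly_smoothD(2)[OF \<gamma> c(1) d(1)] C_infD[OF f d(1)]])
      (auto simp: rep_domain_def)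
  have w: "w (t, y) = f (\<gamma> t (chart_inv c y))" if "(t, y) \<in> ?D" for t y
    using that d by (auto simp: w_def rep_domain_def)
  define w' where "w' p = frechet_derivative w (at p) (1, 0)" for p
  have "continuous_on ?D w'"
    unfolding w'_def[abs_def] by (rule smooth_on_imp_continuous_on[OF smooth_on_frechet_derivative[OF sw]])
  from continuous_open_preimage[OF this oD open_ball]
  have "open (?D \<inter> w' -` ball (w' ?p0) 1)" .
  then obtain P W where PW: "open P" "open W" "?p0 \<in> P \<times> W" "P \<times> W \<subseteq> ?D \<inter> w' -` ball (w' ?p0) 1"
    using p0 by (elim open_prod_elim[where x="?p0"]) auto
  obtain \<delta> where \<delta>: "0 < \<delta>" "ball 0 \<delta> \<subseteq> P"
    using PW(1,3) open_contains_ball by (metis mem_Sigma_iff)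
  \<comment> \<open>On the product neighbourhood \<open>w'\<close> stays within distance 1 of its
    value at the centre, hence the added 1.\<close>
  define C where "C = \<bar>w' ?p0\<bar> + 1"
  have bound: "\<bar>f (\<gamma> t x) - f (\<gamma> 0 x)\<bar> \<le> C * \<bar>t\<bar>" if x: "x \<in> fst c" "snd c x \<in> W" and t: "\<bar>t\<bar> < \<delta>" for x t
  proof -
    let ?y = "snd c x"
    have inD: "(s, ?y) \<in> ?D" "\<bar>w' (s, ?y)\<bar> \<le> C" if "s \<in> ball 0 \<delta>" for s
    proof -
      have "(s, ?y) \<in> P \<times> W" using that \<delta>(2) x(2) by auto
      then have *: "(s, ?y) \<in> ?D" "dist (w' ?p0) (w' (s, ?y)) < 1" using PW(4) by auto
      show "(s, ?y) \<in> ?D" by (rule *(1))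
      show "\<bar>w' (s, ?y)\<bar> \<le> C" using *(2) by (auto simp: dist_real_def C_def)
    qed
    have der: "((\<lambda>s. w (s, ?y)) has_field_derivative w' (s, ?y)) (at s within ball 0 \<delta>)" if "s \<in> ball 0 \<delta>" for s
    proof -
      have dw: "(w has_derivative frechet_derivative w (at (s, ?y))) (at (s, ?y))"
        by (rule smooth_on_imp_has_derivative[OF sw inD(1)[OF that]])
      have lin: "linear (frechet_derivative w (at (s, ?y)))" using dw has_derivative_linear by blast
      have "((\<lambda>s. (s, ?y)) has_derivative (\<lambda>h. (h, 0))) (at s)"
        by (auto intro!: derivative_eq_intros)
      from has_derivative_compose[OF this dw]
      have "((\<lambda>s. w (s, ?y)) has_derivative (\<lambda>h. frechet_derivative w (at (s, ?y)) (h, 0))) (at s)" .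
      moreover have "frechet_derivative w (at (s, ?y)) (h, 0) = w' (s, ?y) * h" for h
        using linear_scale[OF lin, of h "(1, 0)"] by (simp add: w'_def mult.commute)
      ultimately have "((\<lambda>s. w (s, ?y)) has_field_derivative w' (s, ?y)) (at s)"
        by (simp add: has_field_derivative_def)
      then show ?thesis by (rule has_field_derivative_at_within)
    qed
    have "norm (w (t, ?y) - w (0, ?y)) \<le> C * norm (t - 0)"
      by (rule field_differentiable_bound[OF convex_ball[of 0 \<delta>] der])
        (use inD(2) t \<delta>(1) in auto)
    then show ?thesis
      using w[OF inD(1)[of t]] w[OF inD(1)[of 0]] t \<delta>(1) c x by simp
  qed
  have "open (fst c \<inter> snd c -` W)" by (rule open_chart_preimage[OF c(1) PW(2)])
  moreover have "x0 \<in> fst c \<inter> snd c -` W" using c PW(3) by auto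
  ultimately show ?thesis
    using \<delta>(1) bound
    by (intro exI[of _ "fst c \<inter> snd c -` W"] exI[of _ \<delta>] exI[of _ C]) auto
qed

end

context compact_manifold
begin

text \<open>Compactness reduces the local bounds to finitely many, leaving a least time span and a
  largest constant. That constant will dominate the difference quotients under the integral.\<close>

lemma jointly_smooth_Lipschitz:
  assumes \<gamma>: "jointly_smooth A J \<gamma>" and J: "open J" "0 \<in> J" and f: "f \<in> C_inf A"
  obtains \<delta> C where "0 < \<delta>" "\<And>x t. \<bar>t\<bar> < \<delta> \<Longrightarrow> \<bar>f (\<gamma> t x) - f (\<gamma> 0 x)\<bar> \<le> C * \<bar>t\<bar>"
proof -
  have "\<forall>x0. \<exists>V \<delta> C. open V \<and> x0 \<in> V \<and> 0 < \<delta> \<and>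
    (\<forall>x\<in>V. \<forall>t. \<bar>t\<bar> < \<delta> \<longrightarrow> \<bar>f (\<gamma> t x) - f (\<gamma> 0 x)\<bar> \<le> C * \<bar>t\<bar>)"
    using jointly_smooth_local_Lipschitz[OF \<gamma> J f] by blast
  then obtain V \<delta> C where V: "\<And>x0. open (V x0)" "\<And>x0. x0 \<in> V x0" "\<And>x0. 0 < \<delta> x0"
    "\<And>x0 x t. x \<in> V x0 \<Longrightarrow> \<bar>t\<bar> < \<delta> x0 \<Longrightarrow> \<bar>f (\<gamma> t x) - f (\<gamma> 0 x)\<bar> \<le> C x0 * \<bar>t\<bar>"
    by metis
  have "UNIV \<subseteq> (\<Union>x\<in>UNIV. V x)" using V(2) by blast
  then obtain T where T: "finite T" "UNIV \<subseteq> (\<Union>x\<in>T. V x)"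
    using compactE_image[OF compact_UNIV, of UNIV V] V(1) by metis
  have ne: "T \<noteq> {}" using T(2) by auto
  show thesis
  proof (rule that[of "Min (\<delta> ` T)" "Max (C ` T)"])
    show "0 < Min (\<delta> ` T)" using T(1) ne V(3) by simp
  next
    fix x t assume t: "\<bar>t\<bar> < Min (\<delta> ` T)"
    have "x \<in> (\<Union>x\<in>T. V x)" using T(2) by blast
    then obtain x0 where x0: "x0 \<in> T" "x \<in> V x0" by blast
    have "Min (\<delta> ` T) \<le> \<delta> x0" "C x0 \<le> Max (C ` T)" using T(1) x0(1) by auto
    then have "\<bar>f (\<gamma> t x) - f (\<gamma> 0 x)\<bar> \<le> C x0 * \<bar>t\<bar>" "C x0 * \<bar>t\<bar> \<le> Max (C ` T) * \<bar>t\<bar>"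
      using V(4)[OF x0(2), of t] t by (auto intro: mult_right_mono)
    then show "\<bar>f (\<gamma> t x) - f (\<gamma> 0 x)\<bar> \<le> Max (C ` T) * \<bar>t\<bar>" by linarith
  qed
qed

end

context symplectic_manifold
begin

section \<open>The differential of the pulled back functionals\<close>

lemma lin_functional_proj_Dens:
  assumes "\<phi> \<in> Diff_plus A \<mu>" "continuous_on UNIV f"
  shows "lin_functional A f (proj_Dens A \<mu> \<phi>) = vol_integral A \<mu> (\<lambda>x. f (\<phi> x))"
  unfolding lin_functional_def proj_Dens_def
  by (rule vol_integral_push_forward[OF volume_form_top_form Diff_plusD[OF assms(1)] assms(2)])

text \<open>Dominated convergence for the difference quotients of f(\<gamma> t x), with the
  Lipschitz constant as dominating function, integrable because the total mass is finite. The limit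
  in t is tested along sequences.\<close>

lemma DERIV_lin_functional:
  assumes path: "smooth_path_Diff A \<mu> \<gamma>" and vel: "has_velocity_Diff A \<gamma> V" and f: "f \<in> C_inf A"
  shows "((\<lambda>t. lin_functional A f (proj_Dens A \<mu> (\<gamma> t))) has_real_derivative
    vol_integral A \<mu> (\<lambda>x. V x f)) (at 0)"
proof -
  let ?M = "vol_measure A \<mu>"
  obtain \<epsilon> where \<epsilon>: "0 < \<epsilon>" "\<And>t. t \<in> {-\<epsilon><..<\<epsilon>} \<Longrightarrow> \<gamma> t \<in> Diff_plus A \<mu>"
    "jointly_smooth A {-\<epsilon><..<\<epsilon>} \<gamma>"
    using path unfolding smooth_path_Diff_def jointly_smooth_def rep_domain_def by blast
  obtain \<delta> C where \<delta>: "0 < \<delta>" "\<And>x t. \<bar>t\<bar> < \<delta> \<Longrightarrow> \<bar>f (\<gamma> t x) - f (\<gamma> 0 x)\<bar> \<le> C * \<bar>t\<bar>"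
    using jointly_smooth_Lipschitz[OF \<epsilon>(3) _ _ f] \<epsilon>(1) by auto
  let ?u = "\<lambda>t x. f (\<gamma> t x)"
  have cu: "continuous_on UNIV (?u t)" if "\<bar>t\<bar> < \<epsilon>" for t
  proof -
    have "t \<in> {-\<epsilon><..<\<epsilon>}" using that by auto
    then show ?thesis
      using continuous_on_compose2[OF C_inf_continuous[OF f] smooth_map_continuous[OF
            diffeomorphismD(2)[OF Diff_plusD[OF \<epsilon>(2)]]], of t] by simp
  qed
  have F: "lin_functional A f (proj_Dens A \<mu> (\<gamma> t)) = (\<integral>x. ?u t x \<partial>?M)" if "\<bar>t\<bar> < \<epsilon>" for t
  proof -
    have "t \<in> {-\<epsilon><..<\<epsilon>}" using that by auto
    then show ?thesis
      using lin_functional_proj_Dens[OF \<epsilon>(2) C_inf_continuous[OF f], of t] by (simp add: vol_integral_def)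
  qed
  let ?F = "\<lambda>t. lin_functional A f (proj_Dens A \<mu> (\<gamma> t))"
  have "((\<lambda>t. (?F t - ?F 0) / (t - 0)) \<longlongrightarrow> vol_integral A \<mu> (\<lambda>x. V x f)) (at 0)"
    unfolding tendsto_at_iff_sequentially
  proof (intro allI impI)
    fix X :: "nat \<Rightarrow> real"
    assume X: "\<forall>i. X i \<in> UNIV - {0}" "X \<longlonglongrightarrow> 0"
    have "\<forall>\<^sub>F i in sequentially. \<bar>X i\<bar> < min \<delta> \<epsilon>"
      using tendstoD[OF X(2), of "min \<delta> \<epsilon>"] \<delta>(1) \<epsilon>(1) by (simp add: dist_real_def)
    \<comment> \<open>Continuity of the integrands and the uniform bound are known for small times,
      so the sequence is shifted past the index \<open>N\<close>.\<close>
    then obtain N where N: "\<And>i. \<bar>X (i + N)\<bar> < \<delta>" "\<And>i. \<bar>X (i + N)\<bar> < \<epsilon>"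
      unfolding eventually_sequentially by (metis le_add2 min_less_iff_conj)
    define s where "s i x = (?u (X (i + N)) x - ?u 0 x) / X (i + N)" for i x
    have X0: "X (i + N) \<noteq> 0" for i using X(1) by blast
    have cs: "continuous_on UNIV (s i)" for i
      unfolding s_def[abs_def]
      by (intro continuous_on_divide continuous_on_diff cu N continuous_on_const) (use \<epsilon>(1) X0 in auto)
    have lim: "(\<lambda>i. s i x) \<longlonglongrightarrow> V x f" for x
    proof -
      have "((\<lambda>t. ?u t x) has_real_derivative V x f) (at 0)"
        using vel f unfolding has_velocity_Diff_def by blast
      then have "((\<lambda>t. (?u t x - ?u 0 x) / (t - 0)) \<longlongrightarrow> V x f) (at 0)"
        by (simp only: has_field_derivative_iff)
      then have "((\<lambda>t. (?u t x - ?u 0 x) / (t - 0)) \<circ> X) \<longlonglongrightarrow> V x f"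
        using X unfolding tendsto_at_iff_sequentially by blast
      then show ?thesis
        unfolding s_def using LIMSEQ_ignore_initial_segment[of _ _ N] by (fastforce simp: o_def)
    qed
    have ms: "s i \<in> borel_measurable ?M" for i by (rule continuous_measurable_vol[OF cs])
    have "(\<lambda>i. \<integral>x. s i x \<partial>?M) \<longlonglongrightarrow> (\<integral>x. V x f \<partial>?M)"
    proof (rule integral_dominated_convergence[where w="\<lambda>x. C"])
      show "(\<lambda>x. V x f) \<in> borel_measurable ?M"
        by (rule borel_measurable_LIMSEQ_real[OF lim ms])
      show "integrable ?M (\<lambda>x. C)" by (rule continuous_integrable) simp
      show "AE x in ?M. norm (s i x) \<le> C" for i
      proof (rule AE_I2)
        fix x
        have "\<bar>?u (X (i + N)) x - ?u 0 x\<bar> \<le> C * \<bar>X (i + N)\<bar>" by (rule \<delta>(2)[OF N(1)])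
        then show "norm (s i x) \<le> C" using X0[of i] by (simp add: s_def abs_divide field_simps)
      qed
    qed (use lim ms in auto)
    moreover have "(\<integral>x. s i x \<partial>?M) = (?F (X (i + N)) - ?F 0) / (X (i + N) - 0)" for i
      using F[OF N(2), of i] F[of 0] \<epsilon>(1) continuous_integrable[OF cu[OF N(2)[of i]]]
        continuous_integrable[OF cu[of 0]]
      by (simp add: s_def)
    ultimately have "(\<lambda>i. ((\<lambda>t. (?F t - ?F 0) / (t - 0)) \<circ> X) (i + N)) \<longlonglongrightarrow> vol_integral A \<mu> (\<lambda>x. V x f)"
      by (simp add: vol_integral_def)
    then show "((\<lambda>t. (?F t - ?F 0) / (t - 0)) \<circ> X) \<longlonglongrightarrow> vol_integral A \<mu> (\<lambda>x. V x f)"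
      by (rule LIMSEQ_offset)
  qed
  then show ?thesis by (simp only: has_field_derivative_iff)
qed

lemma continuous_form_along:
  assumes X: "X \<in> vector_fields A" "Y \<in> vector_fields A" and \<phi>: "\<phi> \<in> Diff_plus A \<mu>"
  shows "continuous_on UNIV (\<lambda>x. \<omega> (\<phi> x) (X (\<phi> x)) (Y (\<phi> x)))"
  using continuous_on_compose2[OF C_inf_continuous[OF two_form_C_inf[OF two_form X]]
      smooth_map_continuous[OF diffeomorphismD(2)[OF Diff_plusD[OF \<phi>]]]] by simp

text \<open>Along any path with velocity Y \<circ> \<phi> the derivative is the integral of (Y f)
  \<circ> \<phi>, and \<omega>(X_f, Y) = Y f holds pointwise under the integral defining W.\<close>

lemma is_hamiltonian_hamiltonian_field:
  assumes f: "f \<in> C_inf A" and \<phi>: "\<phi> \<in> Diff_plus A \<mu>"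
  shows "is_hamiltonian_Diff A \<omega> \<mu> (lin_functional A f \<circ> proj_Dens A \<mu>) \<phi> (hamiltonian_field A \<omega> f \<circ> \<phi>)"
  unfolding is_hamiltonian_Diff_def
proof (intro conjI ballI)
  let ?X = "hamiltonian_field A \<omega> f"
  show "?X \<circ> \<phi> \<in> tangent_Diff A \<phi>"
    using hamiltonian_field(1)[OF f] by (auto simp: tangent_Diff_def)
  fix Y assume Y: "Y \<in> vector_fields A"
  have "W_form A \<omega> \<mu> \<phi> (?X \<circ> \<phi>) (Y \<circ> \<phi>) = vol_integral A \<mu> (\<lambda>x. (Y \<circ> \<phi>) x f)"
    using hamiltonian_field(2)[OF f vector_fieldD(1)[OF Y]] by (simp add: W_form_def)
  then show "has_differential_Diff A \<mu> (lin_functional A f \<circ> proj_Dens A \<mu>) \<phi> (Y \<circ> \<phi>)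
      (W_form A \<omega> \<mu> \<phi> (?X \<circ> \<phi>) (Y \<circ> \<phi>))"
    unfolding has_differential_Diff_def
  proof (intro allI impI)
    fix \<gamma> assume "smooth_path_Diff A \<mu> \<gamma> \<and> \<gamma> 0 = \<phi> \<and> has_velocity_Diff A \<gamma> (Y \<circ> \<phi>)"
    then show "((\<lambda>t. (lin_functional A f \<circ> proj_Dens A \<mu>) (\<gamma> t)) has_real_derivative
        W_form A \<omega> \<mu> \<phi> (?X \<circ> \<phi>) (Y \<circ> \<phi>)) (at 0)"
      using DERIV_lin_functional[OF _ _ f, of \<gamma> "Y \<circ> \<phi>"]
      by (simp add: \<open>W_form A \<omega> \<mu> \<phi> (?X \<circ> \<phi>) (Y \<circ> \<phi>) = _\<close>)
  qed
qed

text \<open>Only the fields \<open>\<beta> \<partial>\<^sub>i\<close> with a bump function \<open>\<beta>\<close> supported in a chart are needed as test fields,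
  and these are velocities of explicit paths, so that no flow has to be constructed.\<close>

lemma W_form_determines_field:
  assumes X: "X \<in> vector_fields A" "X' \<in> vector_fields A" and \<phi>: "\<phi> \<in> Diff_plus A \<mu>"
    and eq: "\<And>c y r i. c \<in> A \<Longrightarrow> r > 0 \<Longrightarrow> cball y r \<subseteq> snd c ` fst c \<Longrightarrow>
      W_form A \<omega> \<mu> \<phi> (X \<circ> \<phi>) (chart_field A c (ball_bump y r) (axis i 1) \<circ> \<phi>)
      = W_form A \<omega> \<mu> \<phi> (X' \<circ> \<phi>) (chart_field A c (ball_bump y r) (axis i 1) \<circ> \<phi>)"
  shows "X = X'"
proof
  fix p
  obtain c where c: "c \<in> A" "p \<in> fst c" using chart_cover .
  let ?y = "snd c p"
  obtain r0 where r0: "r0 > 0" "cball ?y r0 \<subseteq> snd c ` fst c" using chart_cball c by blast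
  have axis: "\<omega> p (X p) (coord_vec A c p (axis i 1)) = \<omega> p (X' p) (coord_vec A c p (axis i 1))" for i
  proof (rule ccontr)
    assume ne: "\<not> ?thesis"
    \<comment> \<open>Meaningful on the chart domain only. Continuity is obtained instead for
      \<open>g r\<close>, the product of \<open>k\<close> with a bump extended by zero, which is
      defined on all of M.\<close>
    define k where "k q = \<omega> q (X q) (coord_vec A c q (axis i 1)) - \<omega> q (X' q) (coord_vec A c q (axis i 1))" for q
    let ?Z = "\<lambda>r. chart_field A c (ball_bump ?y r) (axis i 1)"
    define g where "g r q = \<omega> q (X q) (?Z r q) - \<omega> q (X' q) (?Z r q)" for r q
    have g: "g r q = (if q \<in> fst c then ball_bump ?y r (snd c q) * k q else 0)" for r q
    proof (cases "q \<in> fst c")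
      case True
      show ?thesis
        using True linear_scale[OF two_form_chart(2)[OF two_form c(1) True vector_fieldD(1)[OF X(1), of q]]]
          linear_scale[OF two_form_chart(2)[OF two_form c(1) True vector_fieldD(1)[OF X(2), of q]]]
        by (simp add: g_def chart_field_def k_def algebra_simps)
    next
      case False
      have "\<omega> q v (\<lambda>f. 0) = 0" if v: "v \<in> tangent_space A q" for v
      proof -
        obtain d where d: "d \<in> A" "q \<in> fst d" using chart_cover .
        show ?thesis using linear_0[OF two_form_chart(2)[OF two_form d v]] by (simp add: coord_vec_0[OF d])
      qed
      then show ?thesis using False X vector_fieldD(1) by (simp add: g_def chart_field_def)
    qed
    have cg: "continuous_on UNIV (g r)" if "r > 0" "cball ?y r \<subseteq> snd c ` fst c" for r
    proof -
      note Z = chart_field_vector_fields[OF c(1) that, of "axis i 1"]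
      show ?thesis
        unfolding g_def[abs_def]
        by (rule continuous_on_diff[OF C_inf_continuous[OF two_form_C_inf[OF two_form X(1) Z]]
              C_inf_continuous[OF two_form_C_inf[OF two_form X(2) Z]]])
    qed
    have "k p \<noteq> 0" using ne by (simp add: k_def)
    \<comment> \<open>The factor makes s * k positive at \<open>p\<close>, so both signs are treated
      at once.\<close>
    define s where "s = sgn (k p)"
    have sk: "s * k p > 0" using \<open>k p \<noteq> 0\<close> by (simp add: s_def sgn_if)
    have b0: "ball_bump ?y r0 ?y > 0" using ball_bump_pos_iff[OF r0(1)] r0(1) by (metis centre_in_ball)
    \<comment> \<open>On this open set s * k is positive, because the bump of radius r0 is
      nonnegative. A second bump supported there then gives an integrand of constant sign.\<close>
    let ?U = "(\<lambda>q. s * g r0 q) -` {0<..}"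
    have "continuous_on UNIV (\<lambda>q. s * g r0 q)" by (intro continuous_on_mult cg[OF r0] continuous_on_const)
    then have oU: "open ?U" by (intro open_vimage) auto
    have "s * g r0 p = ball_bump ?y r0 ?y * (s * k p)" using c by (simp add: g)
    then have "s * g r0 p > 0" using mult_pos_pos[OF b0 sk] by (simp only:)
    then have pU: "p \<in> ?U" by simp
    have "?y \<in> snd c ` (fst c \<inter> ?U)" using c pU by blast
    then obtain r where r: "r > 0" "cball ?y r \<subseteq> snd c ` (fst c \<inter> ?U)"
      using open_contains_cball open_chart_image[OF c(1) oU] by blast
    have r': "cball ?y r \<subseteq> snd c ` fst c" using r(2) by blast
    let ?h = "\<lambda>x. s * g r (\<phi> x)"
    have hpos: "0 \<le> s * g r q" for q
    proof (cases "q \<in> fst c \<and> snd c q \<in> ball ?y r")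
      case True
      then have "snd c q \<in> snd c ` (fst c \<inter> ?U)" using r(2) ball_subset_cball by blast
      then obtain q' where "q' \<in> fst c" "q' \<in> ?U" "snd c q = snd c q'" by blast
      then have "q \<in> ?U" using True c by (metis chart_inv_snd)
      then have "0 < s * (ball_bump ?y r0 (snd c q) * k q)" using True by (simp add: g)
      then have "0 < ball_bump ?y r0 (snd c q) * (s * k q)" by (simp only: mult.left_commute)
      then have "0 < s * k q" using ball_bump_nonneg[of ?y r0 "snd c q"] by (simp add: zero_less_mult_iff)
      then have "0 \<le> ball_bump ?y r (snd c q) * (s * k q)"
        by (rule mult_nonneg_nonneg[OF ball_bump_nonneg less_imp_le])
      then have "0 \<le> s * (ball_bump ?y r (snd c q) * k q)" by (simp only: mult.left_commute)
      then show ?thesis using True by (simp add: g)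
    next
      case False
      then show ?thesis using ball_bump_eq_0[OF r(1), of "snd c q" ?y] by (auto simp: g)
    qed
    note d\<phi> = diffeomorphismD[OF Diff_plusD[OF \<phi>]]
    have "continuous_on UNIV (\<lambda>x. g r (\<phi> x))"
      using continuous_on_compose2[OF cg[OF r(1) r'] smooth_map_continuous[OF d\<phi>(2)]] by simp
    then have ch: "continuous_on UNIV ?h" by (intro continuous_on_mult continuous_on_const)
    have Z: "?Z r \<in> vector_fields A" by (rule chart_field_vector_fields[OF c(1) r(1) r'])
    have "vol_integral A \<mu> (\<lambda>x. g r (\<phi> x))
        = W_form A \<omega> \<mu> \<phi> (X \<circ> \<phi>) (?Z r \<circ> \<phi>) - W_form A \<omega> \<mu> \<phi> (X' \<circ> \<phi>) (?Z r \<circ> \<phi>)"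
      unfolding W_form_def vol_integral_def g_def o_def
      by (rule Bochner_Integration.integral_diff[OF
            continuous_integrable[OF continuous_form_along[OF X(1) Z \<phi>]]
            continuous_integrable[OF continuous_form_along[OF X(2) Z \<phi>]]])
    also have "\<dots> = 0" using eq[OF c(1) r(1) r'] by simp
    finally have "vol_integral A \<mu> ?h = 0" by (simp add: vol_integral_def)
    \<comment> \<open>A nonnegative continuous integrand with zero integral vanishes everywhere; the
      preimage of \<open>p\<close> under \<phi> is the point where this gives a
      contradiction.\<close>
    then have "?h (inv \<phi> p) = 0" by (rule vol_integral_eq_0_imp[OF ch hpos])
    then have "s * g r p = 0" using d\<phi>(1) by (simp add: bij_is_surj surj_f_inv_f)
    moreover have "s * g r p = ball_bump ?y r ?y * (s * k p)" using c by (simp add: g)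
    moreover have "ball_bump ?y r ?y > 0" using ball_bump_pos_iff[OF r(1)] r(1) by (metis centre_in_ball)
    ultimately show False using sk by (metis mult_pos_pos less_irrefl)
  qed
  show "X p = X' p"
  proof (rule two_form_eqI)
    fix w assume "w \<in> tangent_space A p"
    then obtain u where w: "w = coord_vec A c p u" using tangent_space_eq[OF c] by blast
    show "\<omega> p (X p) w = \<omega> p (X' p) w"
      using linear_eq_sum_axis[OF two_form_chart(2)[OF two_form c vector_fieldD(1)[OF X(1)]], of u]
        linear_eq_sum_axis[OF two_form_chart(2)[OF two_form c vector_fieldD(1)[OF X(2)]], of u]
      unfolding w axis by simp
  qed (use X vector_fieldD(1) in auto)
qed

text \<open>Both vectors prescribe the derivative of the same functional along the same explicit
  path. Derivatives are unique, so both pair equally with every test field.\<close>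

lemma hamiltonian_Diff_unique:
  assumes f: "f \<in> C_inf A" and \<phi>: "\<phi> \<in> Diff_plus A \<mu>"
    and U: "is_hamiltonian_Diff A \<omega> \<mu> (lin_functional A f \<circ> proj_Dens A \<mu>) \<phi> U"
  shows "U = hamiltonian_field A \<omega> f \<circ> \<phi>"
proof -
  let ?F = "lin_functional A f \<circ> proj_Dens A \<mu>"
  obtain X where X: "X \<in> vector_fields A" "U = X \<circ> \<phi>"
    using U by (auto simp: is_hamiltonian_Diff_def tangent_Diff_def)
  have "X = hamiltonian_field A \<omega> f"
  proof (rule W_form_determines_field[OF X(1) hamiltonian_field(1)[OF f] \<phi>])
    fix c y r i assume c: "c \<in> A" and r: "r > 0" "cball y r \<subseteq> snd c ` fst c"
    let ?Z = "chart_field A c (ball_bump y r) (axis i 1)"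
    have Z: "?Z \<in> vector_fields A" by (rule chart_field_vector_fields[OF c r])
    obtain \<gamma> where \<gamma>: "smooth_path_Diff A \<mu> \<gamma>" "\<gamma> 0 = \<phi>" "has_velocity_Diff A \<gamma> (?Z \<circ> \<phi>)"
      using path_with_velocity[OF \<phi> c r] by blast
    have "((\<lambda>t. ?F (\<gamma> t)) has_real_derivative W_form A \<omega> \<mu> \<phi> (X \<circ> \<phi>) (?Z \<circ> \<phi>)) (at 0)"
      using U \<gamma> Z unfolding is_hamiltonian_Diff_def has_differential_Diff_def X(2) by blast
    moreover have "((\<lambda>t. ?F (\<gamma> t)) has_real_derivative
        W_form A \<omega> \<mu> \<phi> (hamiltonian_field A \<omega> f \<circ> \<phi>) (?Z \<circ> \<phi>)) (at 0)"
      using is_hamiltonian_hamiltonian_field[OF f \<phi>] \<gamma> Z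
      unfolding is_hamiltonian_Diff_def has_differential_Diff_def by blast
    ultimately show "W_form A \<omega> \<mu> \<phi> (X \<circ> \<phi>) (?Z \<circ> \<phi>)
        = W_form A \<omega> \<mu> \<phi> (hamiltonian_field A \<omega> f \<circ> \<phi>) (?Z \<circ> \<phi>)"
      by (rule DERIV_unique)
  qed
  then show ?thesis by (simp add: X(2))
qed

lemma hamiltonian_Diff_eq:
  assumes "f \<in> C_inf A" "\<phi> \<in> Diff_plus A \<mu>"
  shows "hamiltonian_Diff A \<omega> \<mu> (lin_functional A f \<circ> proj_Dens A \<mu>) \<phi> = hamiltonian_field A \<omega> f \<circ> \<phi>"
  unfolding hamiltonian_Diff_def
  by (rule the_equality) (rule is_hamiltonian_hamiltonian_field[OF assms], rule hamiltonian_Diff_unique[OF assms])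

text \<open>Both sides are the integral of {f,g} \<circ> \<phi> against \<mu>: the right by change
  of variables, using continuity of the bracket, the left once the Hamiltonian vectors are
  identified.\<close>

lemma Diff_bracket_eq_Dens_bracket:
  assumes f: "f \<in> C_inf A" and g: "g \<in> C_inf A" and \<phi>: "\<phi> \<in> Diff_plus A \<mu>"
  shows "Diff_bracket A \<omega> \<mu> (lin_functional A f \<circ> proj_Dens A \<mu>) (lin_functional A g \<circ> proj_Dens A \<mu>) \<phi>
    = Dens_bracket A \<omega> f g (proj_Dens A \<mu> \<phi>)"
proof -
  have "Dens_bracket A \<omega> f g (proj_Dens A \<mu> \<phi>) = vol_integral A \<mu> (\<lambda>x. poisson_bracket A \<omega> f g (\<phi> x))"
    using lin_functional_proj_Dens[OF \<phi> C_inf_continuous[OF poisson_bracket_C_inf[OF f g]]]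
    by (simp add: Dens_bracket_def lin_functional_def)
  then show ?thesis
    by (simp add: Diff_bracket_def hamiltonian_Diff_eq f g \<phi> W_form_def poisson_bracket_def)
qed

end

text \<open>The clause on unique existence gives meaning to \<open>Diff_bracket\<close>, which rests
  on a definite description; the first clause ensures that the bracket on densities is evaluated at
  an actual density.\<close>

theorem mainTheorem3:
  fixes A :: "('a::{t2_space,second_countable_topology}, 'm::{finite,wellorder}) chart set"
    and \<omega> :: "'a two_form" and \<mu> :: "('a, 'm) top_form" and n :: nat
  assumes "CARD('m) = 2 * n"
    and "compact (UNIV :: 'a set)"
    and "smooth_atlas A"
    and "symplectic_form A \<omega>"
    and "\<mu> = omega_power n \<omega>"
    and "vol_integral A \<mu> (\<lambda>x. 1) = 1"
  shows "proj_Dens A \<mu> ` Diff_plus A \<mu> \<subseteq> Dens A \<mu>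
    \<and> W_right_invariant A \<omega> \<mu>
    \<and> (\<forall>f\<in>C_inf A. \<forall>\<phi>\<in>Diff_plus A \<mu>.
          \<exists>!U. is_hamiltonian_Diff A \<omega> \<mu> (lin_functional A f \<circ> proj_Dens A \<mu>) \<phi> U)
    \<and> (\<forall>f\<in>C_inf A. \<forall>g\<in>C_inf A. \<forall>\<phi>\<in>Diff_plus A \<mu>.
          Diff_bracket A \<omega> \<mu> (lin_functional A f \<circ> proj_Dens A \<mu>)
            (lin_functional A g \<circ> proj_Dens A \<mu>) \<phi>
          = Dens_bracket A \<omega> f g (proj_Dens A \<mu> \<phi>))"
proof -
  interpret S: symplectic_manifold A \<omega> n
    by unfold_locales (use assms in auto)
  \<comment> \<open>The locale has its own name for \<omega>^n, identified here with the given
    \<open>\<mu>\<close>.\<close>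
  have \<mu>: "S.\<mu> = \<mu>" by (simp add: S.\<mu>_def assms(5))
  show ?thesis
  proof (intro conjI ballI)
    show "proj_Dens A \<mu> ` Diff_plus A \<mu> \<subseteq> Dens A \<mu>"
      using S.proj_Dens_in_Dens unfolding \<mu> by (rule image_subsetI)
    show "W_right_invariant A \<omega> \<mu>"
      using S.W_right_invariant_volume unfolding \<mu> .
    show "\<exists>!U. is_hamiltonian_Diff A \<omega> \<mu> (lin_functional A f \<circ> proj_Dens A \<mu>) \<phi> U"
      if "f \<in> C_inf A" "\<phi> \<in> Diff_plus A \<mu>" for f \<phi>
      using S.is_hamiltonian_hamiltonian_field[of f \<phi>] S.hamiltonian_Diff_unique[of f \<phi>] that
      unfolding \<mu> by (intro ex1I) simp_all
    show "Diff_bracket A \<omega> \<mu> (lin_functional A f \<circ> proj_Dens A \<mu>)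
        (lin_functional A g \<circ> proj_Dens A \<mu>) \<phi> = Dens_bracket A \<omega> f g (proj_Dens A \<mu> \<phi>)"
      if "f \<in> C_inf A" "g \<in> C_inf A" "\<phi> \<in> Diff_plus A \<mu>" for f g \<phi>
      using S.Diff_bracket_eq_Dens_bracket[of f g \<phi>] that unfolding \<mu> by simp
  qed
qed

end
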